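(* Let $\mathcal{C}$ and $\mathcal{D}$ be monoidal categories, and let $\mathcal{E}$ be an abelian category equipped with a monoidal structure. Let $F:\mathcal{C}\rightarrow\mathcal{E}$ and $G:\mathcal{D}\rightarrow\mathcal{E}$ be (lax) monoidal functors. (1) If for all $A\in Ob(\mathcal{C})$ the functor $F(A)\otimes -$ is exact, then for any left $\mathcal{C}$-module $\mathcal{M}$ the category of left $F$-modules over $\mathcal{M}$ is an abelian category. (2) If for all $C\in Ob(\mathcal{D})$ the functor $-\otimes G(C)$ is exact, then for any right $\mathcal{D}$-module $\mathcal{M}$ the category of right $G$-modules over $\mathcal{M}$ is an abelian category. (3) If for all $A\in Ob(\mathcal{C})$ the functor $F(A)\otimes -$ is exact and for all $C\in Ob(\mathcal{D})$ the functor $-\otimes G(C)$ is exact, then for any $\mathcal{C},\mathcal{D}$-bimodule $\mathcal{M}$ the category of $F,G$-bimodules over $\mathcal{M}$ is an abelian category.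
   Context: Throughout, all categories are $R$-linear for a fixed commutative ring $R$, and all functors are $R$-linear (in each variable). A monoidal category has structure isomorphisms $\alpha:(A\otimes B)\otimes C\to A\otimes(B\otimes C)$, $\lambda: I\otimes A\to A$, $\rho: A\otimes I\to A$. A (lax) monoidal functor $F$ is a functor equipped with a natural transformation $\tilde F_{A,B}:F(A)\otimes F(B)\to F(A\otimes B)$ and a map $F_0:I\to F(I)$ satisfying the usual associativity and unit coherence conditions (not required to be invertible). Modules over monoidal categories. A (strong) left $\mathcal{C}$-module is a category $\mathcal{M}$ with a functor $\triangleright:\mathcal{C}\times\mathcal{M}\to\mathcal{M}$ and natural isomorphisms $a_l:(A\otimes B)\triangleright X\to A\triangleright(B\triangleright X)$, $\ell: I\triangleright X\to X$ such that $(A\triangleright a_l)\circ a_l\circ(\alpha\triangleright X)=a_l\circ a_l$ as maps $((A\otimes B)\otimes C)\triangleright X\to A\triangleright(B\triangleright(C\triangleright X))$, and $(A\triangleright\ell)\circ a_l=\rho\triangleright X$ as maps $(A\otimes I)\triangleright X\to A\triangleright X$. A (strong) right $\mathcal{D}$-module is a category $\mathcal{M}$ with a functor $\triangleleft:\mathcal{M}\times\mathcal{D}\to\mathcal{M}$ and natural isomorphisms $a_r:(X\triangleleft C)\triangleleft D\to X\triangleleft(C\otimes D)$, $r:X\triangleleft I\to X$ such that $(Y\triangleleft\alpha)\circ a_r\circ(a_r\triangleleft D)=a_r\circ a_r$ as maps $((Y\triangleleft B)\triangleleft C)\triangleleft D\to Y\triangleleft(B\otimes(C\otimes D))$, and $(Y\triangleleft\lambda)\circ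 a_r=r\triangleleft B$ as maps $(Y\triangleleft I)\triangleleft B\to Y\triangleleft B$. A (strong) $\mathcal{C},\mathcal{D}$-bimodule is a category with both a left $\mathcal{C}$-module and a right $\mathcal{D}$-module structure and a natural isomorphism $a_m:(A\triangleright X)\triangleleft C\to A\triangleright(X\triangleleft C)$ such that $(A\triangleright a_m)\circ a_m\circ(a_l\triangleleft D)=a_l\circ a_m$ on $((A\otimes B)\triangleright X)\triangleleft D$, and $(A\triangleright a_r)\circ a_m\circ(a_m\triangleleft D)=a_m\circ a_r$ on $((A\triangleright X)\triangleleft C)\triangleleft D$. Modules over monoidal functors. Let $F:\mathcal{C}\to\mathcal{E}$, $G:\mathcal{D}\to\mathcal{E}$ be monoidal functors. A left $F$-module over a left $\mathcal{C}$-module $\mathcal{M}$ is a functor $M:\mathcal{M}\to\mathcal{E}$ with a natural transformation $\mu_l:F(A)\otimes M(X)\to M(A\triangleright X)$ such that $\mu_l\circ(F(A)\otimes\mu_l)\circ\alpha=M(a_l)\circ\mu_l\circ(\tilde F_{A,B}\otimes M(X))$ as maps $(F(A)\otimes F(B))\otimes M(X)\to M(A\triangleright(B\triangleright X))$, and $M(\ell)\circ\mu_l\circ(F_0\otimes M(X))=\lambda$ as maps $I\otimes M(X)\to M(X)$. A right $G$-module over a right $\mathcal{D}$-module $\mathcal{M}$ is a functor $M:\mathcal{M}\to\mathcal{E}$ with a natural transformation $\mu_r:M(X)\otimes G(C)\to M(X\triangleleft C)$ such that $M(a_r)\circ\mu_r\circ(\mu_r\otimes G(D))=\mu_r\circ(M(X)\otimes\tilde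 G_{C,D})\circ\alpha$ as maps $(M(X)\otimes G(C))\otimes G(D)\to M(X\triangleleft(C\otimes D))$, and $M(r)\circ\mu_r\circ(M(X)\otimes G_0)=\rho$ as maps $M(X)\otimes I\to M(X)$. An $F,G$-bimodule over a $\mathcal{C},\mathcal{D}$-bimodule $\mathcal{M}$ is a functor $M:\mathcal{M}\to\mathcal{E}$ with both structures, satisfying in addition $M(a_m)\circ\mu_r\circ(\mu_l\otimes G(B))=\mu_l\circ(F(A)\otimes\mu_r)\circ\alpha$ as maps $(F(A)\otimes M(X))\otimes G(B)\to M(A\triangleright(X\triangleleft B))$. A left module map from $(M,\mu_l)$ to $(N,\nu_l)$ is a natural transformation $f:M\Rightarrow N$ with $f_{A\triangleright X}\circ\mu_l=\nu_l\circ(F(A)\otimes f_X)$ for all $A,X$; a right module map is a natural transformation satisfying the analogous condition $f_{X\triangleleft C}\circ\mu_r=\nu_r\circ(f_X\otimes G(C))$; a bimodule map satisfies both. These are the morphisms of the respective categories of modules and bimodules over $\mathcal{M}$. *)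

theory Defs
  imports "HOL-Algebra.Module"
begin

section \<open>Linear categories\<close>

text \<open>
  Hom-sets are modules in the sense of HOL-Algebra, whose records also have the ring fields
  \<^const>\<open>mult\<close> and \<^const>\<open>one\<close>; these carry no information here. Only the values of the fields at
  elements of \<open>Obj\<close> and at arrows between such elements are meaningful.
\<close>

record ('r, 'o, 'a) lincat =
  Obj :: "'o set"
  Hom :: "'o \<Rightarrow> 'o \<Rightarrow> ('r, 'a) module"
  Id :: "'o \<Rightarrow> 'a"
  Comp :: "'a \<Rightarrow> 'a \<Rightarrow> 'a" (infixl "\<cdot>\<index>" 70)

definition in_hom :: "'a \<Rightarrow> 'o \<Rightarrow> ('r, 'o, 'a, 'z) lincat_scheme \<Rightarrow> 'o \<Rightarrow> bool"
    ("\<guillemotleft>_ : _ \<rightarrow>\<^bsub>_\<^esub> _\<guillemotright>") where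
  "\<guillemotleft>f : X \<rightarrow>\<^bsub>C\<^esub> Y\<guillemotright> \<longleftrightarrow> X \<in> Obj C \<and> Y \<in> Obj C \<and> f \<in> carrier (Hom C X Y)"

definition Arr :: "('r, 'o, 'a, 'z) lincat_scheme \<Rightarrow> 'a set" where
  "Arr C = {f. \<exists>X Y. \<guillemotleft>f : X \<rightarrow>\<^bsub>C\<^esub> Y\<guillemotright>}"

text \<open>
  Hom-sets are required to be disjoint, so that an arrow determines its domain and codomain and
  operations on arrows (composition, functors, tensor products) need no object arguments.
\<close>

locale linear_category = R?: cring R for R :: "('r, 'm) ring_scheme" (structure) +
  fixes C :: "('r, 'o, 'a, 'z) lincat_scheme"
  assumes hom_module: "\<lbrakk>X \<in> Obj C; Y \<in> Obj C\<rbrakk> \<Longrightarrow> module R (Hom C X Y)"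
    and hom_disjoint: "\<lbrakk>\<guillemotleft>f : X \<rightarrow>\<^bsub>C\<^esub> Y\<guillemotright>; \<guillemotleft>f : X' \<rightarrow>\<^bsub>C\<^esub> Y'\<guillemotright>\<rbrakk> \<Longrightarrow> X = X' \<and> Y = Y'"
    and id_in_hom: "X \<in> Obj C \<Longrightarrow> \<guillemotleft>Id C X : X \<rightarrow>\<^bsub>C\<^esub> X\<guillemotright>"
    and comp_in_hom: "\<lbrakk>\<guillemotleft>f : X \<rightarrow>\<^bsub>C\<^esub> Y\<guillemotright>; \<guillemotleft>g : Y \<rightarrow>\<^bsub>C\<^esub> Z\<guillemotright>\<rbrakk> \<Longrightarrow> \<guillemotleft>g \<cdot>\<^bsub>C\<^esub> f : X \<rightarrow>\<^bsub>C\<^esub> Z\<guillemotright>"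
    and comp_id_left: "\<guillemotleft>f : X \<rightarrow>\<^bsub>C\<^esub> Y\<guillemotright> \<Longrightarrow> Id C Y \<cdot>\<^bsub>C\<^esub> f = f"
    and comp_id_right: "\<guillemotleft>f : X \<rightarrow>\<^bsub>C\<^esub> Y\<guillemotright> \<Longrightarrow> f \<cdot>\<^bsub>C\<^esub> Id C X = f"
    and comp_assoc: "\<lbrakk>\<guillemotleft>f : W \<rightarrow>\<^bsub>C\<^esub> X\<guillemotright>; \<guillemotleft>g : X \<rightarrow>\<^bsub>C\<^esub> Y\<guillemotright>; \<guillemotleft>h : Y \<rightarrow>\<^bsub>C\<^esub> Z\<guillemotright>\<rbrakk>
      \<Longrightarrow> (h \<cdot>\<^bsub>C\<^esub> g) \<cdot>\<^bsub>C\<^esub> f = h \<cdot>\<^bsub>C\<^esub> (g \<cdot>\<^bsub>C\<^esub> f)"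
    and comp_add_left: "\<lbrakk>\<guillemotleft>f : X \<rightarrow>\<^bsub>C\<^esub> Y\<guillemotright>; \<guillemotleft>g : Y \<rightarrow>\<^bsub>C\<^esub> Z\<guillemotright>; \<guillemotleft>g' : Y \<rightarrow>\<^bsub>C\<^esub> Z\<guillemotright>\<rbrakk>
      \<Longrightarrow> (g \<oplus>\<^bsub>Hom C Y Z\<^esub> g') \<cdot>\<^bsub>C\<^esub> f = (g \<cdot>\<^bsub>C\<^esub> f) \<oplus>\<^bsub>Hom C X Z\<^esub> (g' \<cdot>\<^bsub>C\<^esub> f)"
    and comp_add_right: "\<lbrakk>\<guillemotleft>f : X \<rightarrow>\<^bsub>C\<^esub> Y\<guillemotright>; \<guillemotleft>f' : X \<rightarrow>\<^bsub>C\<^esub> Y\<guillemotright>; \<guillemotleft>g : Y \<rightarrow>\<^bsub>C\<^esub> Z\<guillemotright>\<rbrakk>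
      \<Longrightarrow> g \<cdot>\<^bsub>C\<^esub> (f \<oplus>\<^bsub>Hom C X Y\<^esub> f') = (g \<cdot>\<^bsub>C\<^esub> f) \<oplus>\<^bsub>Hom C X Z\<^esub> (g \<cdot>\<^bsub>C\<^esub> f')"
    and comp_smult_left: "\<lbrakk>c \<in> carrier R; \<guillemotleft>f : X \<rightarrow>\<^bsub>C\<^esub> Y\<guillemotright>; \<guillemotleft>g : Y \<rightarrow>\<^bsub>C\<^esub> Z\<guillemotright>\<rbrakk>
      \<Longrightarrow> (c \<odot>\<^bsub>Hom C Y Z\<^esub> g) \<cdot>\<^bsub>C\<^esub> f = c \<odot>\<^bsub>Hom C X Z\<^esub> (g \<cdot>\<^bsub>C\<^esub> f)"
    and comp_smult_right: "\<lbrakk>c \<in> carrier R; \<guillemotleft>f : X \<rightarrow>\<^bsub>C\<^esub> Y\<guillemotright>; \<guillemotleft>g : Y \<rightarrow>\<^bsub>C\<^esub> Z\<guillemotright>\<rbrakk>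
      \<Longrightarrow> g \<cdot>\<^bsub>C\<^esub> (c \<odot>\<^bsub>Hom C X Y\<^esub> f) = c \<odot>\<^bsub>Hom C X Z\<^esub> (g \<cdot>\<^bsub>C\<^esub> f)"

definition is_iso :: "('r, 'o, 'a, 'z) lincat_scheme \<Rightarrow> 'o \<Rightarrow> 'o \<Rightarrow> 'a \<Rightarrow> bool" where
  "is_iso C X Y f \<longleftrightarrow> \<guillemotleft>f : X \<rightarrow>\<^bsub>C\<^esub> Y\<guillemotright> \<and>
    (\<exists>g. \<guillemotleft>g : Y \<rightarrow>\<^bsub>C\<^esub> X\<guillemotright> \<and> g \<cdot>\<^bsub>C\<^esub> f = Id C X \<and> f \<cdot>\<^bsub>C\<^esub> g = Id C Y)"


section \<open>Abelian categories\<close>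

definition is_mono :: "('r, 'o, 'a, 'z) lincat_scheme \<Rightarrow> 'o \<Rightarrow> 'o \<Rightarrow> 'a \<Rightarrow> bool" where
  "is_mono C X Y f \<longleftrightarrow> \<guillemotleft>f : X \<rightarrow>\<^bsub>C\<^esub> Y\<guillemotright> \<and>
    (\<forall>W g h. \<guillemotleft>g : W \<rightarrow>\<^bsub>C\<^esub> X\<guillemotright> \<longrightarrow> \<guillemotleft>h : W \<rightarrow>\<^bsub>C\<^esub> X\<guillemotright> \<longrightarrow> f \<cdot>\<^bsub>C\<^esub> g = f \<cdot>\<^bsub>C\<^esub> h \<longrightarrow> g = h)"

definition is_epi :: "('r, 'o, 'a, 'z) lincat_scheme \<Rightarrow> 'o \<Rightarrow> 'o \<Rightarrow> 'a \<Rightarrow> bool" where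
  "is_epi C X Y f \<longleftrightarrow> \<guillemotleft>f : X \<rightarrow>\<^bsub>C\<^esub> Y\<guillemotright> \<and>
    (\<forall>Z g h. \<guillemotleft>g : Y \<rightarrow>\<^bsub>C\<^esub> Z\<guillemotright> \<longrightarrow> \<guillemotleft>h : Y \<rightarrow>\<^bsub>C\<^esub> Z\<guillemotright> \<longrightarrow> g \<cdot>\<^bsub>C\<^esub> f = h \<cdot>\<^bsub>C\<^esub> f \<longrightarrow> g = h)"

definition is_zero_object :: "('r, 'o, 'a, 'z) lincat_scheme \<Rightarrow> 'o \<Rightarrow> bool" where
  "is_zero_object C Z \<longleftrightarrow> Z \<in> Obj C \<and>
    (\<forall>X \<in> Obj C. (\<exists>!f. \<guillemotleft>f : Z \<rightarrow>\<^bsub>C\<^esub> X\<guillemotright>) \<and> (\<exists>!f. \<guillemotleft>f : X \<rightarrow>\<^bsub>C\<^esub> Z\<guillemotright>))"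

definition is_biproduct ::
  "('r, 'o, 'a, 'z) lincat_scheme \<Rightarrow> 'o \<Rightarrow> 'o \<Rightarrow> 'o \<Rightarrow> 'a \<Rightarrow> 'a \<Rightarrow> 'a \<Rightarrow> 'a \<Rightarrow> bool" where
  "is_biproduct C X Y P i j p q \<longleftrightarrow>
    \<guillemotleft>i : X \<rightarrow>\<^bsub>C\<^esub> P\<guillemotright> \<and> \<guillemotleft>j : Y \<rightarrow>\<^bsub>C\<^esub> P\<guillemotright> \<and> \<guillemotleft>p : P \<rightarrow>\<^bsub>C\<^esub> X\<guillemotright> \<and> \<guillemotleft>q : P \<rightarrow>\<^bsub>C\<^esub> Y\<guillemotright> \<and>
    p \<cdot>\<^bsub>C\<^esub> i = Id C X \<and> q \<cdot>\<^bsub>C\<^esub> j = Id C Y \<and>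
    q \<cdot>\<^bsub>C\<^esub> i = \<zero>\<^bsub>Hom C X Y\<^esub> \<and> p \<cdot>\<^bsub>C\<^esub> j = \<zero>\<^bsub>Hom C Y X\<^esub> \<and>
    (i \<cdot>\<^bsub>C\<^esub> p) \<oplus>\<^bsub>Hom C P P\<^esub> (j \<cdot>\<^bsub>C\<^esub> q) = Id C P"

definition is_kernel ::
  "('r, 'o, 'a, 'z) lincat_scheme \<Rightarrow> 'o \<Rightarrow> 'o \<Rightarrow> 'a \<Rightarrow> 'o \<Rightarrow> 'a \<Rightarrow> bool" where
  "is_kernel C X Y f K k \<longleftrightarrow>
    \<guillemotleft>f : X \<rightarrow>\<^bsub>C\<^esub> Y\<guillemotright> \<and> \<guillemotleft>k : K \<rightarrow>\<^bsub>C\<^esub> X\<guillemotright> \<and> f \<cdot>\<^bsub>C\<^esub> k = \<zero>\<^bsub>Hom C K Y\<^esub> \<and>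
    (\<forall>W h. \<guillemotleft>h : W \<rightarrow>\<^bsub>C\<^esub> X\<guillemotright> \<longrightarrow> f \<cdot>\<^bsub>C\<^esub> h = \<zero>\<^bsub>Hom C W Y\<^esub> \<longrightarrow>
      (\<exists>!u. \<guillemotleft>u : W \<rightarrow>\<^bsub>C\<^esub> K\<guillemotright> \<and> k \<cdot>\<^bsub>C\<^esub> u = h))"

definition is_cokernel ::
  "('r, 'o, 'a, 'z) lincat_scheme \<Rightarrow> 'o \<Rightarrow> 'o \<Rightarrow> 'a \<Rightarrow> 'o \<Rightarrow> 'a \<Rightarrow> bool" where
  "is_cokernel C X Y f Q q \<longleftrightarrow>
    \<guillemotleft>f : X \<rightarrow>\<^bsub>C\<^esub> Y\<guillemotright> \<and> \<guillemotleft>q : Y \<rightarrow>\<^bsub>C\<^esub> Q\<guillemotright> \<and> q \<cdot>\<^bsub>C\<^esub> f = \<zero>\<^bsub>Hom C X Q\<^esub> \<and>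
    (\<forall>W h. \<guillemotleft>h : Y \<rightarrow>\<^bsub>C\<^esub> W\<guillemotright> \<longrightarrow> h \<cdot>\<^bsub>C\<^esub> f = \<zero>\<^bsub>Hom C X W\<^esub> \<longrightarrow>
      (\<exists>!u. \<guillemotleft>u : Q \<rightarrow>\<^bsub>C\<^esub> W\<guillemotright> \<and> u \<cdot>\<^bsub>C\<^esub> q = h))"

locale abelian_category = linear_category R C
  for R :: "('r, 'm) ring_scheme" (structure) and C :: "('r, 'o, 'a, 'z) lincat_scheme" +
  assumes zero_object: "\<exists>Z. is_zero_object C Z"
    and biproducts: "\<lbrakk>X \<in> Obj C; Y \<in> Obj C\<rbrakk> \<Longrightarrow> \<exists>P i j p q. is_biproduct C X Y P i j p q"
    and kernels: "\<guillemotleft>f : X \<rightarrow>\<^bsub>C\<^esub> Y\<guillemotright> \<Longrightarrow> \<exists>K k. is_kernel C X Y f K k"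
    and cokernels: "\<guillemotleft>f : X \<rightarrow>\<^bsub>C\<^esub> Y\<guillemotright> \<Longrightarrow> \<exists>Q q. is_cokernel C X Y f Q q"
    and mono_is_kernel: "is_mono C X Y f \<Longrightarrow> \<exists>Z g. is_kernel C Y Z g X f"
    and epi_is_cokernel: "is_epi C X Y f \<Longrightarrow> \<exists>W g. is_cokernel C W X g Y f"

text \<open>The sequence \<open>0 \<rightarrow> X \<rightarrow> Y \<rightarrow> Z \<rightarrow> 0\<close> with maps \<open>f\<close> and \<open>g\<close> is exact.\<close>

definition short_exact ::
  "('r, 'o, 'a, 'z) lincat_scheme \<Rightarrow> 'o \<Rightarrow> 'o \<Rightarrow> 'o \<Rightarrow> 'a \<Rightarrow> 'a \<Rightarrow> bool" where
  "short_exact C X Y Z f g \<longleftrightarrow> is_kernel C Y Z g X f \<and> is_cokernel C X Y f Z g"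


section \<open>Functors\<close>

record ('o1, 'a1, 'o2, 'a2) ftor =
  omap :: "'o1 \<Rightarrow> 'o2"
  amap :: "'a1 \<Rightarrow> 'a2"

locale linear_functor = source: linear_category R C + target: linear_category R D
  for R :: "('r, 'm) ring_scheme" (structure)
    and C :: "('r, 'o1, 'a1, 'z1) lincat_scheme"
    and D :: "('r, 'o2, 'a2, 'z2) lincat_scheme" +
  fixes F :: "('o1, 'a1, 'o2, 'a2, 'z) ftor_scheme"
  assumes omap_obj: "X \<in> Obj C \<Longrightarrow> omap F X \<in> Obj D"
    and amap_in_hom: "\<guillemotleft>f : X \<rightarrow>\<^bsub>C\<^esub> Y\<guillemotright> \<Longrightarrow> \<guillemotleft>amap F f : omap F X \<rightarrow>\<^bsub>D\<^esub> omap F Y\<guillemotright>"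
    and amap_id: "X \<in> Obj C \<Longrightarrow> amap F (Id C X) = Id D (omap F X)"
    and amap_comp: "\<lbrakk>\<guillemotleft>f : X \<rightarrow>\<^bsub>C\<^esub> Y\<guillemotright>; \<guillemotleft>g : Y \<rightarrow>\<^bsub>C\<^esub> Z\<guillemotright>\<rbrakk>
      \<Longrightarrow> amap F (g \<cdot>\<^bsub>C\<^esub> f) = amap F g \<cdot>\<^bsub>D\<^esub> amap F f"
    and amap_add: "\<lbrakk>\<guillemotleft>f : X \<rightarrow>\<^bsub>C\<^esub> Y\<guillemotright>; \<guillemotleft>f' : X \<rightarrow>\<^bsub>C\<^esub> Y\<guillemotright>\<rbrakk>
      \<Longrightarrow> amap F (f \<oplus>\<^bsub>Hom C X Y\<^esub> f') = amap F f \<oplus>\<^bsub>Hom D (omap F X) (omap F Y)\<^esub> amap F f'"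
    and amap_smult: "\<lbrakk>c \<in> carrier R; \<guillemotleft>f : X \<rightarrow>\<^bsub>C\<^esub> Y\<guillemotright>\<rbrakk>
      \<Longrightarrow> amap F (c \<odot>\<^bsub>Hom C X Y\<^esub> f) = c \<odot>\<^bsub>Hom D (omap F X) (omap F Y)\<^esub> amap F f"

definition exact_functor ::
  "('r, 'o1, 'a1, 'z1) lincat_scheme \<Rightarrow> ('r, 'o2, 'a2, 'z2) lincat_scheme \<Rightarrow>
   ('o1, 'a1, 'o2, 'a2, 'z) ftor_scheme \<Rightarrow> bool" where
  "exact_functor C D F \<longleftrightarrow> (\<forall>X Y Z f g. short_exact C X Y Z f g \<longrightarrow>
    short_exact D (omap F X) (omap F Y) (omap F Z) (amap F f) (amap F g))"

text \<open>A functor of two variables, given by its values on objects and on arrows.\<close>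

locale bilinear_functor =
  left: linear_category R A + right: linear_category R B + target: linear_category R C
  for R :: "('r, 'm) ring_scheme" (structure)
    and A :: "('r, 'o1, 'a1, 'z1) lincat_scheme"
    and B :: "('r, 'o2, 'a2, 'z2) lincat_scheme"
    and C :: "('r, 'o3, 'a3, 'z3) lincat_scheme" +
  fixes To :: "'o1 \<Rightarrow> 'o2 \<Rightarrow> 'o3" and Ta :: "'a1 \<Rightarrow> 'a2 \<Rightarrow> 'a3"
  assumes bi_obj: "\<lbrakk>X \<in> Obj A; Y \<in> Obj B\<rbrakk> \<Longrightarrow> To X Y \<in> Obj C"
    and bi_in_hom: "\<lbrakk>\<guillemotleft>f : X \<rightarrow>\<^bsub>A\<^esub> X'\<guillemotright>; \<guillemotleft>g : Y \<rightarrow>\<^bsub>B\<^esub> Y'\<guillemotright>\<rbrakk>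
      \<Longrightarrow> \<guillemotleft>Ta f g : To X Y \<rightarrow>\<^bsub>C\<^esub> To X' Y'\<guillemotright>"
    and bi_id: "\<lbrakk>X \<in> Obj A; Y \<in> Obj B\<rbrakk> \<Longrightarrow> Ta (Id A X) (Id B Y) = Id C (To X Y)"
    and bi_comp: "\<lbrakk>\<guillemotleft>f : X \<rightarrow>\<^bsub>A\<^esub> X'\<guillemotright>; \<guillemotleft>f' : X' \<rightarrow>\<^bsub>A\<^esub> X''\<guillemotright>; \<guillemotleft>g : Y \<rightarrow>\<^bsub>B\<^esub> Y'\<guillemotright>; \<guillemotleft>g' : Y' \<rightarrow>\<^bsub>B\<^esub> Y''\<guillemotright>\<rbrakk>
      \<Longrightarrow> Ta (f' \<cdot>\<^bsub>A\<^esub> f) (g' \<cdot>\<^bsub>B\<^esub> g) = Ta f' g' \<cdot>\<^bsub>C\<^esub> Ta f g"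
    and bi_add_left: "\<lbrakk>\<guillemotleft>f : X \<rightarrow>\<^bsub>A\<^esub> X'\<guillemotright>; \<guillemotleft>f' : X \<rightarrow>\<^bsub>A\<^esub> X'\<guillemotright>; \<guillemotleft>g : Y \<rightarrow>\<^bsub>B\<^esub> Y'\<guillemotright>\<rbrakk>
      \<Longrightarrow> Ta (f \<oplus>\<^bsub>Hom A X X'\<^esub> f') g = Ta f g \<oplus>\<^bsub>Hom C (To X Y) (To X' Y')\<^esub> Ta f' g"
    and bi_add_right: "\<lbrakk>\<guillemotleft>f : X \<rightarrow>\<^bsub>A\<^esub> X'\<guillemotright>; \<guillemotleft>g : Y \<rightarrow>\<^bsub>B\<^esub> Y'\<guillemotright>; \<guillemotleft>g' : Y \<rightarrow>\<^bsub>B\<^esub> Y'\<guillemotright>\<rbrakk>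
      \<Longrightarrow> Ta f (g \<oplus>\<^bsub>Hom B Y Y'\<^esub> g') = Ta f g \<oplus>\<^bsub>Hom C (To X Y) (To X' Y')\<^esub> Ta f g'"
    and bi_smult_left: "\<lbrakk>c \<in> carrier R; \<guillemotleft>f : X \<rightarrow>\<^bsub>A\<^esub> X'\<guillemotright>; \<guillemotleft>g : Y \<rightarrow>\<^bsub>B\<^esub> Y'\<guillemotright>\<rbrakk>
      \<Longrightarrow> Ta (c \<odot>\<^bsub>Hom A X X'\<^esub> f) g = c \<odot>\<^bsub>Hom C (To X Y) (To X' Y')\<^esub> Ta f g"
    and bi_smult_right: "\<lbrakk>c \<in> carrier R; \<guillemotleft>f : X \<rightarrow>\<^bsub>A\<^esub> X'\<guillemotright>; \<guillemotleft>g : Y \<rightarrow>\<^bsub>B\<^esub> Y'\<guillemotright>\<rbrakk>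
      \<Longrightarrow> Ta f (c \<odot>\<^bsub>Hom B Y Y'\<^esub> g) = c \<odot>\<^bsub>Hom C (To X Y) (To X' Y')\<^esub> Ta f g"

definition natural ::
  "('r, 'o1, 'a1, 'z1) lincat_scheme \<Rightarrow> ('r, 'o2, 'a2, 'z2) lincat_scheme \<Rightarrow>
   ('o1, 'a1, 'o2, 'a2, 'y1) ftor_scheme \<Rightarrow> ('o1, 'a1, 'o2, 'a2, 'y2) ftor_scheme \<Rightarrow>
   ('o1 \<Rightarrow> 'a2) \<Rightarrow> bool" where
  "natural C D F G \<eta> \<longleftrightarrow>
    (\<forall>X \<in> Obj C. \<guillemotleft>\<eta> X : omap F X \<rightarrow>\<^bsub>D\<^esub> omap G X\<guillemotright>) \<and>
    (\<forall>X Y f. \<guillemotleft>f : X \<rightarrow>\<^bsub>C\<^esub> Y\<guillemotright> \<longrightarrow> \<eta> Y \<cdot>\<^bsub>D\<^esub> amap F f = amap G f \<cdot>\<^bsub>D\<^esub> \<eta> X)"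


section \<open>Monoidal categories and lax monoidal functors\<close>

record ('r, 'o, 'a) moncat = "('r, 'o, 'a) lincat" +
  tenO :: "'o \<Rightarrow> 'o \<Rightarrow> 'o" (infixr "\<otimes>\<^sub>o\<index>" 75)
  tenA :: "'a \<Rightarrow> 'a \<Rightarrow> 'a" (infixr "\<otimes>\<^sub>a\<index>" 75)
  munit :: 'o
  associator :: "'o \<Rightarrow> 'o \<Rightarrow> 'o \<Rightarrow> 'a"
  lunitor :: "'o \<Rightarrow> 'a"
  runitor :: "'o \<Rightarrow> 'a"

locale monoidal_category = bilinear_functor R C C C "tenO C" "tenA C"
  for R :: "('r, 'm) ring_scheme" (structure) and C :: "('r, 'o, 'a, 'z) moncat_scheme" +
  assumes munit_obj: "munit C \<in> Obj C"
    and associator_iso: "\<lbrakk>X \<in> Obj C; Y \<in> Obj C; Z \<in> Obj C\<rbrakk>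
      \<Longrightarrow> is_iso C ((X \<otimes>\<^sub>o\<^bsub>C\<^esub> Y) \<otimes>\<^sub>o\<^bsub>C\<^esub> Z) (X \<otimes>\<^sub>o\<^bsub>C\<^esub> (Y \<otimes>\<^sub>o\<^bsub>C\<^esub> Z)) (associator C X Y Z)"
    and associator_natural: "\<lbrakk>\<guillemotleft>f : X \<rightarrow>\<^bsub>C\<^esub> X'\<guillemotright>; \<guillemotleft>g : Y \<rightarrow>\<^bsub>C\<^esub> Y'\<guillemotright>; \<guillemotleft>h : Z \<rightarrow>\<^bsub>C\<^esub> Z'\<guillemotright>\<rbrakk>
      \<Longrightarrow> associator C X' Y' Z' \<cdot>\<^bsub>C\<^esub> ((f \<otimes>\<^sub>a\<^bsub>C\<^esub> g) \<otimes>\<^sub>a\<^bsub>C\<^esub> h)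
        = (f \<otimes>\<^sub>a\<^bsub>C\<^esub> (g \<otimes>\<^sub>a\<^bsub>C\<^esub> h)) \<cdot>\<^bsub>C\<^esub> associator C X Y Z"
    and lunitor_iso: "X \<in> Obj C \<Longrightarrow> is_iso C (munit C \<otimes>\<^sub>o\<^bsub>C\<^esub> X) X (lunitor C X)"
    and lunitor_natural: "\<guillemotleft>f : X \<rightarrow>\<^bsub>C\<^esub> Y\<guillemotright>
      \<Longrightarrow> lunitor C Y \<cdot>\<^bsub>C\<^esub> (Id C (munit C) \<otimes>\<^sub>a\<^bsub>C\<^esub> f) = f \<cdot>\<^bsub>C\<^esub> lunitor C X"
    and runitor_iso: "X \<in> Obj C \<Longrightarrow> is_iso C (X \<otimes>\<^sub>o\<^bsub>C\<^esub> munit C) X (runitor C X)"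
    and runitor_natural: "\<guillemotleft>f : X \<rightarrow>\<^bsub>C\<^esub> Y\<guillemotright>
      \<Longrightarrow> runitor C Y \<cdot>\<^bsub>C\<^esub> (f \<otimes>\<^sub>a\<^bsub>C\<^esub> Id C (munit C)) = f \<cdot>\<^bsub>C\<^esub> runitor C X"
    and pentagon: "\<lbrakk>W \<in> Obj C; X \<in> Obj C; Y \<in> Obj C; Z \<in> Obj C\<rbrakk>
      \<Longrightarrow> (Id C W \<otimes>\<^sub>a\<^bsub>C\<^esub> associator C X Y Z) \<cdot>\<^bsub>C\<^esub> associator C W (X \<otimes>\<^sub>o\<^bsub>C\<^esub> Y) Z
            \<cdot>\<^bsub>C\<^esub> (associator C W X Y \<otimes>\<^sub>a\<^bsub>C\<^esub> Id C Z)
        = associator C W X (Y \<otimes>\<^sub>o\<^bsub>C\<^esub> Z) \<cdot>\<^bsub>C\<^esub> associator C (W \<otimes>\<^sub>o\<^bsub>C\<^esub> X) Y Z"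
    and triangle: "\<lbrakk>X \<in> Obj C; Y \<in> Obj C\<rbrakk>
      \<Longrightarrow> (Id C X \<otimes>\<^sub>a\<^bsub>C\<^esub> lunitor C Y) \<cdot>\<^bsub>C\<^esub> associator C X (munit C) Y
        = runitor C X \<otimes>\<^sub>a\<^bsub>C\<^esub> Id C Y"

definition tensor_left :: "('r, 'o, 'a, 'z) moncat_scheme \<Rightarrow> 'o \<Rightarrow> ('o, 'a, 'o, 'a) ftor" where
  "tensor_left C X = \<lparr>omap = (\<lambda>Y. X \<otimes>\<^sub>o\<^bsub>C\<^esub> Y), amap = (\<lambda>g. Id C X \<otimes>\<^sub>a\<^bsub>C\<^esub> g)\<rparr>"

definition tensor_right :: "('r, 'o, 'a, 'z) moncat_scheme \<Rightarrow> 'o \<Rightarrow> ('o, 'a, 'o, 'a) ftor" where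
  "tensor_right C X = \<lparr>omap = (\<lambda>Y. Y \<otimes>\<^sub>o\<^bsub>C\<^esub> X), amap = (\<lambda>g. g \<otimes>\<^sub>a\<^bsub>C\<^esub> Id C X)\<rparr>"

record ('o1, 'a1, 'o2, 'a2) lax_ftor = "('o1, 'a1, 'o2, 'a2) ftor" +
  lax_mult :: "'o1 \<Rightarrow> 'o1 \<Rightarrow> 'a2"
  lax_unit :: 'a2

locale monoidal_functor =
  source: monoidal_category R C + target: monoidal_category R E + linear_functor R C E F
  for R :: "('r, 'm) ring_scheme" (structure)
    and C :: "('r, 'o1, 'a1, 'z1) moncat_scheme"
    and E :: "('r, 'o2, 'a2, 'z2) moncat_scheme"
    and F :: "('o1, 'a1, 'o2, 'a2, 'z) lax_ftor_scheme" +
  assumes lax_mult_in_hom: "\<lbrakk>A \<in> Obj C; B \<in> Obj C\<rbrakk>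
      \<Longrightarrow> \<guillemotleft>lax_mult F A B : omap F A \<otimes>\<^sub>o\<^bsub>E\<^esub> omap F B \<rightarrow>\<^bsub>E\<^esub> omap F (A \<otimes>\<^sub>o\<^bsub>C\<^esub> B)\<guillemotright>"
    and lax_mult_natural: "\<lbrakk>\<guillemotleft>f : A \<rightarrow>\<^bsub>C\<^esub> A'\<guillemotright>; \<guillemotleft>g : B \<rightarrow>\<^bsub>C\<^esub> B'\<guillemotright>\<rbrakk>
      \<Longrightarrow> lax_mult F A' B' \<cdot>\<^bsub>E\<^esub> (amap F f \<otimes>\<^sub>a\<^bsub>E\<^esub> amap F g) = amap F (f \<otimes>\<^sub>a\<^bsub>C\<^esub> g) \<cdot>\<^bsub>E\<^esub> lax_mult F A B"
    and lax_unit_in_hom: "\<guillemotleft>lax_unit F : munit E \<rightarrow>\<^bsub>E\<^esub> omap F (munit C)\<guillemotright>"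
    and lax_assoc: "\<lbrakk>A \<in> Obj C; B \<in> Obj C; D \<in> Obj C\<rbrakk>
      \<Longrightarrow> amap F (associator C A B D) \<cdot>\<^bsub>E\<^esub> lax_mult F (A \<otimes>\<^sub>o\<^bsub>C\<^esub> B) D
            \<cdot>\<^bsub>E\<^esub> (lax_mult F A B \<otimes>\<^sub>a\<^bsub>E\<^esub> Id E (omap F D))
        = lax_mult F A (B \<otimes>\<^sub>o\<^bsub>C\<^esub> D) \<cdot>\<^bsub>E\<^esub> (Id E (omap F A) \<otimes>\<^sub>a\<^bsub>E\<^esub> lax_mult F B D)
            \<cdot>\<^bsub>E\<^esub> associator E (omap F A) (omap F B) (omap F D)"
    and lax_unit_left: "A \<in> Obj C
      \<Longrightarrow> amap F (lunitor C A) \<cdot>\<^bsub>E\<^esub> lax_mult F (munit C) A \<cdot>\<^bsub>E\<^esub> (lax_unit F \<otimes>\<^sub>a\<^bsub>E\<^esub> Id E (omap F A))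
        = lunitor E (omap F A)"
    and lax_unit_right: "A \<in> Obj C
      \<Longrightarrow> amap F (runitor C A) \<cdot>\<^bsub>E\<^esub> lax_mult F A (munit C) \<cdot>\<^bsub>E\<^esub> (Id E (omap F A) \<otimes>\<^sub>a\<^bsub>E\<^esub> lax_unit F)
        = runitor E (omap F A)"


section \<open>Modules over monoidal categories\<close>

text \<open>
  The actions are kept separate from the underlying category, so that a bimodule consists of
  one category together with a left and a right action.
\<close>

record ('co, 'ca, 'mo, 'ma) lact =
  lactO :: "'co \<Rightarrow> 'mo \<Rightarrow> 'mo" (infixr "\<triangleright>\<^sub>o\<index>" 75)
  lactA :: "'ca \<Rightarrow> 'ma \<Rightarrow> 'ma" (infixr "\<triangleright>\<^sub>a\<index>" 75)
  lassoc :: "'co \<Rightarrow> 'co \<Rightarrow> 'mo \<Rightarrow> 'ma"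
  lunit :: "'mo \<Rightarrow> 'ma"

record ('do, 'da, 'mo, 'ma) ract =
  ractO :: "'mo \<Rightarrow> 'do \<Rightarrow> 'mo" (infixl "\<triangleleft>\<^sub>o\<index>" 75)
  ractA :: "'ma \<Rightarrow> 'da \<Rightarrow> 'ma" (infixl "\<triangleleft>\<^sub>a\<index>" 75)
  rassoc :: "'mo \<Rightarrow> 'do \<Rightarrow> 'do \<Rightarrow> 'ma"
  runit :: "'mo \<Rightarrow> 'ma"

locale left_module_category =
  acting: monoidal_category R C + action: bilinear_functor R C M M "lactO L" "lactA L"
  for R :: "('r, 'm) ring_scheme" (structure)
    and C :: "('r, 'co, 'ca, 'z1) moncat_scheme"
    and M :: "('r, 'mo, 'ma, 'z2) lincat_scheme"
    and L :: "('co, 'ca, 'mo, 'ma, 'z3) lact_scheme" +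
  assumes lassoc_iso: "\<lbrakk>A \<in> Obj C; B \<in> Obj C; X \<in> Obj M\<rbrakk>
      \<Longrightarrow> is_iso M ((A \<otimes>\<^sub>o\<^bsub>C\<^esub> B) \<triangleright>\<^sub>o\<^bsub>L\<^esub> X) (A \<triangleright>\<^sub>o\<^bsub>L\<^esub> (B \<triangleright>\<^sub>o\<^bsub>L\<^esub> X)) (lassoc L A B X)"
    and lassoc_natural: "\<lbrakk>\<guillemotleft>f : A \<rightarrow>\<^bsub>C\<^esub> A'\<guillemotright>; \<guillemotleft>g : B \<rightarrow>\<^bsub>C\<^esub> B'\<guillemotright>; \<guillemotleft>h : X \<rightarrow>\<^bsub>M\<^esub> X'\<guillemotright>\<rbrakk>
      \<Longrightarrow> lassoc L A' B' X' \<cdot>\<^bsub>M\<^esub> ((f \<otimes>\<^sub>a\<^bsub>C\<^esub> g) \<triangleright>\<^sub>a\<^bsub>L\<^esub> h) = (f \<triangleright>\<^sub>a\<^bsub>L\<^esub> (g \<triangleright>\<^sub>a\<^bsub>L\<^esub> h)) \<cdot>\<^bsub>M\<^esub> lassoc L A B X"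
    and lunit_iso: "X \<in> Obj M \<Longrightarrow> is_iso M (munit C \<triangleright>\<^sub>o\<^bsub>L\<^esub> X) X (lunit L X)"
    and lunit_natural: "\<guillemotleft>h : X \<rightarrow>\<^bsub>M\<^esub> X'\<guillemotright>
      \<Longrightarrow> lunit L X' \<cdot>\<^bsub>M\<^esub> (Id C (munit C) \<triangleright>\<^sub>a\<^bsub>L\<^esub> h) = h \<cdot>\<^bsub>M\<^esub> lunit L X"
    and lassoc_coherence: "\<lbrakk>A \<in> Obj C; B \<in> Obj C; D \<in> Obj C; X \<in> Obj M\<rbrakk>
      \<Longrightarrow> (Id C A \<triangleright>\<^sub>a\<^bsub>L\<^esub> lassoc L B D X) \<cdot>\<^bsub>M\<^esub> lassoc L A (B \<otimes>\<^sub>o\<^bsub>C\<^esub> D) X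
            \<cdot>\<^bsub>M\<^esub> (associator C A B D \<triangleright>\<^sub>a\<^bsub>L\<^esub> Id M X)
        = lassoc L A B (D \<triangleright>\<^sub>o\<^bsub>L\<^esub> X) \<cdot>\<^bsub>M\<^esub> lassoc L (A \<otimes>\<^sub>o\<^bsub>C\<^esub> B) D X"
    and lunit_coherence: "\<lbrakk>A \<in> Obj C; X \<in> Obj M\<rbrakk>
      \<Longrightarrow> (Id C A \<triangleright>\<^sub>a\<^bsub>L\<^esub> lunit L X) \<cdot>\<^bsub>M\<^esub> lassoc L A (munit C) X = runitor C A \<triangleright>\<^sub>a\<^bsub>L\<^esub> Id M X"

locale right_module_category =
  acting: monoidal_category R D + action: bilinear_functor R M D M "ractO T" "ractA T"
  for R :: "('r, 'm) ring_scheme" (structure)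
    and D :: "('r, 'do, 'da, 'z1) moncat_scheme"
    and M :: "('r, 'mo, 'ma, 'z2) lincat_scheme"
    and T :: "('do, 'da, 'mo, 'ma, 'z3) ract_scheme" +
  assumes rassoc_iso: "\<lbrakk>X \<in> Obj M; A \<in> Obj D; B \<in> Obj D\<rbrakk>
      \<Longrightarrow> is_iso M ((X \<triangleleft>\<^sub>o\<^bsub>T\<^esub> A) \<triangleleft>\<^sub>o\<^bsub>T\<^esub> B) (X \<triangleleft>\<^sub>o\<^bsub>T\<^esub> (A \<otimes>\<^sub>o\<^bsub>D\<^esub> B)) (rassoc T X A B)"
    and rassoc_natural: "\<lbrakk>\<guillemotleft>h : X \<rightarrow>\<^bsub>M\<^esub> X'\<guillemotright>; \<guillemotleft>f : A \<rightarrow>\<^bsub>D\<^esub> A'\<guillemotright>; \<guillemotleft>g : B \<rightarrow>\<^bsub>D\<^esub> B'\<guillemotright>\<rbrakk>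
      \<Longrightarrow> rassoc T X' A' B' \<cdot>\<^bsub>M\<^esub> ((h \<triangleleft>\<^sub>a\<^bsub>T\<^esub> f) \<triangleleft>\<^sub>a\<^bsub>T\<^esub> g) = (h \<triangleleft>\<^sub>a\<^bsub>T\<^esub> (f \<otimes>\<^sub>a\<^bsub>D\<^esub> g)) \<cdot>\<^bsub>M\<^esub> rassoc T X A B"
    and runit_iso: "X \<in> Obj M \<Longrightarrow> is_iso M (X \<triangleleft>\<^sub>o\<^bsub>T\<^esub> munit D) X (runit T X)"
    and runit_natural: "\<guillemotleft>h : X \<rightarrow>\<^bsub>M\<^esub> X'\<guillemotright>
      \<Longrightarrow> runit T X' \<cdot>\<^bsub>M\<^esub> (h \<triangleleft>\<^sub>a\<^bsub>T\<^esub> Id D (munit D)) = h \<cdot>\<^bsub>M\<^esub> runit T X"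
    and rassoc_coherence: "\<lbrakk>Y \<in> Obj M; A \<in> Obj D; B \<in> Obj D; K \<in> Obj D\<rbrakk>
      \<Longrightarrow> (Id M Y \<triangleleft>\<^sub>a\<^bsub>T\<^esub> associator D A B K) \<cdot>\<^bsub>M\<^esub> rassoc T Y (A \<otimes>\<^sub>o\<^bsub>D\<^esub> B) K
            \<cdot>\<^bsub>M\<^esub> (rassoc T Y A B \<triangleleft>\<^sub>a\<^bsub>T\<^esub> Id D K)
        = rassoc T Y A (B \<otimes>\<^sub>o\<^bsub>D\<^esub> K) \<cdot>\<^bsub>M\<^esub> rassoc T (Y \<triangleleft>\<^sub>o\<^bsub>T\<^esub> A) B K"
    and runit_coherence: "\<lbrakk>Y \<in> Obj M; B \<in> Obj D\<rbrakk>
      \<Longrightarrow> (Id M Y \<triangleleft>\<^sub>a\<^bsub>T\<^esub> lunitor D B) \<cdot>\<^bsub>M\<^esub> rassoc T Y (munit D) B = runit T Y \<triangleleft>\<^sub>a\<^bsub>T\<^esub> Id D B"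

locale bimodule_category =
  left: left_module_category R C M L + right: right_module_category R D M T
  for R :: "('r, 'm) ring_scheme" (structure)
    and C :: "('r, 'co, 'ca, 'z1) moncat_scheme"
    and D :: "('r, 'do, 'da, 'z2) moncat_scheme"
    and M :: "('r, 'mo, 'ma, 'z3) lincat_scheme"
    and L :: "('co, 'ca, 'mo, 'ma, 'z4) lact_scheme"
    and T :: "('do, 'da, 'mo, 'ma, 'z5) ract_scheme" +
  fixes am :: "'co \<Rightarrow> 'mo \<Rightarrow> 'do \<Rightarrow> 'ma"
  assumes am_iso: "\<lbrakk>A \<in> Obj C; X \<in> Obj M; K \<in> Obj D\<rbrakk>
      \<Longrightarrow> is_iso M ((A \<triangleright>\<^sub>o\<^bsub>L\<^esub> X) \<triangleleft>\<^sub>o\<^bsub>T\<^esub> K) (A \<triangleright>\<^sub>o\<^bsub>L\<^esub> (X \<triangleleft>\<^sub>o\<^bsub>T\<^esub> K)) (am A X K)"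
    and am_natural: "\<lbrakk>\<guillemotleft>f : A \<rightarrow>\<^bsub>C\<^esub> A'\<guillemotright>; \<guillemotleft>h : X \<rightarrow>\<^bsub>M\<^esub> X'\<guillemotright>; \<guillemotleft>g : K \<rightarrow>\<^bsub>D\<^esub> K'\<guillemotright>\<rbrakk>
      \<Longrightarrow> am A' X' K' \<cdot>\<^bsub>M\<^esub> ((f \<triangleright>\<^sub>a\<^bsub>L\<^esub> h) \<triangleleft>\<^sub>a\<^bsub>T\<^esub> g) = (f \<triangleright>\<^sub>a\<^bsub>L\<^esub> (h \<triangleleft>\<^sub>a\<^bsub>T\<^esub> g)) \<cdot>\<^bsub>M\<^esub> am A X K"
    and am_left_coherence: "\<lbrakk>A \<in> Obj C; B \<in> Obj C; X \<in> Obj M; K \<in> Obj D\<rbrakk>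
      \<Longrightarrow> (Id C A \<triangleright>\<^sub>a\<^bsub>L\<^esub> am B X K) \<cdot>\<^bsub>M\<^esub> am A (B \<triangleright>\<^sub>o\<^bsub>L\<^esub> X) K \<cdot>\<^bsub>M\<^esub> (lassoc L A B X \<triangleleft>\<^sub>a\<^bsub>T\<^esub> Id D K)
        = lassoc L A B (X \<triangleleft>\<^sub>o\<^bsub>T\<^esub> K) \<cdot>\<^bsub>M\<^esub> am (A \<otimes>\<^sub>o\<^bsub>C\<^esub> B) X K"
    and am_right_coherence: "\<lbrakk>A \<in> Obj C; X \<in> Obj M; J \<in> Obj D; K \<in> Obj D\<rbrakk>
      \<Longrightarrow> (Id C A \<triangleright>\<^sub>a\<^bsub>L\<^esub> rassoc T X J K) \<cdot>\<^bsub>M\<^esub> am A (X \<triangleleft>\<^sub>o\<^bsub>T\<^esub> J) K \<cdot>\<^bsub>M\<^esub> (am A X J \<triangleleft>\<^sub>a\<^bsub>T\<^esub> Id D K)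
        = am A X (J \<otimes>\<^sub>o\<^bsub>D\<^esub> K) \<cdot>\<^bsub>M\<^esub> rassoc T (A \<triangleright>\<^sub>o\<^bsub>L\<^esub> X) J K"


section \<open>Modules over monoidal functors\<close>

locale left_functor_module = linear_functor R M E N
  for R :: "('r, 'm) ring_scheme" (structure)
    and C :: "('r, 'co, 'ca, 'z1) moncat_scheme"
    and E :: "('r, 'eo, 'ea, 'z2) moncat_scheme"
    and F :: "('co, 'ca, 'eo, 'ea, 'z3) lax_ftor_scheme"
    and M :: "('r, 'mo, 'ma, 'z4) lincat_scheme"
    and L :: "('co, 'ca, 'mo, 'ma, 'z5) lact_scheme"
    and N :: "('mo, 'ma, 'eo, 'ea, 'z6) ftor_scheme" +
  fixes \<mu> :: "'co \<Rightarrow> 'mo \<Rightarrow> 'ea"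
  assumes lmult_in_hom: "\<lbrakk>A \<in> Obj C; X \<in> Obj M\<rbrakk>
      \<Longrightarrow> \<guillemotleft>\<mu> A X : omap F A \<otimes>\<^sub>o\<^bsub>E\<^esub> omap N X \<rightarrow>\<^bsub>E\<^esub> omap N (A \<triangleright>\<^sub>o\<^bsub>L\<^esub> X)\<guillemotright>"
    and lmult_natural: "\<lbrakk>\<guillemotleft>f : A \<rightarrow>\<^bsub>C\<^esub> A'\<guillemotright>; \<guillemotleft>h : X \<rightarrow>\<^bsub>M\<^esub> X'\<guillemotright>\<rbrakk>
      \<Longrightarrow> \<mu> A' X' \<cdot>\<^bsub>E\<^esub> (amap F f \<otimes>\<^sub>a\<^bsub>E\<^esub> amap N h) = amap N (f \<triangleright>\<^sub>a\<^bsub>L\<^esub> h) \<cdot>\<^bsub>E\<^esub> \<mu> A X"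
    and lmult_assoc: "\<lbrakk>A \<in> Obj C; B \<in> Obj C; X \<in> Obj M\<rbrakk>
      \<Longrightarrow> \<mu> A (B \<triangleright>\<^sub>o\<^bsub>L\<^esub> X) \<cdot>\<^bsub>E\<^esub> (Id E (omap F A) \<otimes>\<^sub>a\<^bsub>E\<^esub> \<mu> B X)
            \<cdot>\<^bsub>E\<^esub> associator E (omap F A) (omap F B) (omap N X)
        = amap N (lassoc L A B X) \<cdot>\<^bsub>E\<^esub> \<mu> (A \<otimes>\<^sub>o\<^bsub>C\<^esub> B) X \<cdot>\<^bsub>E\<^esub> (lax_mult F A B \<otimes>\<^sub>a\<^bsub>E\<^esub> Id E (omap N X))"
    and lmult_unit: "X \<in> Obj M
      \<Longrightarrow> amap N (lunit L X) \<cdot>\<^bsub>E\<^esub> \<mu> (munit C) X \<cdot>\<^bsub>E\<^esub> (lax_unit F \<otimes>\<^sub>a\<^bsub>E\<^esub> Id E (omap N X))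
        = lunitor E (omap N X)"

locale right_functor_module = linear_functor R M E N
  for R :: "('r, 'm) ring_scheme" (structure)
    and D :: "('r, 'do, 'da, 'z1) moncat_scheme"
    and E :: "('r, 'eo, 'ea, 'z2) moncat_scheme"
    and G :: "('do, 'da, 'eo, 'ea, 'z3) lax_ftor_scheme"
    and M :: "('r, 'mo, 'ma, 'z4) lincat_scheme"
    and T :: "('do, 'da, 'mo, 'ma, 'z5) ract_scheme"
    and N :: "('mo, 'ma, 'eo, 'ea, 'z6) ftor_scheme" +
  fixes \<mu> :: "'mo \<Rightarrow> 'do \<Rightarrow> 'ea"
  assumes rmult_in_hom: "\<lbrakk>X \<in> Obj M; A \<in> Obj D\<rbrakk>
      \<Longrightarrow> \<guillemotleft>\<mu> X A : omap N X \<otimes>\<^sub>o\<^bsub>E\<^esub> omap G A \<rightarrow>\<^bsub>E\<^esub> omap N (X \<triangleleft>\<^sub>o\<^bsub>T\<^esub> A)\<guillemotright>"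
    and rmult_natural: "\<lbrakk>\<guillemotleft>h : X \<rightarrow>\<^bsub>M\<^esub> X'\<guillemotright>; \<guillemotleft>f : A \<rightarrow>\<^bsub>D\<^esub> A'\<guillemotright>\<rbrakk>
      \<Longrightarrow> \<mu> X' A' \<cdot>\<^bsub>E\<^esub> (amap N h \<otimes>\<^sub>a\<^bsub>E\<^esub> amap G f) = amap N (h \<triangleleft>\<^sub>a\<^bsub>T\<^esub> f) \<cdot>\<^bsub>E\<^esub> \<mu> X A"
    and rmult_assoc: "\<lbrakk>X \<in> Obj M; A \<in> Obj D; B \<in> Obj D\<rbrakk>
      \<Longrightarrow> amap N (rassoc T X A B) \<cdot>\<^bsub>E\<^esub> \<mu> (X \<triangleleft>\<^sub>o\<^bsub>T\<^esub> A) B \<cdot>\<^bsub>E\<^esub> (\<mu> X A \<otimes>\<^sub>a\<^bsub>E\<^esub> Id E (omap G B))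
        = \<mu> X (A \<otimes>\<^sub>o\<^bsub>D\<^esub> B) \<cdot>\<^bsub>E\<^esub> (Id E (omap N X) \<otimes>\<^sub>a\<^bsub>E\<^esub> lax_mult G A B)
            \<cdot>\<^bsub>E\<^esub> associator E (omap N X) (omap G A) (omap G B)"
    and rmult_unit: "X \<in> Obj M
      \<Longrightarrow> amap N (runit T X) \<cdot>\<^bsub>E\<^esub> \<mu> X (munit D) \<cdot>\<^bsub>E\<^esub> (Id E (omap N X) \<otimes>\<^sub>a\<^bsub>E\<^esub> lax_unit G)
        = runitor E (omap N X)"

locale functor_bimodule =
  left: left_functor_module R C E F M L N \<mu>l + right: right_functor_module R D E G M T N \<mu>r
  for R :: "('r, 'm) ring_scheme" (structure)
    and C :: "('r, 'co, 'ca, 'z1) moncat_scheme"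
    and D :: "('r, 'do, 'da, 'z2) moncat_scheme"
    and E :: "('r, 'eo, 'ea, 'z3) moncat_scheme"
    and F :: "('co, 'ca, 'eo, 'ea, 'z4) lax_ftor_scheme"
    and G :: "('do, 'da, 'eo, 'ea, 'z5) lax_ftor_scheme"
    and M :: "('r, 'mo, 'ma, 'z6) lincat_scheme"
    and L :: "('co, 'ca, 'mo, 'ma, 'z7) lact_scheme"
    and T :: "('do, 'da, 'mo, 'ma, 'z8) ract_scheme"
    and am :: "'co \<Rightarrow> 'mo \<Rightarrow> 'do \<Rightarrow> 'ma"
    and N :: "('mo, 'ma, 'eo, 'ea, 'z9) ftor_scheme"
    and \<mu>l :: "'co \<Rightarrow> 'mo \<Rightarrow> 'ea" and \<mu>r :: "'mo \<Rightarrow> 'do \<Rightarrow> 'ea" +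
  assumes mult_compat: "\<lbrakk>A \<in> Obj C; X \<in> Obj M; B \<in> Obj D\<rbrakk>
      \<Longrightarrow> amap N (am A X B) \<cdot>\<^bsub>E\<^esub> \<mu>r (A \<triangleright>\<^sub>o\<^bsub>L\<^esub> X) B \<cdot>\<^bsub>E\<^esub> (\<mu>l A X \<otimes>\<^sub>a\<^bsub>E\<^esub> Id E (omap G B))
        = \<mu>l A (X \<triangleleft>\<^sub>o\<^bsub>T\<^esub> B) \<cdot>\<^bsub>E\<^esub> (Id E (omap F A) \<otimes>\<^sub>a\<^bsub>E\<^esub> \<mu>r X B)
            \<cdot>\<^bsub>E\<^esub> associator E (omap F A) (omap N X) (omap G B)"

definition left_module_map ::
  "('r, 'co, 'ca, 'z1) moncat_scheme \<Rightarrow> ('r, 'eo, 'ea, 'z2) moncat_scheme \<Rightarrow>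
   ('co, 'ca, 'eo, 'ea, 'z3) lax_ftor_scheme \<Rightarrow> ('r, 'mo, 'ma, 'z4) lincat_scheme \<Rightarrow>
   ('co, 'ca, 'mo, 'ma, 'z5) lact_scheme \<Rightarrow>
   ('co \<Rightarrow> 'mo \<Rightarrow> 'ea) \<Rightarrow> ('co \<Rightarrow> 'mo \<Rightarrow> 'ea) \<Rightarrow> ('mo \<Rightarrow> 'ea) \<Rightarrow> bool" where
  "left_module_map C E F M L \<mu> \<nu> f \<longleftrightarrow> (\<forall>A \<in> Obj C. \<forall>X \<in> Obj M.
     f (A \<triangleright>\<^sub>o\<^bsub>L\<^esub> X) \<cdot>\<^bsub>E\<^esub> \<mu> A X = \<nu> A X \<cdot>\<^bsub>E\<^esub> (Id E (omap F A) \<otimes>\<^sub>a\<^bsub>E\<^esub> f X))"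

definition right_module_map ::
  "('r, 'do, 'da, 'z1) moncat_scheme \<Rightarrow> ('r, 'eo, 'ea, 'z2) moncat_scheme \<Rightarrow>
   ('do, 'da, 'eo, 'ea, 'z3) lax_ftor_scheme \<Rightarrow> ('r, 'mo, 'ma, 'z4) lincat_scheme \<Rightarrow>
   ('do, 'da, 'mo, 'ma, 'z5) ract_scheme \<Rightarrow>
   ('mo \<Rightarrow> 'do \<Rightarrow> 'ea) \<Rightarrow> ('mo \<Rightarrow> 'do \<Rightarrow> 'ea) \<Rightarrow> ('mo \<Rightarrow> 'ea) \<Rightarrow> bool" where
  "right_module_map D E G M T \<mu> \<nu> f \<longleftrightarrow> (\<forall>X \<in> Obj M. \<forall>A \<in> Obj D.
     f (X \<triangleleft>\<^sub>o\<^bsub>T\<^esub> A) \<cdot>\<^bsub>E\<^esub> \<mu> X A = \<nu> X A \<cdot>\<^bsub>E\<^esub> (f X \<otimes>\<^sub>a\<^bsub>E\<^esub> Id E (omap G A)))"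


section \<open>Categories of modules\<close>

text \<open>
  The linear category whose objects are the given set \<open>S\<close> of functors from \<open>M\<close> to \<open>E\<close> with
  additional structure and whose arrows are the natural transformations satisfying \<open>\<Phi>\<close>, with
  componentwise operations. An arrow \<open>(P, Q, f)\<close> records its domain and codomain besides the family
  \<open>f\<close> of components. Families of components are extensional, so that
  natural transformations are equal iff their components are.
\<close>

definition structured_functors ::
  "('r, 'mo, 'ma, 'z1) lincat_scheme \<Rightarrow> ('r, 'eo, 'ea, 'z2) lincat_scheme \<Rightarrow>
   (('mo, 'ma, 'eo, 'ea) ftor \<times> 's) set \<Rightarrow> ('s \<Rightarrow> 's \<Rightarrow> ('mo \<Rightarrow> 'ea) \<Rightarrow> bool) \<Rightarrow>
   ('r, ('mo, 'ma, 'eo, 'ea) ftor \<times> 's,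
    (('mo, 'ma, 'eo, 'ea) ftor \<times> 's) \<times> (('mo, 'ma, 'eo, 'ea) ftor \<times> 's) \<times> ('mo \<Rightarrow> 'ea)) lincat" where
  "structured_functors M E S \<Phi> =
    \<lparr>Obj = S,
     Hom = (\<lambda>P Q.
       \<lparr>carrier = {(P, Q, f) | f. f \<in> extensional (Obj M) \<and> natural M E (fst P) (fst Q) f \<and>
                                 \<Phi> (snd P) (snd Q) f},
        mult = undefined,
        one = undefined,
        zero = (P, Q, \<lambda>X\<in>Obj M. \<zero>\<^bsub>Hom E (omap (fst P) X) (omap (fst Q) X)\<^esub>),
        add = (\<lambda>(_, _, f) (_, _, g).
          (P, Q, \<lambda>X\<in>Obj M. f X \<oplus>\<^bsub>Hom E (omap (fst P) X) (omap (fst Q) X)\<^esub> g X)),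
        smult = (\<lambda>c (_, _, f).
          (P, Q, \<lambda>X\<in>Obj M. c \<odot>\<^bsub>Hom E (omap (fst P) X) (omap (fst Q) X)\<^esub> f X))\<rparr>),
     Id = (\<lambda>P. (P, P, \<lambda>X\<in>Obj M. Id E (omap (fst P) X))),
     Comp = (\<lambda>(_, V, g) (P, _, f). (P, V, \<lambda>X\<in>Obj M. g X \<cdot>\<^bsub>E\<^esub> f X))\<rparr>"

text \<open>Functors and structure maps are extensional too, so that objects are not duplicated.\<close>

definition ftor_extensional ::
  "('r, 'o1, 'a1, 'z1) lincat_scheme \<Rightarrow> ('o1, 'a1, 'o2, 'a2, 'z) ftor_scheme \<Rightarrow> bool" where
  "ftor_extensional C F \<longleftrightarrow> omap F \<in> extensional (Obj C) \<and> amap F \<in> extensional (Arr C)"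

definition left_modules where
  "left_modules R C E F M L =
    structured_functors M E
      {(N, \<mu>). left_functor_module R C E F M L N \<mu> \<and>
         ftor_extensional M N \<and> case_prod \<mu> \<in> extensional (Obj C \<times> Obj M)}
      (left_module_map C E F M L)"

definition right_modules where
  "right_modules R D E G M T =
    structured_functors M E
      {(N, \<mu>). right_functor_module R D E G M T N \<mu> \<and>
         ftor_extensional M N \<and> case_prod \<mu> \<in> extensional (Obj M \<times> Obj D)}
      (right_module_map D E G M T)"

definition bimodules where
  "bimodules R C D E F G M L T am =
    structured_functors M E
      {(N, \<mu>l, \<mu>r). functor_bimodule R C D E F G M L T am N \<mu>l \<mu>r \<and>
         ftor_extensional M N \<and> case_prod \<mu>l \<in> extensional (Obj C \<times> Obj M) \<and>
         case_prod \<mu>r \<in> extensional (Obj M \<times> Obj D)}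
      (\<lambda>(\<mu>l, \<mu>r) (\<nu>l, \<nu>r) f.
         left_module_map C E F M L \<mu>l \<nu>l f \<and> right_module_map D E G M T \<mu>r \<nu>r f)"

end

(*
  Kernels, cokernels and biproducts of modules are computed pointwise in E. The multiplication
  F(A) \<otimes> N(X) \<rightarrow> N(A \<triangleright> X) lifts to pointwise kernels and biproducts by their universal property,
  for any F. On pointwise cokernels it is induced because F(A) \<otimes> - preserves cokernels: an exact
  functor does, by the image factorisation. An equation between multiplications is checked on
  kernels and biproducts after composing with the jointly monic family of maps out of them, and on
  a cokernel q after precomposing with the image of q under the functor S that is the source of
  both sides, e.g. (F(A) \<otimes> F(B)) \<otimes> -; this image is epi because S is isomorphic to a composite of
  the functors F(A) \<otimes> - and - \<otimes> G(B), or to the identity. Finally, a map of modules that is mono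
  (epi) is so pointwise, hence pointwise the kernel of its cokernel (the cokernel of its kernel).
*)

theory Submission
  imports Defs
begin

section \<open>Linear and abelian categories\<close>

text \<open>Left modules, right modules and bimodules differ only in their operations and laws, so
  abelianness is proved once, for functors \<open>N\<close> with a family of operations subject to a
  predicate \<open>eqs\<close>. The predicate enters only through \<open>stable\<close>: it passes
  to a structure that is mapped jointly monically into structures satisfying it, and to pointwise
  epic images. An equation is stable when both sides are natural in the structure
  (\<open>derived_op\<close>) and their source functor preserves epis. Operations, arrows
  \<open>amap N g\<close> and natural transformations between endofunctors of \<open>E\<close>
  compose to such natural families, so each concrete case reduces to writing the two sides of every
  law as a composite of this kind. Universal objects are chosen separately at each object of
  \<open>M\<close>, so nothing makes the choices a functor to begin with. The values on arrows are
  induced like the operations, and the functor laws and linearity of \<open>N\<close> are further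
  equations to be cancelled. Passing from mono to pointwise mono relies on kernels that are
  pointwise and at the same time kernels of modules: for a mono such a kernel is the zero
  map.\<close>

context linear_category
begin

section \<open>Hom-sets: zero arrows, sums and differences\<close>

lemma in_hom_obj:
  assumes "\<guillemotleft>f : X \<rightarrow>\<^bsub>C\<^esub> Y\<guillemotright>"
  shows "X \<in> Obj C" and "Y \<in> Obj C"
  using assms by (auto simp: in_hom_def)

lemma hom_abelian_group: "\<lbrakk>X \<in> Obj C; Y \<in> Obj C\<rbrakk> \<Longrightarrow> abelian_group (Hom C X Y)"
  using hom_module by (simp add: module_def)

lemma zero_in_hom: "\<lbrakk>X \<in> Obj C; Y \<in> Obj C\<rbrakk> \<Longrightarrow> \<guillemotleft>\<zero>\<^bsub>Hom C X Y\<^esub> : X \<rightarrow>\<^bsub>C\<^esub> Y\<guillemotright>"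
  using hom_abelian_group[of X Y]
  by (simp add: in_hom_def abelian_group_def abelian_monoid.zero_closed)

lemma add_in_hom:
  "\<lbrakk>\<guillemotleft>f : X \<rightarrow>\<^bsub>C\<^esub> Y\<guillemotright>; \<guillemotleft>g : X \<rightarrow>\<^bsub>C\<^esub> Y\<guillemotright>\<rbrakk> \<Longrightarrow> \<guillemotleft>f \<oplus>\<^bsub>Hom C X Y\<^esub> g : X \<rightarrow>\<^bsub>C\<^esub> Y\<guillemotright>"
  using hom_abelian_group[of X Y]
  by (simp add: in_hom_def abelian_group_def abelian_monoid.a_closed)

lemma smult_in_hom:
  "\<lbrakk>c \<in> carrier R; \<guillemotleft>f : X \<rightarrow>\<^bsub>C\<^esub> Y\<guillemotright>\<rbrakk> \<Longrightarrow> \<guillemotleft>c \<odot>\<^bsub>Hom C X Y\<^esub> f : X \<rightarrow>\<^bsub>C\<^esub> Y\<guillemotright>"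
  using hom_module[of X Y] by (simp add: in_hom_def module.smult_closed)

text \<open>Cancellation in the group. Applied to the image of 0 + 0 = 0 it shows that additive maps
  preserve zero: composition on either side, and later \<open>amap\<close> in
  \<open>amap_zero\<close>.\<close>

lemma add_idem_zero:
  assumes "\<guillemotleft>f : X \<rightarrow>\<^bsub>C\<^esub> Y\<guillemotright>" "f \<oplus>\<^bsub>Hom C X Y\<^esub> f = f"
  shows "f = \<zero>\<^bsub>Hom C X Y\<^esub>"
proof -
  interpret H: abelian_group "Hom C X Y"
    using assms(1) hom_abelian_group by (auto simp: in_hom_def)
  show ?thesis
    using assms H.add.l_cancel_one by (simp add: in_hom_def)
qed

lemma zero_add_zero: "\<lbrakk>X \<in> Obj C; Y \<in> Obj C\<rbrakk> \<Longrightarrow>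
    \<zero>\<^bsub>Hom C X Y\<^esub> \<oplus>\<^bsub>Hom C X Y\<^esub> \<zero>\<^bsub>Hom C X Y\<^esub> = \<zero>\<^bsub>Hom C X Y\<^esub>"
  using hom_abelian_group[of X Y]
  by (simp add: abelian_group_def abelian_monoid.l_zero abelian_monoid.zero_closed)

lemma comp_zero_left:
  assumes f: "\<guillemotleft>f : X \<rightarrow>\<^bsub>C\<^esub> Y\<guillemotright>" and Z: "Z \<in> Obj C"
  shows "\<zero>\<^bsub>Hom C Y Z\<^esub> \<cdot>\<^bsub>C\<^esub> f = \<zero>\<^bsub>Hom C X Z\<^esub>"
proof (rule add_idem_zero)
  have Y: "Y \<in> Obj C" using f by (simp add: in_hom_def)
  note z = zero_in_hom[OF Y Z]
  show "\<guillemotleft>\<zero>\<^bsub>Hom C Y Z\<^esub> \<cdot>\<^bsub>C\<^esub> f : X \<rightarrow>\<^bsub>C\<^esub> Z\<guillemotright>" by (rule comp_in_hom[OF f z])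
  show "\<zero>\<^bsub>Hom C Y Z\<^esub> \<cdot>\<^bsub>C\<^esub> f \<oplus>\<^bsub>Hom C X Z\<^esub> \<zero>\<^bsub>Hom C Y Z\<^esub> \<cdot>\<^bsub>C\<^esub> f = \<zero>\<^bsub>Hom C Y Z\<^esub> \<cdot>\<^bsub>C\<^esub> f"
    using comp_add_left[OF f z z] zero_add_zero[OF Y Z] by simp
qed

lemma comp_zero_right:
  assumes g: "\<guillemotleft>g : Y \<rightarrow>\<^bsub>C\<^esub> Z\<guillemotright>" and X: "X \<in> Obj C"
  shows "g \<cdot>\<^bsub>C\<^esub> \<zero>\<^bsub>Hom C X Y\<^esub> = \<zero>\<^bsub>Hom C X Z\<^esub>"
proof (rule add_idem_zero)
  have Y: "Y \<in> Obj C" using g by (simp add: in_hom_def)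
  note z = zero_in_hom[OF X Y]
  show "\<guillemotleft>g \<cdot>\<^bsub>C\<^esub> \<zero>\<^bsub>Hom C X Y\<^esub> : X \<rightarrow>\<^bsub>C\<^esub> Z\<guillemotright>" by (rule comp_in_hom[OF z g])
  show "g \<cdot>\<^bsub>C\<^esub> \<zero>\<^bsub>Hom C X Y\<^esub> \<oplus>\<^bsub>Hom C X Z\<^esub> g \<cdot>\<^bsub>C\<^esub> \<zero>\<^bsub>Hom C X Y\<^esub> = g \<cdot>\<^bsub>C\<^esub> \<zero>\<^bsub>Hom C X Y\<^esub>"
    using comp_add_right[OF z z g] zero_add_zero[OF X Y] by simp
qed

text \<open>The difference is described through addition, because the axioms on composition speak of
  sums and not of differences.\<close>

lemma hom_diff:
  assumes "\<guillemotleft>f : X \<rightarrow>\<^bsub>C\<^esub> Y\<guillemotright>" "\<guillemotleft>g : X \<rightarrow>\<^bsub>C\<^esub> Y\<guillemotright>"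
  obtains d where "\<guillemotleft>d : X \<rightarrow>\<^bsub>C\<^esub> Y\<guillemotright>" "f = d \<oplus>\<^bsub>Hom C X Y\<^esub> g"
proof -
  interpret H: abelian_group "Hom C X Y"
    using assms(1) hom_abelian_group by (auto simp: in_hom_def)
  have c: "f \<in> carrier (Hom C X Y)" "g \<in> carrier (Hom C X Y)" using assms by (auto simp: in_hom_def)
  show ?thesis
  proof (rule that)
    show "\<guillemotleft>f \<ominus>\<^bsub>Hom C X Y\<^esub> g : X \<rightarrow>\<^bsub>C\<^esub> Y\<guillemotright>" using assms c by (simp add: in_hom_def)
    show "f = (f \<ominus>\<^bsub>Hom C X Y\<^esub> g) \<oplus>\<^bsub>Hom C X Y\<^esub> g"
      using c by (simp add: H.minus_eq H.a_assoc H.l_neg)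
  qed
qed

lemma add_eq_right_iff:
  assumes "\<guillemotleft>d : X \<rightarrow>\<^bsub>C\<^esub> Y\<guillemotright>" "\<guillemotleft>g : X \<rightarrow>\<^bsub>C\<^esub> Y\<guillemotright>"
  shows "d \<oplus>\<^bsub>Hom C X Y\<^esub> g = g \<longleftrightarrow> d = \<zero>\<^bsub>Hom C X Y\<^esub>"
proof -
  interpret H: abelian_group "Hom C X Y"
    using assms(1) hom_abelian_group by (auto simp: in_hom_def)
  show ?thesis
    using assms H.add.r_cancel_one by (simp add: in_hom_def)
qed

section \<open>Monomorphisms and epimorphisms\<close>

lemma monoI:
  assumes f: "\<guillemotleft>f : X \<rightarrow>\<^bsub>C\<^esub> Y\<guillemotright>"
    and cancel: "\<And>W g. \<lbrakk>\<guillemotleft>g : W \<rightarrow>\<^bsub>C\<^esub> X\<guillemotright>; f \<cdot>\<^bsub>C\<^esub> g = \<zero>\<^bsub>Hom C W Y\<^esub>\<rbrakk> \<Longrightarrow> g = \<zero>\<^bsub>Hom C W X\<^esub>"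
  shows "is_mono C X Y f"
  unfolding is_mono_def
proof (intro conjI allI impI f)
  fix W g h
  assume g: "\<guillemotleft>g : W \<rightarrow>\<^bsub>C\<^esub> X\<guillemotright>" and h: "\<guillemotleft>h : W \<rightarrow>\<^bsub>C\<^esub> X\<guillemotright>" and eq: "f \<cdot>\<^bsub>C\<^esub> g = f \<cdot>\<^bsub>C\<^esub> h"
  \<comment> \<open>Writing \<open>g\<close> as \<open>d + h\<close> turns the equation to be
    cancelled into \<open>f d = 0\<close>, so additivity reduces cancellation to a test against
    zero.\<close>
  obtain d where d: "\<guillemotleft>d : W \<rightarrow>\<^bsub>C\<^esub> X\<guillemotright>" "g = d \<oplus>\<^bsub>Hom C W X\<^esub> h" using hom_diff[OF g h] .
  have "f \<cdot>\<^bsub>C\<^esub> d \<oplus>\<^bsub>Hom C W Y\<^esub> f \<cdot>\<^bsub>C\<^esub> h = f \<cdot>\<^bsub>C\<^esub> h"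
    using comp_add_right[OF d(1) h f] eq d(2) by simp
  then have "d = \<zero>\<^bsub>Hom C W X\<^esub>"
    using cancel[OF d(1)] add_eq_right_iff[OF comp_in_hom[OF d(1) f] comp_in_hom[OF h f]] by simp
  then show "g = h" using add_eq_right_iff[OF d(1) h] d(2) by simp
qed

lemma epiI:
  assumes f: "\<guillemotleft>f : X \<rightarrow>\<^bsub>C\<^esub> Y\<guillemotright>"
    and cancel: "\<And>Z g. \<lbrakk>\<guillemotleft>g : Y \<rightarrow>\<^bsub>C\<^esub> Z\<guillemotright>; g \<cdot>\<^bsub>C\<^esub> f = \<zero>\<^bsub>Hom C X Z\<^esub>\<rbrakk> \<Longrightarrow> g = \<zero>\<^bsub>Hom C Y Z\<^esub>"
  shows "is_epi C X Y f"
  unfolding is_epi_def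
proof (intro conjI allI impI f)
  fix Z g h
  assume g: "\<guillemotleft>g : Y \<rightarrow>\<^bsub>C\<^esub> Z\<guillemotright>" and h: "\<guillemotleft>h : Y \<rightarrow>\<^bsub>C\<^esub> Z\<guillemotright>" and eq: "g \<cdot>\<^bsub>C\<^esub> f = h \<cdot>\<^bsub>C\<^esub> f"
  obtain d where d: "\<guillemotleft>d : Y \<rightarrow>\<^bsub>C\<^esub> Z\<guillemotright>" "g = d \<oplus>\<^bsub>Hom C Y Z\<^esub> h" using hom_diff[OF g h] .
  have "d \<cdot>\<^bsub>C\<^esub> f \<oplus>\<^bsub>Hom C X Z\<^esub> h \<cdot>\<^bsub>C\<^esub> f = h \<cdot>\<^bsub>C\<^esub> f"
    using comp_add_left[OF f d(1) h] eq d(2) by simp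
  then have "d = \<zero>\<^bsub>Hom C Y Z\<^esub>"
    using cancel[OF d(1)] add_eq_right_iff[OF comp_in_hom[OF f d(1)] comp_in_hom[OF f h]] by simp
  then show "g = h" using add_eq_right_iff[OF d(1) h] d(2) by simp
qed

lemma mono_cancel:
  "\<lbrakk>is_mono C X Y f; f \<cdot>\<^bsub>C\<^esub> g = f \<cdot>\<^bsub>C\<^esub> h; \<guillemotleft>g : W \<rightarrow>\<^bsub>C\<^esub> X\<guillemotright>; \<guillemotleft>h : W \<rightarrow>\<^bsub>C\<^esub> X\<guillemotright>\<rbrakk> \<Longrightarrow> g = h"
  unfolding is_mono_def by blast

lemma epi_cancel:
  "\<lbrakk>is_epi C X Y f; g \<cdot>\<^bsub>C\<^esub> f = h \<cdot>\<^bsub>C\<^esub> f; \<guillemotleft>g : Y \<rightarrow>\<^bsub>C\<^esub> Z\<guillemotright>; \<guillemotleft>h : Y \<rightarrow>\<^bsub>C\<^esub> Z\<guillemotright>\<rbrakk> \<Longrightarrow> g = h"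
  unfolding is_epi_def by blast

lemma mono_comp:
  assumes f: "is_mono C X Y f" and g: "is_mono C Y Z g"
  shows "is_mono C X Z (g \<cdot>\<^bsub>C\<^esub> f)"
  unfolding is_mono_def
proof (intro conjI allI impI)
  have fg: "\<guillemotleft>f : X \<rightarrow>\<^bsub>C\<^esub> Y\<guillemotright>" "\<guillemotleft>g : Y \<rightarrow>\<^bsub>C\<^esub> Z\<guillemotright>" using f g by (auto simp: is_mono_def)
  then show "\<guillemotleft>g \<cdot>\<^bsub>C\<^esub> f : X \<rightarrow>\<^bsub>C\<^esub> Z\<guillemotright>" by (rule comp_in_hom)
  fix W u v
  assume u: "\<guillemotleft>u : W \<rightarrow>\<^bsub>C\<^esub> X\<guillemotright>" and v: "\<guillemotleft>v : W \<rightarrow>\<^bsub>C\<^esub> X\<guillemotright>" and "g \<cdot>\<^bsub>C\<^esub> f \<cdot>\<^bsub>C\<^esub> u = g \<cdot>\<^bsub>C\<^esub> f \<cdot>\<^bsub>C\<^esub> v"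
  then have "g \<cdot>\<^bsub>C\<^esub> (f \<cdot>\<^bsub>C\<^esub> u) = g \<cdot>\<^bsub>C\<^esub> (f \<cdot>\<^bsub>C\<^esub> v)" by (simp add: comp_assoc[OF u fg] comp_assoc[OF v fg])
  then have "f \<cdot>\<^bsub>C\<^esub> u = f \<cdot>\<^bsub>C\<^esub> v"
    by (rule mono_cancel[OF g _ comp_in_hom[OF u fg(1)] comp_in_hom[OF v fg(1)]])
  then show "u = v" by (rule mono_cancel[OF f _ u v])
qed

lemma epi_comp:
  assumes f: "is_epi C X Y f" and g: "is_epi C Y Z g"
  shows "is_epi C X Z (g \<cdot>\<^bsub>C\<^esub> f)"
  unfolding is_epi_def
proof (intro conjI allI impI)
  have fg: "\<guillemotleft>f : X \<rightarrow>\<^bsub>C\<^esub> Y\<guillemotright>" "\<guillemotleft>g : Y \<rightarrow>\<^bsub>C\<^esub> Z\<guillemotright>" using f g by (auto simp: is_epi_def)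
  then show "\<guillemotleft>g \<cdot>\<^bsub>C\<^esub> f : X \<rightarrow>\<^bsub>C\<^esub> Z\<guillemotright>" by (rule comp_in_hom)
  fix W u v
  assume u: "\<guillemotleft>u : Z \<rightarrow>\<^bsub>C\<^esub> W\<guillemotright>" and v: "\<guillemotleft>v : Z \<rightarrow>\<^bsub>C\<^esub> W\<guillemotright>" and "u \<cdot>\<^bsub>C\<^esub> (g \<cdot>\<^bsub>C\<^esub> f) = v \<cdot>\<^bsub>C\<^esub> (g \<cdot>\<^bsub>C\<^esub> f)"
  then have "u \<cdot>\<^bsub>C\<^esub> g \<cdot>\<^bsub>C\<^esub> f = v \<cdot>\<^bsub>C\<^esub> g \<cdot>\<^bsub>C\<^esub> f" by (simp add: comp_assoc[OF fg u] comp_assoc[OF fg v])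
  then have "u \<cdot>\<^bsub>C\<^esub> g = v \<cdot>\<^bsub>C\<^esub> g"
    by (rule epi_cancel[OF f _ comp_in_hom[OF fg(2) u] comp_in_hom[OF fg(2) v]])
  then show "u = v" by (rule epi_cancel[OF g _ u v])
qed

lemma iso_epi:
  assumes "is_iso C X Y f"
  shows "is_epi C X Y f"
proof -
  obtain g where f: "\<guillemotleft>f : X \<rightarrow>\<^bsub>C\<^esub> Y\<guillemotright>" and g: "\<guillemotleft>g : Y \<rightarrow>\<^bsub>C\<^esub> X\<guillemotright>" and fg: "f \<cdot>\<^bsub>C\<^esub> g = Id C Y"
    using assms by (auto simp: is_iso_def)
  have "u = v" if u: "\<guillemotleft>u : Y \<rightarrow>\<^bsub>C\<^esub> Z\<guillemotright>" and v: "\<guillemotleft>v : Y \<rightarrow>\<^bsub>C\<^esub> Z\<guillemotright>" and "u \<cdot>\<^bsub>C\<^esub> f = v \<cdot>\<^bsub>C\<^esub> f" for Z u v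
  proof -
    have "u \<cdot>\<^bsub>C\<^esub> f \<cdot>\<^bsub>C\<^esub> g = v \<cdot>\<^bsub>C\<^esub> f \<cdot>\<^bsub>C\<^esub> g" using that by simp
    then show ?thesis
      by (simp add: comp_assoc[OF g f u] comp_assoc[OF g f v] fg comp_id_right[OF u] comp_id_right[OF v])
  qed
  then show ?thesis using f by (auto simp: is_epi_def)
qed

text \<open>With \<open>s\<close> inverse to \<open>t\<close>, the arrow \<open>f\<close> is the
  composite of the epis \<open>t f\<close> and \<open>s\<close>. This recognises an epi after
  transport along a natural isomorphism.\<close>

lemma epi_iso_cancel:
  assumes f: "\<guillemotleft>f : X \<rightarrow>\<^bsub>C\<^esub> Y\<guillemotright>" and t: "is_iso C Y Z t" and tf: "is_epi C X Z (t \<cdot>\<^bsub>C\<^esub> f)"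
  shows "is_epi C X Y f"
proof -
  obtain s where t: "\<guillemotleft>t : Y \<rightarrow>\<^bsub>C\<^esub> Z\<guillemotright>" and s: "\<guillemotleft>s : Z \<rightarrow>\<^bsub>C\<^esub> Y\<guillemotright>" and st: "s \<cdot>\<^bsub>C\<^esub> t = Id C Y"
    and ts: "t \<cdot>\<^bsub>C\<^esub> s = Id C Z" using t by (auto simp: is_iso_def)
  have "is_iso C Z Y s" using s t st ts by (auto simp: is_iso_def)
  then have "is_epi C X Y (s \<cdot>\<^bsub>C\<^esub> (t \<cdot>\<^bsub>C\<^esub> f))" using epi_comp[OF tf iso_epi] by blast
  then show ?thesis by (simp add: comp_assoc[OF f t s, symmetric] st comp_id_left[OF f])
qed

section \<open>Kernels and cokernels in a linear category\<close>

lemma kernel_lift: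
  assumes "is_kernel C X Y f K k" "\<guillemotleft>h : W \<rightarrow>\<^bsub>C\<^esub> X\<guillemotright>" "f \<cdot>\<^bsub>C\<^esub> h = \<zero>\<^bsub>Hom C W Y\<^esub>"
  obtains u where "\<guillemotleft>u : W \<rightarrow>\<^bsub>C\<^esub> K\<guillemotright>" "k \<cdot>\<^bsub>C\<^esub> u = h"
  using assms unfolding is_kernel_def by blast

lemma cokernel_lift:
  assumes "is_cokernel C X Y f Q q" "\<guillemotleft>h : Y \<rightarrow>\<^bsub>C\<^esub> W\<guillemotright>" "h \<cdot>\<^bsub>C\<^esub> f = \<zero>\<^bsub>Hom C X W\<^esub>"
  obtains u where "\<guillemotleft>u : Q \<rightarrow>\<^bsub>C\<^esub> W\<guillemotright>" "u \<cdot>\<^bsub>C\<^esub> q = h"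
  using assms unfolding is_cokernel_def by blast

text \<open>Two arrows that agree after \<open>k\<close> are factorisations of one and the same
  arrow, which \<open>f\<close> kills, so the uniqueness clause of the universal property identifies
  them.\<close>

lemma kernel_mono:
  assumes k: "is_kernel C X Y f K k"
  shows "is_mono C K X k"
  unfolding is_mono_def
proof (intro conjI allI impI)
  have kf: "\<guillemotleft>k : K \<rightarrow>\<^bsub>C\<^esub> X\<guillemotright>" "\<guillemotleft>f : X \<rightarrow>\<^bsub>C\<^esub> Y\<guillemotright>" and fk: "f \<cdot>\<^bsub>C\<^esub> k = \<zero>\<^bsub>Hom C K Y\<^esub>"
    using k by (auto simp: is_kernel_def)
  show "\<guillemotleft>k : K \<rightarrow>\<^bsub>C\<^esub> X\<guillemotright>" by fact
  fix W g h
  assume g: "\<guillemotleft>g : W \<rightarrow>\<^bsub>C\<^esub> K\<guillemotright>" and h: "\<guillemotleft>h : W \<rightarrow>\<^bsub>C\<^esub> K\<guillemotright>" and "k \<cdot>\<^bsub>C\<^esub> g = k \<cdot>\<^bsub>C\<^esub> h"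
  moreover have "f \<cdot>\<^bsub>C\<^esub> (k \<cdot>\<^bsub>C\<^esub> g) = \<zero>\<^bsub>Hom C W Y\<^esub>"
    using comp_assoc[OF g kf] fk comp_zero_left[OF g, of Y] kf by (simp add: in_hom_def)
  ultimately show "g = h" using k comp_in_hom[OF g kf(1)] unfolding is_kernel_def by metis
qed

lemma cokernel_epi:
  assumes q: "is_cokernel C X Y f Q q"
  shows "is_epi C Y Q q"
  unfolding is_epi_def
proof (intro conjI allI impI)
  have fq: "\<guillemotleft>f : X \<rightarrow>\<^bsub>C\<^esub> Y\<guillemotright>" "\<guillemotleft>q : Y \<rightarrow>\<^bsub>C\<^esub> Q\<guillemotright>" and 0: "q \<cdot>\<^bsub>C\<^esub> f = \<zero>\<^bsub>Hom C X Q\<^esub>"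
    using q by (auto simp: is_cokernel_def)
  show "\<guillemotleft>q : Y \<rightarrow>\<^bsub>C\<^esub> Q\<guillemotright>" by fact
  fix W g h
  assume g: "\<guillemotleft>g : Q \<rightarrow>\<^bsub>C\<^esub> W\<guillemotright>" and h: "\<guillemotleft>h : Q \<rightarrow>\<^bsub>C\<^esub> W\<guillemotright>" and "g \<cdot>\<^bsub>C\<^esub> q = h \<cdot>\<^bsub>C\<^esub> q"
  moreover have "g \<cdot>\<^bsub>C\<^esub> q \<cdot>\<^bsub>C\<^esub> f = \<zero>\<^bsub>Hom C X W\<^esub>"
    using comp_assoc[OF fq g] 0 comp_zero_right[OF g, of X] fq by (simp add: in_hom_def)
  ultimately show "g = h" using q comp_in_hom[OF fq(2) g] unfolding is_cokernel_def by metis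
qed

text \<open>Uniqueness of the lift is cancellation of the mono \<open>k\<close>, so that only
  existence remains as a premise.\<close>

lemma kernelI:
  assumes f: "\<guillemotleft>f : X \<rightarrow>\<^bsub>C\<^esub> Y\<guillemotright>" and k: "is_mono C K X k" and 0: "f \<cdot>\<^bsub>C\<^esub> k = \<zero>\<^bsub>Hom C K Y\<^esub>"
    and lift: "\<And>W h. \<lbrakk>\<guillemotleft>h : W \<rightarrow>\<^bsub>C\<^esub> X\<guillemotright>; f \<cdot>\<^bsub>C\<^esub> h = \<zero>\<^bsub>Hom C W Y\<^esub>\<rbrakk> \<Longrightarrow> \<exists>u. \<guillemotleft>u : W \<rightarrow>\<^bsub>C\<^esub> K\<guillemotright> \<and> k \<cdot>\<^bsub>C\<^esub> u = h"
  shows "is_kernel C X Y f K k"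
  unfolding is_kernel_def
proof (intro conjI allI impI)
  show "\<guillemotleft>k : K \<rightarrow>\<^bsub>C\<^esub> X\<guillemotright>" using k by (simp add: is_mono_def)
  fix W h assume "\<guillemotleft>h : W \<rightarrow>\<^bsub>C\<^esub> X\<guillemotright>" "f \<cdot>\<^bsub>C\<^esub> h = \<zero>\<^bsub>Hom C W Y\<^esub>"
  then show "\<exists>!u. \<guillemotleft>u : W \<rightarrow>\<^bsub>C\<^esub> K\<guillemotright> \<and> k \<cdot>\<^bsub>C\<^esub> u = h" using lift mono_cancel[OF k] by metis
qed (fact f 0)+

lemma cokernelI:
  assumes f: "\<guillemotleft>f : X \<rightarrow>\<^bsub>C\<^esub> Y\<guillemotright>" and q: "is_epi C Y Q q" and 0: "q \<cdot>\<^bsub>C\<^esub> f = \<zero>\<^bsub>Hom C X Q\<^esub>"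
    and lift: "\<And>W h. \<lbrakk>\<guillemotleft>h : Y \<rightarrow>\<^bsub>C\<^esub> W\<guillemotright>; h \<cdot>\<^bsub>C\<^esub> f = \<zero>\<^bsub>Hom C X W\<^esub>\<rbrakk> \<Longrightarrow> \<exists>u. \<guillemotleft>u : Q \<rightarrow>\<^bsub>C\<^esub> W\<guillemotright> \<and> u \<cdot>\<^bsub>C\<^esub> q = h"
  shows "is_cokernel C X Y f Q q"
  unfolding is_cokernel_def
proof (intro conjI allI impI)
  show "\<guillemotleft>q : Y \<rightarrow>\<^bsub>C\<^esub> Q\<guillemotright>" using q by (simp add: is_epi_def)
  fix W h assume "\<guillemotleft>h : Y \<rightarrow>\<^bsub>C\<^esub> W\<guillemotright>" "h \<cdot>\<^bsub>C\<^esub> f = \<zero>\<^bsub>Hom C X W\<^esub>"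
  then show "\<exists>!u. \<guillemotleft>u : Q \<rightarrow>\<^bsub>C\<^esub> W\<guillemotright> \<and> u \<cdot>\<^bsub>C\<^esub> q = h" using lift epi_cancel[OF q] by metis
qed (fact f 0)+

text \<open>The arrow \<open>g\<close> factors through the cokernel as \<open>g' q\<close>, so
  whatever \<open>q\<close> kills is killed by \<open>g\<close> and lifts through \<open>f\<close>.
  A mono, which by axiom is the kernel of some arrow, thereby becomes the kernel of its own
  cokernel.\<close>

lemma mono_kernel_of_cokernel:
  assumes k: "is_kernel C Y Z g X f" and q: "is_cokernel C X Y f Q q"
  shows "is_kernel C Y Q q X f"
proof (rule kernelI)
  have fq: "\<guillemotleft>f : X \<rightarrow>\<^bsub>C\<^esub> Y\<guillemotright>" "\<guillemotleft>q : Y \<rightarrow>\<^bsub>C\<^esub> Q\<guillemotright>" and qf: "q \<cdot>\<^bsub>C\<^esub> f = \<zero>\<^bsub>Hom C X Q\<^esub>"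
    using q by (auto simp: is_cokernel_def)
  have g: "\<guillemotleft>g : Y \<rightarrow>\<^bsub>C\<^esub> Z\<guillemotright>" and gf: "g \<cdot>\<^bsub>C\<^esub> f = \<zero>\<^bsub>Hom C X Z\<^esub>" using k by (auto simp: is_kernel_def)
  show "\<guillemotleft>q : Y \<rightarrow>\<^bsub>C\<^esub> Q\<guillemotright>" "q \<cdot>\<^bsub>C\<^esub> f = \<zero>\<^bsub>Hom C X Q\<^esub>" by fact+
  show "is_mono C X Y f" by (rule kernel_mono[OF k])
  obtain g' where g': "\<guillemotleft>g' : Q \<rightarrow>\<^bsub>C\<^esub> Z\<guillemotright>" "g' \<cdot>\<^bsub>C\<^esub> q = g" using cokernel_lift[OF q g gf] .
  fix W h assume h: "\<guillemotleft>h : W \<rightarrow>\<^bsub>C\<^esub> Y\<guillemotright>" and "q \<cdot>\<^bsub>C\<^esub> h = \<zero>\<^bsub>Hom C W Q\<^esub>"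
  then have "g \<cdot>\<^bsub>C\<^esub> h = \<zero>\<^bsub>Hom C W Z\<^esub>"
    using comp_assoc[OF h fq(2) g'(1)] g'(2) comp_zero_right[OF g'(1), of W] by (simp add: in_hom_def)
  then show "\<exists>u. \<guillemotleft>u : W \<rightarrow>\<^bsub>C\<^esub> X\<guillemotright> \<and> f \<cdot>\<^bsub>C\<^esub> u = h" using kernel_lift[OF k h] by metis
qed

text \<open>Dually, \<open>g\<close> factors through the kernel \<open>k\<close>, so an arrow that
  kills \<open>k\<close> kills \<open>g\<close> and descends along \<open>f\<close>.\<close>

lemma epi_cokernel_of_kernel:
  assumes q: "is_cokernel C W X g Y f" and k: "is_kernel C X Y f K k"
  shows "is_cokernel C K X k Y f"
proof (rule cokernelI)
  have kf: "\<guillemotleft>k : K \<rightarrow>\<^bsub>C\<^esub> X\<guillemotright>" "\<guillemotleft>f : X \<rightarrow>\<^bsub>C\<^esub> Y\<guillemotright>" and fk: "f \<cdot>\<^bsub>C\<^esub> k = \<zero>\<^bsub>Hom C K Y\<^esub>"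
    using k by (auto simp: is_kernel_def)
  have g: "\<guillemotleft>g : W \<rightarrow>\<^bsub>C\<^esub> X\<guillemotright>" and fg: "f \<cdot>\<^bsub>C\<^esub> g = \<zero>\<^bsub>Hom C W Y\<^esub>" using q by (auto simp: is_cokernel_def)
  show "\<guillemotleft>k : K \<rightarrow>\<^bsub>C\<^esub> X\<guillemotright>" "f \<cdot>\<^bsub>C\<^esub> k = \<zero>\<^bsub>Hom C K Y\<^esub>" by fact+
  show "is_epi C X Y f" by (rule cokernel_epi[OF q])
  obtain g' where g': "\<guillemotleft>g' : W \<rightarrow>\<^bsub>C\<^esub> K\<guillemotright>" "k \<cdot>\<^bsub>C\<^esub> g' = g" using kernel_lift[OF k g fg] .
  fix Z h assume h: "\<guillemotleft>h : X \<rightarrow>\<^bsub>C\<^esub> Z\<guillemotright>" and "h \<cdot>\<^bsub>C\<^esub> k = \<zero>\<^bsub>Hom C K Z\<^esub>"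
  then have "h \<cdot>\<^bsub>C\<^esub> g = \<zero>\<^bsub>Hom C W Z\<^esub>"
    using comp_assoc[OF g'(1) kf(1) h] g'(2) comp_zero_left[OF g'(1), of Z] by (simp add: in_hom_def)
  then show "\<exists>u. \<guillemotleft>u : Y \<rightarrow>\<^bsub>C\<^esub> Z\<guillemotright> \<and> u \<cdot>\<^bsub>C\<^esub> f = h" using cokernel_lift[OF q h] by metis
qed

end

lemma (in linear_functor) amap_zero:
  assumes X: "X \<in> Obj C" and Y: "Y \<in> Obj C"
  shows "amap F \<zero>\<^bsub>Hom C X Y\<^esub> = \<zero>\<^bsub>Hom D (omap F X) (omap F Y)\<^esub>"
proof (rule target.add_idem_zero)
  note z = source.zero_in_hom[OF X Y]
  show "\<guillemotleft>amap F \<zero>\<^bsub>Hom C X Y\<^esub> : omap F X \<rightarrow>\<^bsub>D\<^esub> omap F Y\<guillemotright>" by (rule amap_in_hom[OF z])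
  show "amap F \<zero>\<^bsub>Hom C X Y\<^esub> \<oplus>\<^bsub>Hom D (omap F X) (omap F Y)\<^esub> amap F \<zero>\<^bsub>Hom C X Y\<^esub> = amap F \<zero>\<^bsub>Hom C X Y\<^esub>"
    using amap_add[OF z z] source.zero_add_zero[OF X Y] by simp
qed

section \<open>Image factorisations and exact functors\<close>

context abelian_category
begin

lemma mono_is_kernel_of_cokernel:
  "\<lbrakk>is_mono C X Y f; is_cokernel C X Y f Q q\<rbrakk> \<Longrightarrow> is_kernel C Y Q q X f"
  using mono_is_kernel mono_kernel_of_cokernel by blast

lemma epi_is_cokernel_of_kernel:
  "\<lbrakk>is_epi C X Y f; is_kernel C X Y f K k\<rbrakk> \<Longrightarrow> is_cokernel C K X k Y f"
  using epi_is_cokernel epi_cokernel_of_kernel by blast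

text \<open>\<open>I\<close> is the usual image, the kernel of the cokernel. The cokernel
  \<open>q\<close> is given in advance so that the short exact sequence ends in the same
  \<open>Q\<close> and \<open>q\<close> as the cokernel of \<open>f\<close>.\<close>

lemma image_factorisation:
  assumes f: "\<guillemotleft>f : X \<rightarrow>\<^bsub>C\<^esub> Y\<guillemotright>" and q: "is_cokernel C X Y f Q q"
  obtains I m e where "is_epi C X I e" "is_mono C I Y m" "f = m \<cdot>\<^bsub>C\<^esub> e" "short_exact C I Y Q m q"
proof -
  have q': "\<guillemotleft>q : Y \<rightarrow>\<^bsub>C\<^esub> Q\<guillemotright>" and qf: "q \<cdot>\<^bsub>C\<^esub> f = \<zero>\<^bsub>Hom C X Q\<^esub>"
    using q by (auto simp: is_cokernel_def)
  obtain I m where m: "is_kernel C Y Q q I m" using kernels[OF q'] by blast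
  have m': "\<guillemotleft>m : I \<rightarrow>\<^bsub>C\<^esub> Y\<guillemotright>" and qm: "q \<cdot>\<^bsub>C\<^esub> m = \<zero>\<^bsub>Hom C I Q\<^esub>" using m by (auto simp: is_kernel_def)
  obtain e where e: "\<guillemotleft>e : X \<rightarrow>\<^bsub>C\<^esub> I\<guillemotright>" and me: "m \<cdot>\<^bsub>C\<^esub> e = f" using kernel_lift[OF m f qf] .
  have "is_epi C X I e"
  proof (rule epiI[OF e])
    fix Z g assume g: "\<guillemotleft>g : I \<rightarrow>\<^bsub>C\<^esub> Z\<guillemotright>" and ge: "g \<cdot>\<^bsub>C\<^esub> e = \<zero>\<^bsub>Hom C X Z\<^esub>"
    \<comment> \<open>The kernel \<open>K\<close> of \<open>g\<close> is a subobject of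
      \<open>I\<close> through which \<open>e\<close> factors. The aim is to show that
      \<open>K\<close> is all of \<open>I\<close>, which forces \<open>g = 0\<close>.\<close>
    obtain K k where k: "is_kernel C I Z g K k" using kernels[OF g] by blast
    have k': "\<guillemotleft>k : K \<rightarrow>\<^bsub>C\<^esub> I\<guillemotright>" and gk: "g \<cdot>\<^bsub>C\<^esub> k = \<zero>\<^bsub>Hom C K Z\<^esub>" using k by (auto simp: is_kernel_def)
    obtain e' where e': "\<guillemotleft>e' : X \<rightarrow>\<^bsub>C\<^esub> K\<guillemotright>" and ke': "k \<cdot>\<^bsub>C\<^esub> e' = e" using kernel_lift[OF k e ge] .
    \<comment> \<open>Being mono, \<open>m k\<close> is itself a kernel, of some \<open>h\<close>.
      This \<open>h\<close> kills \<open>f\<close>, so it factors through \<open>q\<close> and kills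
      \<open>m\<close>; hence \<open>m\<close> factors through \<open>m k\<close>.\<close>
    have "is_mono C K Y (m \<cdot>\<^bsub>C\<^esub> k)" by (rule mono_comp[OF kernel_mono[OF k] kernel_mono[OF m]])
    then obtain V h where h: "is_kernel C Y V h K (m \<cdot>\<^bsub>C\<^esub> k)" using mono_is_kernel by blast
    have h': "\<guillemotleft>h : Y \<rightarrow>\<^bsub>C\<^esub> V\<guillemotright>" and hmk: "h \<cdot>\<^bsub>C\<^esub> (m \<cdot>\<^bsub>C\<^esub> k) = \<zero>\<^bsub>Hom C K V\<^esub>"
      using h by (auto simp: is_kernel_def)
    note obj = in_hom_obj[OF h'] in_hom_obj[OF k'] in_hom_obj[OF g] in_hom_obj[OF e']
    have mk: "\<guillemotleft>m \<cdot>\<^bsub>C\<^esub> k : K \<rightarrow>\<^bsub>C\<^esub> Y\<guillemotright>" by (rule comp_in_hom[OF k' m'])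
    have "f = m \<cdot>\<^bsub>C\<^esub> k \<cdot>\<^bsub>C\<^esub> e'" using comp_assoc[OF e' k' m'] ke' me by simp
    then have "h \<cdot>\<^bsub>C\<^esub> f = \<zero>\<^bsub>Hom C X V\<^esub>"
      using comp_assoc[OF e' mk h'] hmk comp_zero_left[OF e'] obj by simp
    then obtain h'' where h'': "\<guillemotleft>h'' : Q \<rightarrow>\<^bsub>C\<^esub> V\<guillemotright>" "h'' \<cdot>\<^bsub>C\<^esub> q = h" using cokernel_lift[OF q h'] by blast
    have "h \<cdot>\<^bsub>C\<^esub> m = \<zero>\<^bsub>Hom C I V\<^esub>"
      using comp_assoc[OF m' q' h''(1)] h''(2) qm comp_zero_right[OF h''(1)] obj by simp
    then obtain t where t: "\<guillemotleft>t : I \<rightarrow>\<^bsub>C\<^esub> K\<guillemotright>" and mkt: "m \<cdot>\<^bsub>C\<^esub> k \<cdot>\<^bsub>C\<^esub> t = m" using kernel_lift[OF h m'] by blast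
    \<comment> \<open>Cancelling the mono \<open>m\<close> in \<open>m k t = m\<close> shows that
      \<open>t\<close> splits \<open>k\<close>; then \<open>g = g k t = 0\<close>.\<close>
    have "k \<cdot>\<^bsub>C\<^esub> t = Id C I"
      using mono_cancel[OF kernel_mono[OF m] _ comp_in_hom[OF t k'] id_in_hom] mkt
        comp_assoc[OF t k' m'] comp_id_right[OF m'] obj by simp
    then have "g = g \<cdot>\<^bsub>C\<^esub> k \<cdot>\<^bsub>C\<^esub> t" using comp_assoc[OF t k' g] comp_id_right[OF g] by simp
    then show "g = \<zero>\<^bsub>Hom C I Z\<^esub>" using gk comp_zero_left[OF t] obj by simp
  qed
  moreover have "is_cokernel C I Y m Q q"
    using epi_is_cokernel_of_kernel[OF cokernel_epi[OF q] m] .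
  ultimately show ?thesis using that[of I e m] m me kernel_mono[OF m] by (simp add: short_exact_def)
qed

text \<open>Since \<open>e\<close> is epi, an arrow kills \<open>m e\<close> exactly when it kills
  \<open>m\<close>.\<close>

lemma cokernel_precomp_epi:
  assumes m: "is_cokernel C I Y m Q q" and e: "is_epi C X I e"
  shows "is_cokernel C X Y (m \<cdot>\<^bsub>C\<^esub> e) Q q"
proof (rule cokernelI)
  have m': "\<guillemotleft>m : I \<rightarrow>\<^bsub>C\<^esub> Y\<guillemotright>" and q': "\<guillemotleft>q : Y \<rightarrow>\<^bsub>C\<^esub> Q\<guillemotright>" and qm: "q \<cdot>\<^bsub>C\<^esub> m = \<zero>\<^bsub>Hom C I Q\<^esub>"
    and e': "\<guillemotleft>e : X \<rightarrow>\<^bsub>C\<^esub> I\<guillemotright>" using m e by (auto simp: is_cokernel_def is_epi_def)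
  show "\<guillemotleft>m \<cdot>\<^bsub>C\<^esub> e : X \<rightarrow>\<^bsub>C\<^esub> Y\<guillemotright>" by (rule comp_in_hom[OF e' m'])
  show "is_epi C Y Q q" by (rule cokernel_epi[OF m])
  show "q \<cdot>\<^bsub>C\<^esub> (m \<cdot>\<^bsub>C\<^esub> e) = \<zero>\<^bsub>Hom C X Q\<^esub>"
    using comp_assoc[OF e' m' q'] qm comp_zero_left[OF e'] in_hom_obj[OF q'] by simp
  fix W h assume h: "\<guillemotleft>h : Y \<rightarrow>\<^bsub>C\<^esub> W\<guillemotright>" and "h \<cdot>\<^bsub>C\<^esub> (m \<cdot>\<^bsub>C\<^esub> e) = \<zero>\<^bsub>Hom C X W\<^esub>"
  then have "h \<cdot>\<^bsub>C\<^esub> m \<cdot>\<^bsub>C\<^esub> e = \<zero>\<^bsub>Hom C I W\<^esub> \<cdot>\<^bsub>C\<^esub> e"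
    using comp_assoc[OF e' m' h] comp_zero_left[OF e'] in_hom_obj[OF h] by simp
  then have "h \<cdot>\<^bsub>C\<^esub> m = \<zero>\<^bsub>Hom C I W\<^esub>"
    using epi_cancel[OF e _ comp_in_hom[OF m' h] zero_in_hom] in_hom_obj[OF h] in_hom_obj[OF m'] by simp
  then show "\<exists>u. \<guillemotleft>u : Q \<rightarrow>\<^bsub>C\<^esub> W\<guillemotright> \<and> u \<cdot>\<^bsub>C\<^esub> q = h" using cokernel_lift[OF m h] by metis
qed

text \<open>An epi together with its kernel forms a short exact sequence, to which exactness
  applies.\<close>

lemma exact_preserves_epi:
  assumes "linear_functor R C D F" "exact_functor C D F" "is_epi C X Y e"
  shows "is_epi D (omap F X) (omap F Y) (amap F e)"
proof -
  interpret F: linear_functor R C D F by fact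
  have "\<guillemotleft>e : X \<rightarrow>\<^bsub>C\<^esub> Y\<guillemotright>" using assms(3) by (simp add: is_epi_def)
  then obtain K k where k: "is_kernel C X Y e K k" using kernels by blast
  then have "short_exact C K X Y k e"
    using epi_is_cokernel_of_kernel[OF assms(3)] by (simp add: short_exact_def)
  then have "is_cokernel D (omap F K) (omap F X) (amap F k) (omap F Y) (amap F e)"
    using assms(2) by (simp add: exact_functor_def short_exact_def)
  then show ?thesis by (rule F.target.cokernel_epi)
qed

text \<open>\<open>exact_functor\<close> speaks of short exact sequences, while \<open>f\<close> may
  fail to be mono. In \<open>f = m e\<close>, exactness yields the cokernel of the image of
  \<open>m\<close> and keeps the image of \<open>e\<close> epi, and precomposition with an epi
  leaves a cokernel unchanged.\<close>

lemma exact_preserves_cokernel: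
  assumes E: "abelian_category R D" and F: "linear_functor R C D F" and ex: "exact_functor C D F"
    and q: "is_cokernel C X Y f Q q"
  shows "is_cokernel D (omap F X) (omap F Y) (amap F f) (omap F Q) (amap F q)"
proof -
  interpret F: linear_functor R C D F by fact
  have f: "\<guillemotleft>f : X \<rightarrow>\<^bsub>C\<^esub> Y\<guillemotright>" using q by (simp add: is_cokernel_def)
  obtain I m e where e: "is_epi C X I e" and m: "is_mono C I Y m" and f': "f = m \<cdot>\<^bsub>C\<^esub> e"
    and se: "short_exact C I Y Q m q" using image_factorisation[OF f q] .
  have "\<guillemotleft>e : X \<rightarrow>\<^bsub>C\<^esub> I\<guillemotright>" "\<guillemotleft>m : I \<rightarrow>\<^bsub>C\<^esub> Y\<guillemotright>" using e m by (auto simp: is_epi_def is_mono_def)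
  note F.amap_comp[OF this]
  moreover have "is_cokernel D (omap F I) (omap F Y) (amap F m) (omap F Q) (amap F q)"
    using ex se by (simp add: exact_functor_def short_exact_def)
  ultimately show ?thesis
    using abelian_category.cokernel_precomp_epi[OF E _ exact_preserves_epi[OF F ex e]] f' by simp
qed

end

section \<open>Operations on functors\<close>

definition comp_ftor ::
  "('o2, 'a2, 'o3, 'a3) ftor \<Rightarrow> ('o1, 'a1, 'o2, 'a2) ftor \<Rightarrow> ('o1, 'a1, 'o3, 'a3) ftor" where
  "comp_ftor F G = \<lparr>omap = (\<lambda>X. omap F (omap G X)), amap = (\<lambda>f. amap F (amap G f))\<rparr>"

lemma comp_ftor_simps [simp]:
  "omap (comp_ftor F G) X = omap F (omap G X)" "amap (comp_ftor F G) f = amap F (amap G f)"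
  by (simp_all add: comp_ftor_def)

lemma linear_functor_comp:
  assumes "linear_functor R C D G" "linear_functor R D E F"
  shows "linear_functor R C E (comp_ftor F G)"
proof -
  interpret G: linear_functor R C D G by fact
  interpret F: linear_functor R D E F by fact
  show ?thesis
  proof
    fix X Y Z f g
    assume f: "\<guillemotleft>f : X \<rightarrow>\<^bsub>C\<^esub> Y\<guillemotright>"
    show "\<guillemotleft>amap (comp_ftor F G) f : omap (comp_ftor F G) X \<rightarrow>\<^bsub>E\<^esub> omap (comp_ftor F G) Y\<guillemotright>"
      by (simp add: F.amap_in_hom[OF G.amap_in_hom[OF f]])
    show "amap (comp_ftor F G) (g \<cdot>\<^bsub>C\<^esub> f) = amap (comp_ftor F G) g \<cdot>\<^bsub>E\<^esub> amap (comp_ftor F G) f"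
      if "\<guillemotleft>g : Y \<rightarrow>\<^bsub>C\<^esub> Z\<guillemotright>"
      by (simp add: G.amap_comp[OF f that] F.amap_comp[OF G.amap_in_hom[OF f] G.amap_in_hom[OF that]])
    show "amap (comp_ftor F G) (f \<oplus>\<^bsub>Hom C X Y\<^esub> g)
      = amap (comp_ftor F G) f \<oplus>\<^bsub>Hom E (omap (comp_ftor F G) X) (omap (comp_ftor F G) Y)\<^esub> amap (comp_ftor F G) g"
      if "\<guillemotleft>g : X \<rightarrow>\<^bsub>C\<^esub> Y\<guillemotright>"
      by (simp add: G.amap_add[OF f that] F.amap_add[OF G.amap_in_hom[OF f] G.amap_in_hom[OF that]])
    show "amap (comp_ftor F G) (c \<odot>\<^bsub>Hom C X Y\<^esub> f)
      = c \<odot>\<^bsub>Hom E (omap (comp_ftor F G) X) (omap (comp_ftor F G) Y)\<^esub> amap (comp_ftor F G) f"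
      if "c \<in> carrier R" for c
      by (simp add: G.amap_smult[OF that f] F.amap_smult[OF that G.amap_in_hom[OF f]])
  next
    fix X assume X: "X \<in> Obj C"
    show "omap (comp_ftor F G) X \<in> Obj E" by (simp add: F.omap_obj[OF G.omap_obj[OF X]])
    show "amap (comp_ftor F G) (Id C X) = Id E (omap (comp_ftor F G) X)"
      by (simp add: G.amap_id[OF X] F.amap_id[OF G.omap_obj[OF X]])
  qed
qed

section \<open>Jointly monic families and biproducts\<close>

definition jointly_mono :: "('r, 'o, 'a, 'z) lincat_scheme \<Rightarrow> 'o \<Rightarrow> 'a set \<Rightarrow> bool" where
  "jointly_mono C X L \<longleftrightarrow> (\<forall>W u v. \<guillemotleft>u : W \<rightarrow>\<^bsub>C\<^esub> X\<guillemotright> \<longrightarrow> \<guillemotleft>v : W \<rightarrow>\<^bsub>C\<^esub> X\<guillemotright> \<longrightarrow>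
    (\<forall>k \<in> L. k \<cdot>\<^bsub>C\<^esub> u = k \<cdot>\<^bsub>C\<^esub> v) \<longrightarrow> u = v)"

lemma jointly_monoD:
  "\<lbrakk>jointly_mono C X L; \<And>k. k \<in> L \<Longrightarrow> k \<cdot>\<^bsub>C\<^esub> u = k \<cdot>\<^bsub>C\<^esub> v; \<guillemotleft>u : W \<rightarrow>\<^bsub>C\<^esub> X\<guillemotright>; \<guillemotleft>v : W \<rightarrow>\<^bsub>C\<^esub> X\<guillemotright>\<rbrakk> \<Longrightarrow> u = v"
  unfolding jointly_mono_def by blast

lemma mono_jointly_mono: "is_mono C X Y k \<Longrightarrow> jointly_mono C X {k}"
  by (simp add: is_mono_def jointly_mono_def)

context linear_category
begin

text \<open>The witness is the column \<open>i f + j g\<close>. Only existence is stated here;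
  uniqueness is the content of \<open>biproduct_jointly_mono\<close>.\<close>

lemma biproduct_pair:
  assumes bp: "is_biproduct C X Y B i j p q" and f: "\<guillemotleft>f : W \<rightarrow>\<^bsub>C\<^esub> X\<guillemotright>" and g: "\<guillemotleft>g : W \<rightarrow>\<^bsub>C\<^esub> Y\<guillemotright>"
  shows "\<exists>u. \<guillemotleft>u : W \<rightarrow>\<^bsub>C\<^esub> B\<guillemotright> \<and> p \<cdot>\<^bsub>C\<^esub> u = f \<and> q \<cdot>\<^bsub>C\<^esub> u = g"
proof (intro exI conjI)
  have i: "\<guillemotleft>i : X \<rightarrow>\<^bsub>C\<^esub> B\<guillemotright>" and j: "\<guillemotleft>j : Y \<rightarrow>\<^bsub>C\<^esub> B\<guillemotright>" and p: "\<guillemotleft>p : B \<rightarrow>\<^bsub>C\<^esub> X\<guillemotright>" and q: "\<guillemotleft>q : B \<rightarrow>\<^bsub>C\<^esub> Y\<guillemotright>"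
    and eqs: "p \<cdot>\<^bsub>C\<^esub> i = Id C X" "q \<cdot>\<^bsub>C\<^esub> j = Id C Y" "q \<cdot>\<^bsub>C\<^esub> i = \<zero>\<^bsub>Hom C X Y\<^esub>" "p \<cdot>\<^bsub>C\<^esub> j = \<zero>\<^bsub>Hom C Y X\<^esub>"
    using bp by (auto simp: is_biproduct_def)
  let ?u = "i \<cdot>\<^bsub>C\<^esub> f \<oplus>\<^bsub>Hom C W B\<^esub> j \<cdot>\<^bsub>C\<^esub> g"
  note fi = comp_in_hom[OF f i] and gj = comp_in_hom[OF g j]
  note obj = in_hom_obj[OF f] in_hom_obj[OF g]
  show "\<guillemotleft>?u : W \<rightarrow>\<^bsub>C\<^esub> B\<guillemotright>" by (rule add_in_hom[OF fi gj])
  have z: "abelian_monoid (Hom C W X)" "abelian_monoid (Hom C W Y)"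
    using hom_abelian_group obj by (simp_all add: abelian_group_def)
  have "p \<cdot>\<^bsub>C\<^esub> ?u = f \<oplus>\<^bsub>Hom C W X\<^esub> \<zero>\<^bsub>Hom C W X\<^esub>"
    by (simp add: comp_add_right[OF fi gj p] comp_assoc[OF f i p, symmetric] comp_assoc[OF g j p, symmetric]
        eqs comp_id_left[OF f] comp_zero_left[OF g] obj)
  then show "p \<cdot>\<^bsub>C\<^esub> ?u = f" using abelian_monoid.r_zero[OF z(1)] f by (simp add: in_hom_def)
  have "q \<cdot>\<^bsub>C\<^esub> ?u = \<zero>\<^bsub>Hom C W Y\<^esub> \<oplus>\<^bsub>Hom C W Y\<^esub> g"
    by (simp add: comp_add_right[OF fi gj q] comp_assoc[OF f i q, symmetric] comp_assoc[OF g j q, symmetric]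
        eqs comp_id_left[OF g] comp_zero_left[OF f] obj)
  then show "q \<cdot>\<^bsub>C\<^esub> ?u = g" using abelian_monoid.l_zero[OF z(2)] g by (simp add: in_hom_def)
qed

text \<open>Composing \<open>i p + j q = 1\<close> with an arrow into \<open>B\<close> recovers the
  arrow from its two components.\<close>

lemma biproduct_jointly_mono:
  assumes bp: "is_biproduct C X Y B i j p q"
  shows "jointly_mono C B {p, q}"
  unfolding jointly_mono_def
proof (intro allI impI)
  have i: "\<guillemotleft>i : X \<rightarrow>\<^bsub>C\<^esub> B\<guillemotright>" and j: "\<guillemotleft>j : Y \<rightarrow>\<^bsub>C\<^esub> B\<guillemotright>" and p: "\<guillemotleft>p : B \<rightarrow>\<^bsub>C\<^esub> X\<guillemotright>" and q: "\<guillemotleft>q : B \<rightarrow>\<^bsub>C\<^esub> Y\<guillemotright>"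
    and id: "i \<cdot>\<^bsub>C\<^esub> p \<oplus>\<^bsub>Hom C B B\<^esub> j \<cdot>\<^bsub>C\<^esub> q = Id C B"
    using bp by (auto simp: is_biproduct_def)
  have split: "u = i \<cdot>\<^bsub>C\<^esub> (p \<cdot>\<^bsub>C\<^esub> u) \<oplus>\<^bsub>Hom C W B\<^esub> j \<cdot>\<^bsub>C\<^esub> (q \<cdot>\<^bsub>C\<^esub> u)" if u: "\<guillemotleft>u : W \<rightarrow>\<^bsub>C\<^esub> B\<guillemotright>" for u W
  proof -
    have "u = (i \<cdot>\<^bsub>C\<^esub> p \<oplus>\<^bsub>Hom C B B\<^esub> j \<cdot>\<^bsub>C\<^esub> q) \<cdot>\<^bsub>C\<^esub> u" by (simp add: id comp_id_left[OF u])
    then show ?thesis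
      by (simp add: comp_add_left[OF u comp_in_hom[OF p i] comp_in_hom[OF q j]]
          comp_assoc[OF u p i] comp_assoc[OF u q j])
  qed
  fix W u v
  assume "\<guillemotleft>u : W \<rightarrow>\<^bsub>C\<^esub> B\<guillemotright>" "\<guillemotleft>v : W \<rightarrow>\<^bsub>C\<^esub> B\<guillemotright>" "\<forall>k\<in>{p, q}. k \<cdot>\<^bsub>C\<^esub> u = k \<cdot>\<^bsub>C\<^esub> v"
  then show "u = v" using split[of u W] split[of v W] by simp
qed

end

section \<open>Functors that preserve epimorphisms\<close>

definition preserves_epis ::
  "('r, 'o1, 'a1, 'z1) lincat_scheme \<Rightarrow> ('r, 'o2, 'a2, 'z2) lincat_scheme \<Rightarrow>
   ('o1, 'a1, 'o2, 'a2) ftor \<Rightarrow> bool" where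
  "preserves_epis C D F \<longleftrightarrow>
    (\<forall>X Y e. is_epi C X Y e \<longrightarrow> is_epi D (omap F X) (omap F Y) (amap F e))"

lemma preserves_epis_comp:
  "\<lbrakk>preserves_epis C D G; preserves_epis D E F\<rbrakk> \<Longrightarrow> preserves_epis C E (comp_ftor F G)"
  by (simp add: preserves_epis_def)

text \<open>In the naturality square of \<open>t\<close> at \<open>e\<close> one path is an
  isomorphism followed by an epi, hence epi; the isomorphism that ends the other path is then
  cancelled.\<close>

lemma preserves_epis_iso:
  assumes G: "linear_functor R C D G" and F: "preserves_epis C D F" and t: "natural C D G F t"
    and iso: "\<And>X. X \<in> Obj C \<Longrightarrow> is_iso D (omap G X) (omap F X) (t X)"
  shows "preserves_epis C D G"
  unfolding preserves_epis_def
proof (intro allI impI)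
  interpret G: linear_functor R C D G by fact
  fix X Y e assume epi: "is_epi C X Y e"
  then have e: "\<guillemotleft>e : X \<rightarrow>\<^bsub>C\<^esub> Y\<guillemotright>" by (simp add: is_epi_def)
  have X: "X \<in> Obj C" and Y: "Y \<in> Obj C" using e by (auto simp: in_hom_def)
  have "is_epi D (omap F X) (omap F Y) (amap F e)" using F epi by (simp add: preserves_epis_def)
  then have "is_epi D (omap G X) (omap F Y) (amap F e \<cdot>\<^bsub>D\<^esub> t X)"
    using G.target.epi_comp[OF G.target.iso_epi[OF iso[OF X]]] by blast
  moreover have "t Y \<cdot>\<^bsub>D\<^esub> amap G e = amap F e \<cdot>\<^bsub>D\<^esub> t X" using t e by (simp add: natural_def)
  ultimately show "is_epi D (omap G X) (omap G Y) (amap G e)"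
    using G.target.epi_iso_cancel[OF G.amap_in_hom[OF e] iso[OF Y]] by simp
qed

section \<open>Functors with operations and their maps\<close>

text \<open>
  All three kinds of modules are functors \<open>N : M \<rightarrow> E\<close> with a family of operations
  \<open>T\<^sub>j (N (src j)) \<rightarrow> N (tgt j)\<close>, where the \<open>T\<^sub>j\<close> are right exact endofunctors of \<open>E\<close>.
\<close>

locale functor_operations = base: linear_category R M + abelian_category R E
  for R :: "('r, 'm) ring_scheme" (structure)
    and M :: "('r, 'mo, 'ma, 'z1) lincat_scheme"
    and E :: "('r, 'eo, 'ea, 'z2) lincat_scheme" +
  fixes J :: "'j set" and src :: "'j \<Rightarrow> 'mo" and tgt :: "'j \<Rightarrow> 'mo"
    and T :: "'j \<Rightarrow> ('eo, 'ea, 'eo, 'ea) ftor"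
  assumes src_obj: "j \<in> J \<Longrightarrow> src j \<in> Obj M"
    and tgt_obj: "j \<in> J \<Longrightarrow> tgt j \<in> Obj M"
    and T_linear: "j \<in> J \<Longrightarrow> linear_functor R E E (T j)"
    and T_cokernel: "\<lbrakk>j \<in> J; is_cokernel E X Y f Q q\<rbrakk>
      \<Longrightarrow> is_cokernel E (omap (T j) X) (omap (T j) Y) (amap (T j) f) (omap (T j) Q) (amap (T j) q)"
begin

text \<open>In an abelian category every epi is a cokernel, so it falls under
  \<open>T_cokernel\<close>.\<close>

lemma T_epi: "j \<in> J \<Longrightarrow> preserves_epis E E (T j)"
  unfolding preserves_epis_def using T_cokernel epi_is_cokernel cokernel_epi by meson

text \<open>Besides linearity of the functor, only the types of the operations are recorded.
  Naturality of a multiplication in its arguments counts as one of the laws, which are treated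
  through \<open>stable\<close>.\<close>

definition has_operations :: "('mo, 'ma, 'eo, 'ea) ftor \<Rightarrow> ('j \<Rightarrow> 'ea) \<Rightarrow> bool" where
  "has_operations N n \<longleftrightarrow> linear_functor R M E N \<and>
    (\<forall>j \<in> J. \<guillemotleft>n j : omap (T j) (omap N (src j)) \<rightarrow>\<^bsub>E\<^esub> omap N (tgt j)\<guillemotright>)"

definition op_map ::
  "('mo, 'ma, 'eo, 'ea) ftor \<Rightarrow> ('j \<Rightarrow> 'ea) \<Rightarrow> ('mo, 'ma, 'eo, 'ea) ftor \<Rightarrow> ('j \<Rightarrow> 'ea) \<Rightarrow>
   ('mo \<Rightarrow> 'ea) \<Rightarrow> bool" where
  "op_map N n P p f \<longleftrightarrow> natural M E N P f \<and>
    (\<forall>j \<in> J. f (tgt j) \<cdot>\<^bsub>E\<^esub> n j = p j \<cdot>\<^bsub>E\<^esub> amap (T j) (f (src j)))"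

lemma has_operations_linear: "has_operations N n \<Longrightarrow> linear_functor R M E N"
  by (simp add: has_operations_def)

lemma has_operations_in_hom:
  "\<lbrakk>has_operations N n; j \<in> J\<rbrakk> \<Longrightarrow> \<guillemotleft>n j : omap (T j) (omap N (src j)) \<rightarrow>\<^bsub>E\<^esub> omap N (tgt j)\<guillemotright>"
  by (simp add: has_operations_def)

lemma op_map_in_hom: "\<lbrakk>op_map N n P p f; X \<in> Obj M\<rbrakk> \<Longrightarrow> \<guillemotleft>f X : omap N X \<rightarrow>\<^bsub>E\<^esub> omap P X\<guillemotright>"
  by (simp add: op_map_def natural_def)

lemma op_map_natural:
  "\<lbrakk>op_map N n P p f; \<guillemotleft>h : X \<rightarrow>\<^bsub>M\<^esub> Y\<guillemotright>\<rbrakk> \<Longrightarrow> f Y \<cdot>\<^bsub>E\<^esub> amap N h = amap P h \<cdot>\<^bsub>E\<^esub> f X"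
  by (simp add: op_map_def natural_def)

lemma op_map_op:
  "\<lbrakk>op_map N n P p f; j \<in> J\<rbrakk> \<Longrightarrow> f (tgt j) \<cdot>\<^bsub>E\<^esub> n j = p j \<cdot>\<^bsub>E\<^esub> amap (T j) (f (src j))"
  by (simp add: op_map_def)

lemma op_mapI:
  assumes "\<And>X. X \<in> Obj M \<Longrightarrow> \<guillemotleft>f X : omap N X \<rightarrow>\<^bsub>E\<^esub> omap P X\<guillemotright>"
    and "\<And>X Y h. \<guillemotleft>h : X \<rightarrow>\<^bsub>M\<^esub> Y\<guillemotright> \<Longrightarrow> f Y \<cdot>\<^bsub>E\<^esub> amap N h = amap P h \<cdot>\<^bsub>E\<^esub> f X"
    and "\<And>j. j \<in> J \<Longrightarrow> f (tgt j) \<cdot>\<^bsub>E\<^esub> n j = p j \<cdot>\<^bsub>E\<^esub> amap (T j) (f (src j))"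
  shows "op_map N n P p f"
  using assms by (simp add: op_map_def natural_def)

text \<open>A family of components matters only at objects of \<open>M\<close>. This gives the
  passage between a family and its restriction, which is needed because arrows of the module
  categories are extensional.\<close>

lemma op_map_cong:
  assumes "op_map N n P p f" and "\<And>X. X \<in> Obj M \<Longrightarrow> f X = g X"
  shows "op_map N n P p g"
proof -
  have obj: "\<guillemotleft>h : X \<rightarrow>\<^bsub>M\<^esub> Y\<guillemotright> \<Longrightarrow> X \<in> Obj M \<and> Y \<in> Obj M" for h X Y by (simp add: in_hom_def)
  show ?thesis
    using assms op_map_in_hom[OF assms(1)] op_map_natural[OF assms(1)] op_map_op[OF assms(1)]
    by (intro op_mapI) (metis obj src_obj tgt_obj)+
qed

lemma op_map_comp:
  assumes N: "has_operations N n" and P: "has_operations P p" and Q: "has_operations Q q"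
    and f: "op_map N n P p f" and g: "op_map P p Q q g"
  shows "op_map N n Q q (\<lambda>X. g X \<cdot>\<^bsub>E\<^esub> f X)"
proof -
  interpret N: linear_functor R M E N using N by (rule has_operations_linear)
  interpret P: linear_functor R M E P using P by (rule has_operations_linear)
  interpret Q: linear_functor R M E Q using Q by (rule has_operations_linear)
  note f' = op_map_in_hom[OF f] and g' = op_map_in_hom[OF g]
  show ?thesis
  proof (rule op_mapI)
    show "\<guillemotleft>g X \<cdot>\<^bsub>E\<^esub> f X : omap N X \<rightarrow>\<^bsub>E\<^esub> omap Q X\<guillemotright>" if "X \<in> Obj M" for X
      by (rule comp_in_hom[OF f'[OF that] g'[OF that]])
    show "g Y \<cdot>\<^bsub>E\<^esub> f Y \<cdot>\<^bsub>E\<^esub> amap N h = amap Q h \<cdot>\<^bsub>E\<^esub> (g X \<cdot>\<^bsub>E\<^esub> f X)" if h: "\<guillemotleft>h : X \<rightarrow>\<^bsub>M\<^esub> Y\<guillemotright>" for X Y h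
    proof -
      have X: "X \<in> Obj M" and Y: "Y \<in> Obj M" using h by (auto simp: in_hom_def)
      show ?thesis
        by (simp add: comp_assoc[OF N.amap_in_hom[OF h] f'[OF Y] g'[OF Y]] op_map_natural[OF f h]
            comp_assoc[OF f'[OF X] P.amap_in_hom[OF h] g'[OF Y], symmetric] op_map_natural[OF g h]
            comp_assoc[OF f'[OF X] g'[OF X] Q.amap_in_hom[OF h]])
    qed
    show "g (tgt j) \<cdot>\<^bsub>E\<^esub> f (tgt j) \<cdot>\<^bsub>E\<^esub> n j = q j \<cdot>\<^bsub>E\<^esub> amap (T j) (g (src j) \<cdot>\<^bsub>E\<^esub> f (src j))" if j: "j \<in> J" for j
    proof -
      interpret T: linear_functor R E E "T j" by (rule T_linear[OF j])
      note s = src_obj[OF j] and t = tgt_obj[OF j]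
      show ?thesis
        by (simp add: comp_assoc[OF has_operations_in_hom[OF N j] f'[OF t] g'[OF t]] op_map_op[OF f j]
            comp_assoc[OF T.amap_in_hom[OF f'[OF s]] has_operations_in_hom[OF P j] g'[OF t], symmetric]
            op_map_op[OF g j] T.amap_comp[OF f'[OF s] g'[OF s]]
            comp_assoc[OF T.amap_in_hom[OF f'[OF s]] T.amap_in_hom[OF g'[OF s]] has_operations_in_hom[OF Q j]])
    qed
  qed
qed

lemma op_map_id:
  assumes N: "has_operations N n"
  shows "op_map N n N n (\<lambda>X. Id E (omap N X))"
proof -
  interpret N: linear_functor R M E N using N by (rule has_operations_linear)
  show ?thesis
  proof (rule op_mapI)
    show "Id E (omap N Y) \<cdot>\<^bsub>E\<^esub> amap N h = amap N h \<cdot>\<^bsub>E\<^esub> Id E (omap N X)" if "\<guillemotleft>h : X \<rightarrow>\<^bsub>M\<^esub> Y\<guillemotright>" for X Y h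
      using N.amap_in_hom[OF that] by (simp add: comp_id_left comp_id_right)
    show "Id E (omap N (tgt j)) \<cdot>\<^bsub>E\<^esub> n j = n j \<cdot>\<^bsub>E\<^esub> amap (T j) (Id E (omap N (src j)))" if j: "j \<in> J" for j
    proof -
      interpret T: linear_functor R E E "T j" by (rule T_linear[OF j])
      show ?thesis using has_operations_in_hom[OF N j]
        by (simp add: T.amap_id N.omap_obj src_obj[OF j] comp_id_left comp_id_right)
    qed
  qed (simp add: N.omap_obj id_in_hom)
qed

text \<open>
  With \<open>K\<close> empty, a kernel inclusion, or the two projections of a biproduct, this yields zero objects,
  kernels and biproducts.
\<close>

lemma lift_operations:
  fixes K :: "(('mo, 'ma, 'eo, 'ea) ftor \<times> ('j \<Rightarrow> 'ea) \<times> ('mo \<Rightarrow> 'ea)) set" and Z :: "'mo \<Rightarrow> 'eo"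
  assumes K: "\<And>P p k. (P, p, k) \<in> K \<Longrightarrow> has_operations P p"
    and Z: "\<And>X. X \<in> Obj M \<Longrightarrow> Z X \<in> Obj E"
    and k: "\<And>P p k X. \<lbrakk>(P, p, k) \<in> K; X \<in> Obj M\<rbrakk> \<Longrightarrow> \<guillemotleft>k X : Z X \<rightarrow>\<^bsub>E\<^esub> omap P X\<guillemotright>"
    and mono: "\<And>X. X \<in> Obj M \<Longrightarrow> jointly_mono E (Z X) {k X | P p k. (P, p, k) \<in> K}"
    and arr: "\<And>X Y h. \<guillemotleft>h : X \<rightarrow>\<^bsub>M\<^esub> Y\<guillemotright> \<Longrightarrow> \<exists>u. \<guillemotleft>u : Z X \<rightarrow>\<^bsub>E\<^esub> Z Y\<guillemotright> \<and>
      (\<forall>P p k. (P, p, k) \<in> K \<longrightarrow> k Y \<cdot>\<^bsub>E\<^esub> u = amap P h \<cdot>\<^bsub>E\<^esub> k X)"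
    and op: "\<And>j. j \<in> J \<Longrightarrow> \<exists>u. \<guillemotleft>u : omap (T j) (Z (src j)) \<rightarrow>\<^bsub>E\<^esub> Z (tgt j)\<guillemotright> \<and>
      (\<forall>P p k. (P, p, k) \<in> K \<longrightarrow> k (tgt j) \<cdot>\<^bsub>E\<^esub> u = p j \<cdot>\<^bsub>E\<^esub> amap (T j) (k (src j)))"
  obtains N n where "has_operations N n" "ftor_extensional M N" "\<And>X. X \<in> Obj M \<Longrightarrow> omap N X = Z X"
    "\<And>P p k. (P, p, k) \<in> K \<Longrightarrow> op_map N n P p k"
proof -
  \<comment> \<open>The factorisation has to be chosen from \<open>h\<close> alone, since
    \<open>amap\<close> takes no object arguments. Disjointness of the hom-sets of \<open>M\<close>
    makes \<open>X\<close> and \<open>Y\<close> determined by \<open>h\<close>.\<close>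
  obtain a where a: "\<And>h X Y. \<guillemotleft>h : X \<rightarrow>\<^bsub>M\<^esub> Y\<guillemotright> \<Longrightarrow> \<guillemotleft>a h : Z X \<rightarrow>\<^bsub>E\<^esub> Z Y\<guillemotright> \<and>
      (\<forall>P p k. (P, p, k) \<in> K \<longrightarrow> k Y \<cdot>\<^bsub>E\<^esub> a h = amap P h \<cdot>\<^bsub>E\<^esub> k X)"
  proof -
    have "\<exists>u. \<forall>X Y. \<guillemotleft>h : X \<rightarrow>\<^bsub>M\<^esub> Y\<guillemotright> \<longrightarrow> \<guillemotleft>u : Z X \<rightarrow>\<^bsub>E\<^esub> Z Y\<guillemotright> \<and>
        (\<forall>P p k. (P, p, k) \<in> K \<longrightarrow> k Y \<cdot>\<^bsub>E\<^esub> u = amap P h \<cdot>\<^bsub>E\<^esub> k X)" for h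
    proof (cases "\<exists>X Y. \<guillemotleft>h : X \<rightarrow>\<^bsub>M\<^esub> Y\<guillemotright>")
      case True
      then obtain X Y where h: "\<guillemotleft>h : X \<rightarrow>\<^bsub>M\<^esub> Y\<guillemotright>" by blast
      then show ?thesis using arr[OF h] base.hom_disjoint[OF h] by blast
    qed blast
    then show ?thesis using that by metis
  qed
  have a_hom: "\<guillemotleft>a h : Z X \<rightarrow>\<^bsub>E\<^esub> Z Y\<guillemotright>" if "\<guillemotleft>h : X \<rightarrow>\<^bsub>M\<^esub> Y\<guillemotright>" for h X Y using a that by blast
  have a_eq: "k Y \<cdot>\<^bsub>E\<^esub> a h = amap P h \<cdot>\<^bsub>E\<^esub> k X" if "\<guillemotleft>h : X \<rightarrow>\<^bsub>M\<^esub> Y\<guillemotright>" "(P, p, k) \<in> K" for h X Y P p k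
    using a that by blast
  obtain n where n: "\<And>j. j \<in> J \<Longrightarrow> \<guillemotleft>n j : omap (T j) (Z (src j)) \<rightarrow>\<^bsub>E\<^esub> Z (tgt j)\<guillemotright> \<and>
      (\<forall>P p k. (P, p, k) \<in> K \<longrightarrow> k (tgt j) \<cdot>\<^bsub>E\<^esub> n j = p j \<cdot>\<^bsub>E\<^esub> amap (T j) (k (src j)))"
    using op by metis
  define N where "N = \<lparr>omap = restrict Z (Obj M), amap = restrict a (Arr M)\<rparr>"
  have N_obj: "omap N X = Z X" if "X \<in> Obj M" for X using that by (simp add: N_def)
  have N_arr: "amap N h = a h" if "\<guillemotleft>h : X \<rightarrow>\<^bsub>M\<^esub> Y\<guillemotright>" for h X Y
    using that by (auto simp: N_def Arr_def restrict_def)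
  \<comment> \<open>Each functor law for \<open>N\<close> is an equation between arrows into some
    \<open>Z Y\<close>. Composing with the maps \<open>k\<close> turns it into the same law for the
    functors \<open>P\<close>.\<close>
  have eqI: "u = v" if "Y \<in> Obj M" "\<guillemotleft>u : W \<rightarrow>\<^bsub>E\<^esub> Z Y\<guillemotright>" "\<guillemotleft>v : W \<rightarrow>\<^bsub>E\<^esub> Z Y\<guillemotright>"
      "\<And>P p k. (P, p, k) \<in> K \<Longrightarrow> k Y \<cdot>\<^bsub>E\<^esub> u = k Y \<cdot>\<^bsub>E\<^esub> v" for u v W Y
    by (rule jointly_monoD[OF mono[OF that(1)] _ that(2,3)]) (use that(4) in auto)
  have lin: "linear_functor R M E N"
  proof
    fix X assume X: "X \<in> Obj M"
    show "omap N X \<in> Obj E" by (simp add: N_obj X Z)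
    note i = base.id_in_hom[OF X]
    have "a (Id M X) = Id E (Z X)"
    proof (rule eqI[OF X a_hom[OF i] id_in_hom[OF Z[OF X]]])
      fix P p k assume in_K: "(P, p, k) \<in> K"
      interpret P: linear_functor R M E P using K[OF in_K] by (rule has_operations_linear)
      show "k X \<cdot>\<^bsub>E\<^esub> a (Id M X) = k X \<cdot>\<^bsub>E\<^esub> Id E (Z X)"
        using a_eq[OF i in_K] k[OF in_K X] by (simp add: P.amap_id[OF X] comp_id_left comp_id_right)
    qed
    then show "amap N (Id M X) = Id E (omap N X)" by (simp add: N_obj X N_arr[OF i])
  next
    fix X Y f assume f: "\<guillemotleft>f : X \<rightarrow>\<^bsub>M\<^esub> Y\<guillemotright>"
    have X: "X \<in> Obj M" and Y: "Y \<in> Obj M" using f by (auto simp: in_hom_def)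
    show "\<guillemotleft>amap N f : omap N X \<rightarrow>\<^bsub>E\<^esub> omap N Y\<guillemotright>" by (simp add: N_arr[OF f] N_obj X Y a_hom[OF f])
    show "amap N (g \<cdot>\<^bsub>M\<^esub> f) = amap N g \<cdot>\<^bsub>E\<^esub> amap N f" if g: "\<guillemotleft>g : Y \<rightarrow>\<^bsub>M\<^esub> W\<guillemotright>" for g W
    proof -
      note gf = base.comp_in_hom[OF f g]
      have W: "W \<in> Obj M" using g by (simp add: in_hom_def)
      have "a (g \<cdot>\<^bsub>M\<^esub> f) = a g \<cdot>\<^bsub>E\<^esub> a f"
      proof (rule eqI[OF W a_hom[OF gf] comp_in_hom[OF a_hom[OF f] a_hom[OF g]]])
        fix P p k assume in_K: "(P, p, k) \<in> K"
        interpret P: linear_functor R M E P using K[OF in_K] by (rule has_operations_linear)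
        show "k W \<cdot>\<^bsub>E\<^esub> a (g \<cdot>\<^bsub>M\<^esub> f) = k W \<cdot>\<^bsub>E\<^esub> (a g \<cdot>\<^bsub>E\<^esub> a f)"
          by (simp add: a_eq[OF gf in_K] P.amap_comp[OF f g]
              comp_assoc[OF k[OF in_K X] P.amap_in_hom[OF f] P.amap_in_hom[OF g]]
              a_eq[OF f in_K, symmetric] comp_assoc[OF a_hom[OF f] k[OF in_K Y] P.amap_in_hom[OF g], symmetric]
              a_eq[OF g in_K, symmetric] comp_assoc[OF a_hom[OF f] a_hom[OF g] k[OF in_K W]])
      qed
      then show ?thesis by (simp add: N_arr[OF f] N_arr[OF g] N_arr[OF gf])
    qed
    show "amap N (f \<oplus>\<^bsub>Hom M X Y\<^esub> g) = amap N f \<oplus>\<^bsub>Hom E (omap N X) (omap N Y)\<^esub> amap N g"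
      if g: "\<guillemotleft>g : X \<rightarrow>\<^bsub>M\<^esub> Y\<guillemotright>" for g
    proof -
      note fg = base.add_in_hom[OF f g]
      have "a (f \<oplus>\<^bsub>Hom M X Y\<^esub> g) = a f \<oplus>\<^bsub>Hom E (Z X) (Z Y)\<^esub> a g"
      proof (rule eqI[OF Y a_hom[OF fg] add_in_hom[OF a_hom[OF f] a_hom[OF g]]])
        fix P p k assume in_K: "(P, p, k) \<in> K"
        interpret P: linear_functor R M E P using K[OF in_K] by (rule has_operations_linear)
        show "k Y \<cdot>\<^bsub>E\<^esub> a (f \<oplus>\<^bsub>Hom M X Y\<^esub> g) = k Y \<cdot>\<^bsub>E\<^esub> (a f \<oplus>\<^bsub>Hom E (Z X) (Z Y)\<^esub> a g)"
          by (simp add: a_eq[OF fg in_K] P.amap_add[OF f g]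
              comp_add_left[OF k[OF in_K X] P.amap_in_hom[OF f] P.amap_in_hom[OF g]]
              a_eq[OF f in_K] a_eq[OF g in_K] comp_add_right[OF a_hom[OF f] a_hom[OF g] k[OF in_K Y]])
      qed
      then show ?thesis by (simp add: N_arr[OF f] N_arr[OF g] N_arr[OF fg] N_obj X Y)
    qed
    show "amap N (c \<odot>\<^bsub>Hom M X Y\<^esub> f) = c \<odot>\<^bsub>Hom E (omap N X) (omap N Y)\<^esub> amap N f"
      if c: "c \<in> carrier R" for c
    proof -
      note cf = base.smult_in_hom[OF c f]
      have "a (c \<odot>\<^bsub>Hom M X Y\<^esub> f) = c \<odot>\<^bsub>Hom E (Z X) (Z Y)\<^esub> a f"
      proof (rule eqI[OF Y a_hom[OF cf] smult_in_hom[OF c a_hom[OF f]]])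
        fix P p k assume in_K: "(P, p, k) \<in> K"
        interpret P: linear_functor R M E P using K[OF in_K] by (rule has_operations_linear)
        show "k Y \<cdot>\<^bsub>E\<^esub> a (c \<odot>\<^bsub>Hom M X Y\<^esub> f) = k Y \<cdot>\<^bsub>E\<^esub> (c \<odot>\<^bsub>Hom E (Z X) (Z Y)\<^esub> a f)"
          by (simp add: a_eq[OF cf in_K] P.amap_smult[OF c f]
              comp_smult_left[OF c k[OF in_K X] P.amap_in_hom[OF f]]
              a_eq[OF f in_K] comp_smult_right[OF c a_hom[OF f] k[OF in_K Y]])
      qed
      then show ?thesis by (simp add: N_arr[OF f] N_arr[OF cf] N_obj X Y)
    qed
  qed
  show ?thesis
  proof (rule that)
    show "has_operations N n" using lin n by (simp add: has_operations_def N_obj src_obj tgt_obj)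
    show "ftor_extensional M N" by (simp add: ftor_extensional_def N_def)
    show "omap N X = Z X" if "X \<in> Obj M" for X by (rule N_obj[OF that])
    show "op_map N n P p k" if "(P, p, k) \<in> K" for P p k
      by (rule op_mapI) (use that k n a_eq in \<open>auto simp: N_obj N_arr\<close>)
  qed
qed

text \<open>Dual to \<open>lift_operations\<close>, with one epic family \<open>q\<close> in place
  of a set of maps, because quotients are taken of a single structure. In the premise
  \<open>op\<close>, factoring through the image of \<open>q\<close> under \<open>T j\<close> is
  what right exactness of \<open>T j\<close> will provide.\<close>

lemma descend_operations:
  assumes P: "has_operations P p"
    and epi: "\<And>X. X \<in> Obj M \<Longrightarrow> is_epi E (omap P X) (Z X) (q X)"
    and arr: "\<And>X Y h. \<guillemotleft>h : X \<rightarrow>\<^bsub>M\<^esub> Y\<guillemotright> \<Longrightarrow> \<exists>u. \<guillemotleft>u : Z X \<rightarrow>\<^bsub>E\<^esub> Z Y\<guillemotright> \<and> u \<cdot>\<^bsub>E\<^esub> q X = q Y \<cdot>\<^bsub>E\<^esub> amap P h"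
    and op: "\<And>j. j \<in> J \<Longrightarrow> \<exists>u. \<guillemotleft>u : omap (T j) (Z (src j)) \<rightarrow>\<^bsub>E\<^esub> Z (tgt j)\<guillemotright> \<and>
      u \<cdot>\<^bsub>E\<^esub> amap (T j) (q (src j)) = q (tgt j) \<cdot>\<^bsub>E\<^esub> p j"
  obtains N n where "has_operations N n" "ftor_extensional M N" "\<And>X. X \<in> Obj M \<Longrightarrow> omap N X = Z X"
    "op_map P p N n q"
proof -
  interpret P: linear_functor R M E P using P by (rule has_operations_linear)
  have q: "\<guillemotleft>q X : omap P X \<rightarrow>\<^bsub>E\<^esub> Z X\<guillemotright>" if "X \<in> Obj M" for X using epi[OF that] by (simp add: is_epi_def)
  have Z: "Z X \<in> Obj E" if "X \<in> Obj M" for X using q[OF that] by (simp add: in_hom_def)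
  obtain a where a: "\<And>h X Y. \<guillemotleft>h : X \<rightarrow>\<^bsub>M\<^esub> Y\<guillemotright> \<Longrightarrow> \<guillemotleft>a h : Z X \<rightarrow>\<^bsub>E\<^esub> Z Y\<guillemotright> \<and> a h \<cdot>\<^bsub>E\<^esub> q X = q Y \<cdot>\<^bsub>E\<^esub> amap P h"
  proof -
    have "\<exists>u. \<forall>X Y. \<guillemotleft>h : X \<rightarrow>\<^bsub>M\<^esub> Y\<guillemotright> \<longrightarrow> \<guillemotleft>u : Z X \<rightarrow>\<^bsub>E\<^esub> Z Y\<guillemotright> \<and> u \<cdot>\<^bsub>E\<^esub> q X = q Y \<cdot>\<^bsub>E\<^esub> amap P h" for h
    proof (cases "\<exists>X Y. \<guillemotleft>h : X \<rightarrow>\<^bsub>M\<^esub> Y\<guillemotright>")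
      case True
      then obtain X Y where h: "\<guillemotleft>h : X \<rightarrow>\<^bsub>M\<^esub> Y\<guillemotright>" by blast
      then show ?thesis using arr[OF h] base.hom_disjoint[OF h] by blast
    qed blast
    then show ?thesis using that by metis
  qed
  have a_hom: "\<guillemotleft>a h : Z X \<rightarrow>\<^bsub>E\<^esub> Z Y\<guillemotright>" and a_eq: "a h \<cdot>\<^bsub>E\<^esub> q X = q Y \<cdot>\<^bsub>E\<^esub> amap P h"
    if "\<guillemotleft>h : X \<rightarrow>\<^bsub>M\<^esub> Y\<guillemotright>" for h X Y using a that by blast+
  obtain n where n: "\<And>j. j \<in> J \<Longrightarrow> \<guillemotleft>n j : omap (T j) (Z (src j)) \<rightarrow>\<^bsub>E\<^esub> Z (tgt j)\<guillemotright> \<and>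
      n j \<cdot>\<^bsub>E\<^esub> amap (T j) (q (src j)) = q (tgt j) \<cdot>\<^bsub>E\<^esub> p j"
    using op by metis
  define N where "N = \<lparr>omap = restrict Z (Obj M), amap = restrict a (Arr M)\<rparr>"
  have N_obj: "omap N X = Z X" if "X \<in> Obj M" for X using that by (simp add: N_def)
  have N_arr: "amap N h = a h" if "\<guillemotleft>h : X \<rightarrow>\<^bsub>M\<^esub> Y\<guillemotright>" for h X Y
    using that by (auto simp: N_def Arr_def restrict_def)
  have lin: "linear_functor R M E N"
  proof
    fix X assume X: "X \<in> Obj M"
    show "omap N X \<in> Obj E" by (simp add: N_obj X Z)
    note i = base.id_in_hom[OF X]
    have "a (Id M X) \<cdot>\<^bsub>E\<^esub> q X = Id E (Z X) \<cdot>\<^bsub>E\<^esub> q X"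
      using a_eq[OF i] q[OF X] by (simp add: P.amap_id[OF X] comp_id_left comp_id_right)
    then have "a (Id M X) = Id E (Z X)"
      by (rule epi_cancel[OF epi[OF X] _ a_hom[OF i] id_in_hom[OF Z[OF X]]])
    then show "amap N (Id M X) = Id E (omap N X)" by (simp add: N_obj X N_arr[OF i])
  next
    fix X Y f assume f: "\<guillemotleft>f : X \<rightarrow>\<^bsub>M\<^esub> Y\<guillemotright>"
    have X: "X \<in> Obj M" and Y: "Y \<in> Obj M" using f by (auto simp: in_hom_def)
    show "\<guillemotleft>amap N f : omap N X \<rightarrow>\<^bsub>E\<^esub> omap N Y\<guillemotright>" by (simp add: N_arr[OF f] N_obj X Y a_hom[OF f])
    show "amap N (g \<cdot>\<^bsub>M\<^esub> f) = amap N g \<cdot>\<^bsub>E\<^esub> amap N f" if g: "\<guillemotleft>g : Y \<rightarrow>\<^bsub>M\<^esub> W\<guillemotright>" for g W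
    proof -
      note gf = base.comp_in_hom[OF f g]
      have W: "W \<in> Obj M" using g by (simp add: in_hom_def)
      have "a (g \<cdot>\<^bsub>M\<^esub> f) \<cdot>\<^bsub>E\<^esub> q X = a g \<cdot>\<^bsub>E\<^esub> a f \<cdot>\<^bsub>E\<^esub> q X"
        by (simp add: a_eq[OF gf] P.amap_comp[OF f g] comp_assoc[OF q[OF X] a_hom[OF f] a_hom[OF g]] a_eq[OF f]
            comp_assoc[OF P.amap_in_hom[OF f] q[OF Y] a_hom[OF g], symmetric] a_eq[OF g]
            comp_assoc[OF P.amap_in_hom[OF f] P.amap_in_hom[OF g] q[OF W]])
      then have "a (g \<cdot>\<^bsub>M\<^esub> f) = a g \<cdot>\<^bsub>E\<^esub> a f"
        by (rule epi_cancel[OF epi[OF X] _ a_hom[OF gf] comp_in_hom[OF a_hom[OF f] a_hom[OF g]]])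
      then show ?thesis by (simp add: N_arr[OF f] N_arr[OF g] N_arr[OF gf])
    qed
    show "amap N (f \<oplus>\<^bsub>Hom M X Y\<^esub> g) = amap N f \<oplus>\<^bsub>Hom E (omap N X) (omap N Y)\<^esub> amap N g"
      if g: "\<guillemotleft>g : X \<rightarrow>\<^bsub>M\<^esub> Y\<guillemotright>" for g
    proof -
      note fg = base.add_in_hom[OF f g]
      have "a (f \<oplus>\<^bsub>Hom M X Y\<^esub> g) \<cdot>\<^bsub>E\<^esub> q X = (a f \<oplus>\<^bsub>Hom E (Z X) (Z Y)\<^esub> a g) \<cdot>\<^bsub>E\<^esub> q X"
        by (simp add: a_eq[OF fg] P.amap_add[OF f g] comp_add_left[OF q[OF X] a_hom[OF f] a_hom[OF g]]
            a_eq[OF f] a_eq[OF g] comp_add_right[OF P.amap_in_hom[OF f] P.amap_in_hom[OF g] q[OF Y]])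
      then have "a (f \<oplus>\<^bsub>Hom M X Y\<^esub> g) = a f \<oplus>\<^bsub>Hom E (Z X) (Z Y)\<^esub> a g"
        by (rule epi_cancel[OF epi[OF X] _ a_hom[OF fg] add_in_hom[OF a_hom[OF f] a_hom[OF g]]])
      then show ?thesis by (simp add: N_arr[OF f] N_arr[OF g] N_arr[OF fg] N_obj X Y)
    qed
    show "amap N (c \<odot>\<^bsub>Hom M X Y\<^esub> f) = c \<odot>\<^bsub>Hom E (omap N X) (omap N Y)\<^esub> amap N f"
      if c: "c \<in> carrier R" for c
    proof -
      note cf = base.smult_in_hom[OF c f]
      have "a (c \<odot>\<^bsub>Hom M X Y\<^esub> f) \<cdot>\<^bsub>E\<^esub> q X = (c \<odot>\<^bsub>Hom E (Z X) (Z Y)\<^esub> a f) \<cdot>\<^bsub>E\<^esub> q X"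
        by (simp add: a_eq[OF cf] P.amap_smult[OF c f] comp_smult_left[OF c q[OF X] a_hom[OF f]]
            a_eq[OF f] comp_smult_right[OF c P.amap_in_hom[OF f] q[OF Y]])
      then have "a (c \<odot>\<^bsub>Hom M X Y\<^esub> f) = c \<odot>\<^bsub>Hom E (Z X) (Z Y)\<^esub> a f"
        by (rule epi_cancel[OF epi[OF X] _ a_hom[OF cf] smult_in_hom[OF c a_hom[OF f]]])
      then show ?thesis by (simp add: N_arr[OF f] N_arr[OF cf] N_obj X Y)
    qed
  qed
  show ?thesis
  proof (rule that)
    show "has_operations N n" using lin n by (simp add: has_operations_def N_obj src_obj tgt_obj)
    show "ftor_extensional M N" by (simp add: ftor_extensional_def N_def)
    show "omap N X = Z X" if "X \<in> Obj M" for X by (rule N_obj[OF that])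
    show "op_map P p N n q"
      by (rule op_mapI) (use q n a_eq in \<open>auto simp: N_obj N_arr\<close>)
  qed
qed

text \<open>A factorisation chosen object by object is automatically a map of structures: composing
  a square for \<open>u\<close> with any \<open>k\<close> gives a square for the composite of
  \<open>k\<close> and \<open>u\<close>, and the family of all \<open>k\<close> cancels. Universal
  properties in the module category are obtained from pointwise ones in this way.\<close>

lemma op_map_factor_mono:
  fixes K :: "(('mo, 'ma, 'eo, 'ea) ftor \<times> ('j \<Rightarrow> 'ea) \<times> ('mo \<Rightarrow> 'ea)) set"
  assumes W: "has_operations W w" and N: "has_operations N n"
    and P: "\<And>P p k. (P, p, k) \<in> K \<Longrightarrow> has_operations P p"
    and k: "\<And>P p k. (P, p, k) \<in> K \<Longrightarrow> op_map N n P p k"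
    and mono: "\<And>X. X \<in> Obj M \<Longrightarrow> jointly_mono E (omap N X) {k X | P p k. (P, p, k) \<in> K}"
    and u: "\<And>X. X \<in> Obj M \<Longrightarrow> \<guillemotleft>u X : omap W X \<rightarrow>\<^bsub>E\<^esub> omap N X\<guillemotright>"
    and ku: "\<And>P p k. (P, p, k) \<in> K \<Longrightarrow> op_map W w P p (\<lambda>X. k X \<cdot>\<^bsub>E\<^esub> u X)"
  shows "op_map W w N n u"
proof (rule op_mapI[OF u])
  interpret W: linear_functor R M E W using W by (rule has_operations_linear)
  interpret N: linear_functor R M E N using N by (rule has_operations_linear)
  show "u Y \<cdot>\<^bsub>E\<^esub> amap W h = amap N h \<cdot>\<^bsub>E\<^esub> u X" if h: "\<guillemotleft>h : X \<rightarrow>\<^bsub>M\<^esub> Y\<guillemotright>" for X Y h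
  proof -
    have X: "X \<in> Obj M" and Y: "Y \<in> Obj M" using h by (auto simp: in_hom_def)
    have "k Y \<cdot>\<^bsub>E\<^esub> (u Y \<cdot>\<^bsub>E\<^esub> amap W h) = k Y \<cdot>\<^bsub>E\<^esub> (amap N h \<cdot>\<^bsub>E\<^esub> u X)" if in_K: "(P, p, k) \<in> K" for P p k
    proof -
      interpret P: linear_functor R M E P using P[OF in_K] by (rule has_operations_linear)
      note k' = op_map_in_hom[OF k[OF in_K]]
      show ?thesis
        by (simp add: comp_assoc[OF W.amap_in_hom[OF h] u[OF Y] k'[OF Y], symmetric]
            op_map_natural[OF ku[OF in_K] h] comp_assoc[OF u[OF X] k'[OF X] P.amap_in_hom[OF h], symmetric]
            op_map_natural[OF k[OF in_K] h, symmetric] comp_assoc[OF u[OF X] N.amap_in_hom[OF h] k'[OF Y]])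
    qed
    then show ?thesis
      by (intro jointly_monoD[OF mono[OF Y] _ comp_in_hom[OF W.amap_in_hom[OF h] u[OF Y]]
            comp_in_hom[OF u[OF X] N.amap_in_hom[OF h]]]) auto
  qed
  show "u (tgt j) \<cdot>\<^bsub>E\<^esub> w j = n j \<cdot>\<^bsub>E\<^esub> amap (T j) (u (src j))" if j: "j \<in> J" for j
  proof -
    interpret T: linear_functor R E E "T j" by (rule T_linear[OF j])
    note s = src_obj[OF j] and t = tgt_obj[OF j]
    note w = has_operations_in_hom[OF W j] and n = has_operations_in_hom[OF N j]
    have "k (tgt j) \<cdot>\<^bsub>E\<^esub> (u (tgt j) \<cdot>\<^bsub>E\<^esub> w j) = k (tgt j) \<cdot>\<^bsub>E\<^esub> (n j \<cdot>\<^bsub>E\<^esub> amap (T j) (u (src j)))"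
      if in_K: "(P, p, k) \<in> K" for P p k
    proof -
      note k' = op_map_in_hom[OF k[OF in_K]]
      note p = has_operations_in_hom[OF P[OF in_K] j]
      show ?thesis
        by (simp add: comp_assoc[OF w u[OF t] k'[OF t], symmetric] op_map_op[OF ku[OF in_K] j]
            T.amap_comp[OF u[OF s] k'[OF s]]
            comp_assoc[OF T.amap_in_hom[OF u[OF s]] T.amap_in_hom[OF k'[OF s]] p, symmetric]
            op_map_op[OF k[OF in_K] j, symmetric] comp_assoc[OF T.amap_in_hom[OF u[OF s]] n k'[OF t]])
    qed
    then show ?thesis
      by (intro jointly_monoD[OF mono[OF t] _ comp_in_hom[OF w u[OF t]]
            comp_in_hom[OF T.amap_in_hom[OF u[OF s]] n]]) auto
  qed
qed

text \<open>Dual to \<open>op_map_factor_mono\<close>. The square for an operation has to be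
  precomposed with the image of \<open>q\<close> under \<open>T j\<close> and not with
  \<open>q\<close> itself, so cancelling uses that \<open>T j\<close> preserves epis.\<close>

lemma op_map_factor_epi:
  assumes P: "has_operations P p" and N: "has_operations N n" and W: "has_operations W w"
    and q: "op_map P p N n q"
    and epi: "\<And>X. X \<in> Obj M \<Longrightarrow> is_epi E (omap P X) (omap N X) (q X)"
    and u: "\<And>X. X \<in> Obj M \<Longrightarrow> \<guillemotleft>u X : omap N X \<rightarrow>\<^bsub>E\<^esub> omap W X\<guillemotright>"
    and uq: "op_map P p W w (\<lambda>X. u X \<cdot>\<^bsub>E\<^esub> q X)"
  shows "op_map N n W w u"
proof (rule op_mapI[OF u])
  interpret P: linear_functor R M E P using P by (rule has_operations_linear)
  interpret W: linear_functor R M E W using W by (rule has_operations_linear)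
  interpret N: linear_functor R M E N using N by (rule has_operations_linear)
  note q' = op_map_in_hom[OF q]
  show "u Y \<cdot>\<^bsub>E\<^esub> amap N h = amap W h \<cdot>\<^bsub>E\<^esub> u X" if h: "\<guillemotleft>h : X \<rightarrow>\<^bsub>M\<^esub> Y\<guillemotright>" for X Y h
  proof -
    have X: "X \<in> Obj M" and Y: "Y \<in> Obj M" using h by (auto simp: in_hom_def)
    have "u Y \<cdot>\<^bsub>E\<^esub> amap N h \<cdot>\<^bsub>E\<^esub> q X = amap W h \<cdot>\<^bsub>E\<^esub> u X \<cdot>\<^bsub>E\<^esub> q X"
      by (simp add: comp_assoc[OF q'[OF X] N.amap_in_hom[OF h] u[OF Y]] op_map_natural[OF q h, symmetric]
          comp_assoc[OF P.amap_in_hom[OF h] q'[OF Y] u[OF Y], symmetric] op_map_natural[OF uq h]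
          comp_assoc[OF q'[OF X] u[OF X] W.amap_in_hom[OF h]])
    then show ?thesis
      by (rule epi_cancel[OF epi[OF X] _ comp_in_hom[OF N.amap_in_hom[OF h] u[OF Y]]
            comp_in_hom[OF u[OF X] W.amap_in_hom[OF h]]])
  qed
  show "u (tgt j) \<cdot>\<^bsub>E\<^esub> n j = w j \<cdot>\<^bsub>E\<^esub> amap (T j) (u (src j))" if j: "j \<in> J" for j
  proof -
    interpret T: linear_functor R E E "T j" by (rule T_linear[OF j])
    note s = src_obj[OF j] and t = tgt_obj[OF j]
    note w = has_operations_in_hom[OF W j] and n = has_operations_in_hom[OF N j]
      and p = has_operations_in_hom[OF P j]
    have "u (tgt j) \<cdot>\<^bsub>E\<^esub> n j \<cdot>\<^bsub>E\<^esub> amap (T j) (q (src j)) = w j \<cdot>\<^bsub>E\<^esub> amap (T j) (u (src j)) \<cdot>\<^bsub>E\<^esub> amap (T j) (q (src j))"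
      by (simp add: comp_assoc[OF T.amap_in_hom[OF q'[OF s]] n u[OF t]] op_map_op[OF q j, symmetric]
          comp_assoc[OF p q'[OF t] u[OF t], symmetric] op_map_op[OF uq j]
          T.amap_comp[OF q'[OF s] u[OF s]]
          comp_assoc[OF T.amap_in_hom[OF q'[OF s]] T.amap_in_hom[OF u[OF s]] w])
    moreover have "is_epi E (omap (T j) (omap P (src j))) (omap (T j) (omap N (src j))) (amap (T j) (q (src j)))"
      using T_epi[OF j] epi[OF s] by (simp add: preserves_epis_def)
    ultimately show ?thesis
      using epi_cancel comp_in_hom[OF n u[OF t]] comp_in_hom[OF T.amap_in_hom[OF u[OF s]] w] by blast
  qed
qed

section \<open>Linear combinations of maps\<close>

lemma op_map_zero:
  assumes N: "has_operations N n" and P: "has_operations P p"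
  shows "op_map N n P p (\<lambda>X. \<zero>\<^bsub>Hom E (omap N X) (omap P X)\<^esub>)"
proof -
  interpret N: linear_functor R M E N using N by (rule has_operations_linear)
  interpret P: linear_functor R M E P using P by (rule has_operations_linear)
  note obj = N.omap_obj P.omap_obj
  show ?thesis
  proof (rule op_mapI)
    show "\<zero>\<^bsub>Hom E (omap N Y) (omap P Y)\<^esub> \<cdot>\<^bsub>E\<^esub> amap N h = amap P h \<cdot>\<^bsub>E\<^esub> \<zero>\<^bsub>Hom E (omap N X) (omap P X)\<^esub>"
      if h: "\<guillemotleft>h : X \<rightarrow>\<^bsub>M\<^esub> Y\<guillemotright>" for X Y h
      using base.in_hom_obj[OF h]
      by (simp add: comp_zero_left[OF N.amap_in_hom[OF h]] comp_zero_right[OF P.amap_in_hom[OF h]] obj)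
    show "\<zero>\<^bsub>Hom E (omap N (tgt j)) (omap P (tgt j))\<^esub> \<cdot>\<^bsub>E\<^esub> n j
      = p j \<cdot>\<^bsub>E\<^esub> amap (T j) \<zero>\<^bsub>Hom E (omap N (src j)) (omap P (src j))\<^esub>" if j: "j \<in> J" for j
    proof -
      interpret T: linear_functor R E E "T j" by (rule T_linear[OF j])
      show ?thesis
        by (simp add: T.amap_zero T.omap_obj obj src_obj[OF j] tgt_obj[OF j]
            comp_zero_left[OF has_operations_in_hom[OF N j]] comp_zero_right[OF has_operations_in_hom[OF P j]])
    qed
  qed (simp add: zero_in_hom obj)
qed

lemma op_map_add:
  assumes N: "has_operations N n" and P: "has_operations P p"
    and f: "op_map N n P p f" and g: "op_map N n P p g"
  shows "op_map N n P p (\<lambda>X. f X \<oplus>\<^bsub>Hom E (omap N X) (omap P X)\<^esub> g X)"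
proof -
  interpret N: linear_functor R M E N using N by (rule has_operations_linear)
  interpret P: linear_functor R M E P using P by (rule has_operations_linear)
  note f' = op_map_in_hom[OF f] and g' = op_map_in_hom[OF g]
  show ?thesis
  proof (rule op_mapI)
    show "\<guillemotleft>f X \<oplus>\<^bsub>Hom E (omap N X) (omap P X)\<^esub> g X : omap N X \<rightarrow>\<^bsub>E\<^esub> omap P X\<guillemotright>" if "X \<in> Obj M" for X
      by (rule add_in_hom[OF f'[OF that] g'[OF that]])
    show "(f Y \<oplus>\<^bsub>Hom E (omap N Y) (omap P Y)\<^esub> g Y) \<cdot>\<^bsub>E\<^esub> amap N h
      = amap P h \<cdot>\<^bsub>E\<^esub> (f X \<oplus>\<^bsub>Hom E (omap N X) (omap P X)\<^esub> g X)"
      if h: "\<guillemotleft>h : X \<rightarrow>\<^bsub>M\<^esub> Y\<guillemotright>" for X Y h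
    proof -
      note X = base.in_hom_obj(1)[OF h] and Y = base.in_hom_obj(2)[OF h]
      show ?thesis
        by (simp add: comp_add_left[OF N.amap_in_hom[OF h] f'[OF Y] g'[OF Y]] op_map_natural[OF f h]
            op_map_natural[OF g h] comp_add_right[OF f'[OF X] g'[OF X] P.amap_in_hom[OF h]])
    qed
    show "(f (tgt j) \<oplus>\<^bsub>Hom E (omap N (tgt j)) (omap P (tgt j))\<^esub> g (tgt j)) \<cdot>\<^bsub>E\<^esub> n j
      = p j \<cdot>\<^bsub>E\<^esub> amap (T j) (f (src j) \<oplus>\<^bsub>Hom E (omap N (src j)) (omap P (src j))\<^esub> g (src j))"
      if j: "j \<in> J" for j
    proof -
      interpret T: linear_functor R E E "T j" by (rule T_linear[OF j])
      note s = src_obj[OF j] and t = tgt_obj[OF j]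
      show ?thesis
        by (simp add: comp_add_left[OF has_operations_in_hom[OF N j] f'[OF t] g'[OF t]] op_map_op[OF f j]
            op_map_op[OF g j] T.amap_add[OF f'[OF s] g'[OF s]]
            comp_add_right[OF T.amap_in_hom[OF f'[OF s]] T.amap_in_hom[OF g'[OF s]] has_operations_in_hom[OF P j]])
    qed
  qed
qed

lemma op_map_smult:
  assumes N: "has_operations N n" and P: "has_operations P p"
    and f: "op_map N n P p f" and c: "c \<in> carrier R"
  shows "op_map N n P p (\<lambda>X. c \<odot>\<^bsub>Hom E (omap N X) (omap P X)\<^esub> f X)"
proof -
  interpret N: linear_functor R M E N using N by (rule has_operations_linear)
  interpret P: linear_functor R M E P using P by (rule has_operations_linear)
  note f' = op_map_in_hom[OF f]
  show ?thesis
  proof (rule op_mapI)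
    show "\<guillemotleft>c \<odot>\<^bsub>Hom E (omap N X) (omap P X)\<^esub> f X : omap N X \<rightarrow>\<^bsub>E\<^esub> omap P X\<guillemotright>" if "X \<in> Obj M" for X
      by (rule smult_in_hom[OF c f'[OF that]])
    show "(c \<odot>\<^bsub>Hom E (omap N Y) (omap P Y)\<^esub> f Y) \<cdot>\<^bsub>E\<^esub> amap N h
      = amap P h \<cdot>\<^bsub>E\<^esub> (c \<odot>\<^bsub>Hom E (omap N X) (omap P X)\<^esub> f X)"
      if h: "\<guillemotleft>h : X \<rightarrow>\<^bsub>M\<^esub> Y\<guillemotright>" for X Y h
    proof -
      note X = base.in_hom_obj(1)[OF h] and Y = base.in_hom_obj(2)[OF h]
      show ?thesis
        by (simp add: comp_smult_left[OF c N.amap_in_hom[OF h] f'[OF Y]] op_map_natural[OF f h]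
            comp_smult_right[OF c f'[OF X] P.amap_in_hom[OF h]])
    qed
    show "(c \<odot>\<^bsub>Hom E (omap N (tgt j)) (omap P (tgt j))\<^esub> f (tgt j)) \<cdot>\<^bsub>E\<^esub> n j
      = p j \<cdot>\<^bsub>E\<^esub> amap (T j) (c \<odot>\<^bsub>Hom E (omap N (src j)) (omap P (src j))\<^esub> f (src j))"
      if j: "j \<in> J" for j
    proof -
      interpret T: linear_functor R E E "T j" by (rule T_linear[OF j])
      note s = src_obj[OF j] and t = tgt_obj[OF j]
      show ?thesis
        by (simp add: comp_smult_left[OF c has_operations_in_hom[OF N j] f'[OF t]] op_map_op[OF f j]
            T.amap_smult[OF c f'[OF s]]
            comp_smult_right[OF c T.amap_in_hom[OF f'[OF s]] has_operations_in_hom[OF P j]])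
    qed
  qed
qed

section \<open>Stable laws and derived operations\<close>

text \<open>
  Conditions on operations that pass to the structures obtained from \<open>lift_operations\<close> and
  \<open>descend_operations\<close>.
\<close>

definition stable :: "(('mo, 'ma, 'eo, 'ea) ftor \<Rightarrow> ('j \<Rightarrow> 'ea) \<Rightarrow> bool) \<Rightarrow> bool" where
  "stable eqs \<longleftrightarrow>
    (\<forall>N n K. has_operations N n \<longrightarrow>
      (\<forall>P p k. (P, p, k) \<in> K \<longrightarrow> has_operations P p \<and> eqs P p \<and> op_map N n P p k) \<longrightarrow>
      (\<forall>X \<in> Obj M. jointly_mono E (omap N X) {k X | P p k. (P, p, k) \<in> K}) \<longrightarrow> eqs N n) \<and>
    (\<forall>P p N n q. has_operations P p \<longrightarrow> eqs P p \<longrightarrow> has_operations N n \<longrightarrow> op_map P p N n q \<longrightarrow>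
      (\<forall>X \<in> Obj M. is_epi E (omap P X) (omap N X) (q X)) \<longrightarrow> eqs N n)"

lemma stable_sub:
  assumes "stable eqs" "has_operations N n"
    and "\<And>P p k. (P, p, k) \<in> K \<Longrightarrow> has_operations P p \<and> eqs P p \<and> op_map N n P p k"
    and "\<And>X. X \<in> Obj M \<Longrightarrow> jointly_mono E (omap N X) {k X | P p k. (P, p, k) \<in> K}"
  shows "eqs N n"
  using assms(1)[unfolded stable_def, THEN conjunct1, rule_format, of N n K] assms(2-4) by blast

lemma stable_quotient:
  assumes "stable eqs" "has_operations P p" "eqs P p" "has_operations N n" "op_map P p N n q"
    and "\<And>X. X \<in> Obj M \<Longrightarrow> is_epi E (omap P X) (omap N X) (q X)"
  shows "eqs N n"
  using assms(1)[unfolded stable_def, THEN conjunct2, rule_format, of P p N n q] assms(2-6) by blast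

lemma stableI:
  assumes "\<And>N n K. \<lbrakk>has_operations N n;
      \<And>P p k. (P, p, k) \<in> K \<Longrightarrow> has_operations P p \<and> eqs P p \<and> op_map N n P p k;
      \<And>X. X \<in> Obj M \<Longrightarrow> jointly_mono E (omap N X) {k X | P p k. (P, p, k) \<in> K}\<rbrakk> \<Longrightarrow> eqs N n"
    and "\<And>P p N n q. \<lbrakk>has_operations P p; eqs P p; has_operations N n; op_map P p N n q;
      \<And>X. X \<in> Obj M \<Longrightarrow> is_epi E (omap P X) (omap N X) (q X)\<rbrakk> \<Longrightarrow> eqs N n"
  shows "stable eqs"
  using assms unfolding stable_def by (intro conjI allI impI) (meson, meson)

text \<open>Module laws are conjunctions of equations, quantified over objects and arrows and
  guarded by their types. With \<open>stable_all\<close> and \<open>stable_imp\<close>, stability is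
  reduced to single equations with fixed parameters.\<close>

lemma stable_conj:
  assumes a: "stable a" and b: "stable b"
  shows "stable (\<lambda>N n. a N n \<and> b N n)"
proof (rule stableI)
  show "a N n \<and> b N n" if "has_operations N n"
      "\<And>P p k. (P, p, k) \<in> K \<Longrightarrow> has_operations P p \<and> (a P p \<and> b P p) \<and> op_map N n P p k"
      "\<And>X. X \<in> Obj M \<Longrightarrow> jointly_mono E (omap N X) {k X | P p k. (P, p, k) \<in> K}" for N n K
    using stable_sub[OF a that(1) _ that(3)] stable_sub[OF b that(1) _ that(3)] that(2) by simp
  show "a N n \<and> b N n" if "has_operations P p" "a P p \<and> b P p" "has_operations N n" "op_map P p N n q"
      "\<And>X. X \<in> Obj M \<Longrightarrow> is_epi E (omap P X) (omap N X) (q X)" for P p N n q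
    using stable_quotient[OF a that(1) _ that(3-5)] stable_quotient[OF b that(1) _ that(3-5)] that(2) by simp
qed

lemma stable_all:
  assumes a: "\<And>x. stable (a x)"
  shows "stable (\<lambda>N n. \<forall>x. a x N n)"
proof (rule stableI; rule allI)
  show "a x N n" if "has_operations N n"
      "\<And>P p k. (P, p, k) \<in> K \<Longrightarrow> has_operations P p \<and> (\<forall>x. a x P p) \<and> op_map N n P p k"
      "\<And>X. X \<in> Obj M \<Longrightarrow> jointly_mono E (omap N X) {k X | P p k. (P, p, k) \<in> K}" for N n K x
    using stable_sub[OF a that(1) _ that(3)] that(2) by simp
  show "a x N n" if "has_operations P p" "\<forall>x. a x P p" "has_operations N n" "op_map P p N n q"
      "\<And>X. X \<in> Obj M \<Longrightarrow> is_epi E (omap P X) (omap N X) (q X)" for P p N n q x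
    using stable_quotient[OF a that(1) _ that(3-5)] that(2) by simp
qed

lemma stable_imp:
  assumes a: "Q \<Longrightarrow> stable a"
  shows "stable (\<lambda>N n. Q \<longrightarrow> a N n)"
proof (rule stableI; rule impI)
  show "a N n" if "has_operations N n"
      "\<And>P p k. (P, p, k) \<in> K \<Longrightarrow> has_operations P p \<and> (Q \<longrightarrow> a P p) \<and> op_map N n P p k"
      "\<And>X. X \<in> Obj M \<Longrightarrow> jointly_mono E (omap N X) {k X | P p k. (P, p, k) \<in> K}" Q for N n K
    using stable_sub[OF a that(1) _ that(3)] that(2,4) by simp
  show "a N n" if "has_operations P p" "Q \<longrightarrow> a P p" "has_operations N n" "op_map P p N n q"
      "\<And>X. X \<in> Obj M \<Longrightarrow> is_epi E (omap P X) (omap N X) (q X)" Q for P p N n q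
    using stable_quotient[OF a that(1) _ that(3-5)] that(2,6) by simp
qed

text \<open>A natural transformation on the category of all structures and their maps, from
  evaluation at \<open>X\<close> followed by \<open>S\<close> to evaluation at \<open>Y\<close>. It
  is a semantic substitute for terms: both sides of a module law, as functions of the structure, are
  of this form.\<close>

definition derived_op ::
  "('eo, 'ea, 'eo, 'ea) ftor \<Rightarrow> 'mo \<Rightarrow> 'mo \<Rightarrow> (('mo, 'ma, 'eo, 'ea) ftor \<Rightarrow> ('j \<Rightarrow> 'ea) \<Rightarrow> 'ea) \<Rightarrow> bool" where
  "derived_op S X Y l \<longleftrightarrow> linear_functor R E E S \<and> X \<in> Obj M \<and> Y \<in> Obj M \<and>
    (\<forall>N n. has_operations N n \<longrightarrow> \<guillemotleft>l N n : omap S (omap N X) \<rightarrow>\<^bsub>E\<^esub> omap N Y\<guillemotright>) \<and>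
    (\<forall>N n P p f. has_operations N n \<longrightarrow> has_operations P p \<longrightarrow> op_map N n P p f \<longrightarrow>
      f Y \<cdot>\<^bsub>E\<^esub> l N n = l P p \<cdot>\<^bsub>E\<^esub> amap S (f X))"

lemma derived_op_in_hom:
  "\<lbrakk>derived_op S X Y l; has_operations N n\<rbrakk> \<Longrightarrow> \<guillemotleft>l N n : omap S (omap N X) \<rightarrow>\<^bsub>E\<^esub> omap N Y\<guillemotright>"
  by (simp add: derived_op_def)

lemma derived_op_natural:
  "\<lbrakk>derived_op S X Y l; has_operations N n; has_operations P p; op_map N n P p f\<rbrakk>
    \<Longrightarrow> f Y \<cdot>\<^bsub>E\<^esub> l N n = l P p \<cdot>\<^bsub>E\<^esub> amap S (f X)"
  unfolding derived_op_def by blast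

lemma derived_op_cong:
  assumes "derived_op S X Y l" "\<And>N n. has_operations N n \<Longrightarrow> l N n = l' N n"
  shows "derived_op S X Y l'"
  using assms unfolding derived_op_def by metis

text \<open>Naturality carries the equation along maps of structures. For a map \<open>k\<close> to
  a structure that satisfies it, both sides composed with \<open>k Y\<close> become equal; for a map
  \<open>q\<close> from such a structure, both sides precomposed with the image of
  \<open>q X\<close> under \<open>S\<close> become equal. The latter image is epi by the assumption
  on \<open>S\<close>.\<close>

lemma stable_eq:
  assumes l: "derived_op S X Y l" and r: "derived_op S X Y r" and S: "preserves_epis E E S"
  shows "stable (\<lambda>N n. l N n = r N n)"
  unfolding stable_def
proof (intro conjI allI impI)
  have obj: "X \<in> Obj M" "Y \<in> Obj M" using l by (auto simp: derived_op_def)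
  fix N n
  assume N: "has_operations N n"
  {
    fix K
    assume K: "\<forall>P p k. (P, p, k) \<in> K \<longrightarrow> has_operations P p \<and> l P p = r P p \<and> op_map N n P p k"
      and mono: "\<forall>X\<in>Obj M. jointly_mono E (omap N X) {k X | P p k. (P, p, k) \<in> K}"
    have "k Y \<cdot>\<^bsub>E\<^esub> l N n = k Y \<cdot>\<^bsub>E\<^esub> r N n" if "(P, p, k) \<in> K" for P p k
      using K that derived_op_natural[OF l N] derived_op_natural[OF r N] by metis
    then show "l N n = r N n"
      by (intro jointly_monoD[OF bspec[OF mono obj(2)] _ derived_op_in_hom[OF l N] derived_op_in_hom[OF r N]])
        auto
  }
  fix P p q
  assume P: "has_operations P p" and eq: "l P p = r P p" and q: "op_map P p N n q"
    and epi: "\<forall>X\<in>Obj M. is_epi E (omap P X) (omap N X) (q X)"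
  have "l N n \<cdot>\<^bsub>E\<^esub> amap S (q X) = r N n \<cdot>\<^bsub>E\<^esub> amap S (q X)"
    using derived_op_natural[OF l P N q] derived_op_natural[OF r P N q] eq by simp
  moreover have "is_epi E (omap S (omap P X)) (omap S (omap N X)) (amap S (q X))"
    using S epi obj by (simp add: preserves_epis_def)
  ultimately show "l N n = r N n"
    using epi_cancel derived_op_in_hom[OF l N] derived_op_in_hom[OF r N] by blast
qed

text \<open>Covers the right-hand sides of the unit laws, where a unitor of \<open>E\<close> stands
  alone and no operation occurs.\<close>

lemma derived_op_transformation:
  assumes S: "linear_functor R E E S" and X: "X \<in> Obj M"
    and t: "\<And>Z. Z \<in> Obj E \<Longrightarrow> \<guillemotleft>t Z : omap S Z \<rightarrow>\<^bsub>E\<^esub> Z\<guillemotright>"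
    and nat: "\<And>Y Z g. \<guillemotleft>g : Y \<rightarrow>\<^bsub>E\<^esub> Z\<guillemotright> \<Longrightarrow> t Z \<cdot>\<^bsub>E\<^esub> amap S g = g \<cdot>\<^bsub>E\<^esub> t Y"
  shows "derived_op S X X (\<lambda>N n. t (omap N X))"
  unfolding derived_op_def
proof (intro conjI allI impI S X)
  show "\<guillemotleft>t (omap N X) : omap S (omap N X) \<rightarrow>\<^bsub>E\<^esub> omap N X\<guillemotright>" if "has_operations N n" for N n
    using t linear_functor.omap_obj[OF has_operations_linear[OF that] X] by simp
  show "f X \<cdot>\<^bsub>E\<^esub> t (omap N X) = t (omap P X) \<cdot>\<^bsub>E\<^esub> amap S (f X)" if "op_map N n P p f" for N n P p f
    using nat[OF op_map_in_hom[OF that X]] by simp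
qed

lemma derived_op_basic:
  assumes j: "j \<in> J"
  shows "derived_op (T j) (src j) (tgt j) (\<lambda>N n. n j)"
  using T_linear[OF j] src_obj[OF j] tgt_obj[OF j] has_operations_in_hom[OF _ j] op_map_op[OF _ j]
  by (simp add: derived_op_def)

text \<open>Needed for naturality of a multiplication in the module variable. The arrow
  \<open>amap N h\<close> depends on the structure, so it is not a component of a fixed
  transformation of endofunctors of \<open>E\<close> and \<open>derived_op_pre\<close> does not
  apply to it.\<close>

lemma derived_op_basic_arrow:
  assumes j: "j \<in> J" and h: "\<guillemotleft>h : X \<rightarrow>\<^bsub>M\<^esub> src j\<guillemotright>"
  shows "derived_op (T j) X (tgt j) (\<lambda>N n. n j \<cdot>\<^bsub>E\<^esub> amap (T j) (amap N h))"
  unfolding derived_op_def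
proof (intro conjI allI impI)
  interpret T: linear_functor R E E "T j" by (rule T_linear[OF j])
  show "linear_functor R E E (T j)" "tgt j \<in> Obj M" by (fact T_linear[OF j] tgt_obj[OF j])+
  show X: "X \<in> Obj M" using h by (simp add: in_hom_def)
  note hom = linear_functor.amap_in_hom[OF has_operations_linear h]
  fix N n assume N: "has_operations N n"
  note n = has_operations_in_hom[OF N j]
  show "\<guillemotleft>n j \<cdot>\<^bsub>E\<^esub> amap (T j) (amap N h) : omap (T j) (omap N X) \<rightarrow>\<^bsub>E\<^esub> omap N (tgt j)\<guillemotright>"
    by (rule comp_in_hom[OF T.amap_in_hom[OF hom[OF N]] n])
  fix P p f assume P: "has_operations P p" and f: "op_map N n P p f"
  note f' = op_map_in_hom[OF f] and p = has_operations_in_hom[OF P j]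
  note s = src_obj[OF j] and t = tgt_obj[OF j]
  show "f (tgt j) \<cdot>\<^bsub>E\<^esub> (n j \<cdot>\<^bsub>E\<^esub> amap (T j) (amap N h)) = p j \<cdot>\<^bsub>E\<^esub> amap (T j) (amap P h) \<cdot>\<^bsub>E\<^esub> amap (T j) (f X)"
    by (simp add: comp_assoc[OF T.amap_in_hom[OF hom[OF N]] n f'[OF t], symmetric] op_map_op[OF f j]
        comp_assoc[OF T.amap_in_hom[OF hom[OF N]] T.amap_in_hom[OF f'[OF s]] p]
        comp_assoc[OF T.amap_in_hom[OF f'[OF X]] T.amap_in_hom[OF hom[OF P]] p]
        T.amap_comp[OF hom[OF N] f'[OF s], symmetric] op_map_natural[OF f h]
        T.amap_comp[OF f'[OF X] hom[OF P], symmetric])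
qed

text \<open>Covers the arrows of \<open>M\<close> that appear in the laws under \<open>N\<close>:
  structure isomorphisms such as \<open>lassoc\<close>, and arrows obtained from the action in the
  naturality law.\<close>

lemma derived_op_post:
  assumes l: "derived_op S X Y l" and g: "\<guillemotleft>g : Y \<rightarrow>\<^bsub>M\<^esub> Z\<guillemotright>"
  shows "derived_op S X Z (\<lambda>N n. amap N g \<cdot>\<^bsub>E\<^esub> l N n)"
  unfolding derived_op_def
proof (intro conjI allI impI)
  show S: "linear_functor R E E S" and X: "X \<in> Obj M" using l by (auto simp: derived_op_def)
  interpret S: linear_functor R E E S by fact
  have Y: "Y \<in> Obj M" using g by (simp add: in_hom_def)
  show Z: "Z \<in> Obj M" using g by (simp add: in_hom_def)
  note hom = linear_functor.amap_in_hom[OF has_operations_linear g]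
  fix N n assume N: "has_operations N n"
  note n = derived_op_in_hom[OF l N]
  show "\<guillemotleft>amap N g \<cdot>\<^bsub>E\<^esub> l N n : omap S (omap N X) \<rightarrow>\<^bsub>E\<^esub> omap N Z\<guillemotright>"
    by (rule comp_in_hom[OF n hom[OF N]])
  fix P p f assume P: "has_operations P p" and f: "op_map N n P p f"
  note f' = op_map_in_hom[OF f] and p = derived_op_in_hom[OF l P]
  show "f Z \<cdot>\<^bsub>E\<^esub> (amap N g \<cdot>\<^bsub>E\<^esub> l N n) = amap P g \<cdot>\<^bsub>E\<^esub> l P p \<cdot>\<^bsub>E\<^esub> amap S (f X)"
    by (simp add: comp_assoc[OF n hom[OF N] f'[OF Z], symmetric] op_map_natural[OF f g]
        comp_assoc[OF n f'[OF Y] hom[OF P]] derived_op_natural[OF l N P f]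
        comp_assoc[OF S.amap_in_hom[OF f'[OF X]] p hom[OF P]])
qed

text \<open>Iterated multiplication: the inner result is fed into the operation \<open>j\<close>, so
  \<open>T j\<close> is applied to the inner derived operation and its source becomes a composite
  functor.\<close>

lemma derived_op_comp:
  assumes l: "derived_op S X (src j) l" and j: "j \<in> J"
  shows "derived_op (comp_ftor (T j) S) X (tgt j) (\<lambda>N n. n j \<cdot>\<^bsub>E\<^esub> amap (T j) (l N n))"
  unfolding derived_op_def
proof (intro conjI allI impI)
  have S: "linear_functor R E E S" using l by (auto simp: derived_op_def)
  interpret S: linear_functor R E E S by fact
  interpret T: linear_functor R E E "T j" by (rule T_linear[OF j])
  show X: "X \<in> Obj M" using l by (auto simp: derived_op_def)
  show "linear_functor R E E (comp_ftor (T j) S)" by (rule linear_functor_comp[OF S T_linear[OF j]])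
  show t: "tgt j \<in> Obj M" by (rule tgt_obj[OF j])
  fix N n assume N: "has_operations N n"
  note n = has_operations_in_hom[OF N j] and nl = derived_op_in_hom[OF l N]
  show "\<guillemotleft>n j \<cdot>\<^bsub>E\<^esub> amap (T j) (l N n) : omap (comp_ftor (T j) S) (omap N X) \<rightarrow>\<^bsub>E\<^esub> omap N (tgt j)\<guillemotright>"
    using comp_in_hom[OF T.amap_in_hom[OF nl] n] by simp
  fix P p f assume P: "has_operations P p" and f: "op_map N n P p f"
  note f' = op_map_in_hom[OF f] and p = has_operations_in_hom[OF P j] and pl = derived_op_in_hom[OF l P]
  note s = src_obj[OF j]
  show "f (tgt j) \<cdot>\<^bsub>E\<^esub> (n j \<cdot>\<^bsub>E\<^esub> amap (T j) (l N n))
    = p j \<cdot>\<^bsub>E\<^esub> amap (T j) (l P p) \<cdot>\<^bsub>E\<^esub> amap (comp_ftor (T j) S) (f X)"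
    by (simp add: comp_assoc[OF T.amap_in_hom[OF nl] n f'[OF t], symmetric] op_map_op[OF f j]
        comp_assoc[OF T.amap_in_hom[OF nl] T.amap_in_hom[OF f'[OF s]] p]
        comp_assoc[OF T.amap_in_hom[OF S.amap_in_hom[OF f'[OF X]]] T.amap_in_hom[OF pl] p]
        T.amap_comp[OF nl f'[OF s], symmetric] derived_op_natural[OF l N P f]
        T.amap_comp[OF S.amap_in_hom[OF f'[OF X]] pl, symmetric])
qed

text \<open>The same family as from \<open>derived_op_comp\<close> and
  \<open>derived_op_post\<close>, bracketed to the left as in the laws for right modules and
  bimodules.\<close>

lemma derived_op_post_comp:
  assumes l: "derived_op S X (src j) l" and j: "j \<in> J" and g: "\<guillemotleft>g : tgt j \<rightarrow>\<^bsub>M\<^esub> Z\<guillemotright>"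
  shows "derived_op (comp_ftor (T j) S) X Z (\<lambda>N n. amap N g \<cdot>\<^bsub>E\<^esub> n j \<cdot>\<^bsub>E\<^esub> amap (T j) (l N n))"
proof (rule derived_op_cong[OF derived_op_post[OF derived_op_comp[OF l j] g]])
  interpret T: linear_functor R E E "T j" by (rule T_linear[OF j])
  fix N n assume N: "has_operations N n"
  show "amap N g \<cdot>\<^bsub>E\<^esub> (n j \<cdot>\<^bsub>E\<^esub> amap (T j) (l N n)) = amap N g \<cdot>\<^bsub>E\<^esub> n j \<cdot>\<^bsub>E\<^esub> amap (T j) (l N n)"
    using comp_assoc[OF T.amap_in_hom[OF derived_op_in_hom[OF l N]] has_operations_in_hom[OF N j]
        linear_functor.amap_in_hom[OF has_operations_linear[OF N] g]] by simp
qed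

text \<open>Accounts for the associators of \<open>E\<close> and for the maps induced by
  \<open>lax_mult\<close>, \<open>lax_unit\<close> and \<open>amap F f\<close>, all of which are
  natural in the slot occupied by the module.\<close>

lemma derived_op_pre:
  assumes l: "derived_op S X Y l" and S': "linear_functor R E E S'" and t: "natural E E S' S t"
  shows "derived_op S' X Y (\<lambda>N n. l N n \<cdot>\<^bsub>E\<^esub> t (omap N X))"
  unfolding derived_op_def
proof (intro conjI allI impI S')
  have S: "linear_functor R E E S" using l by (auto simp: derived_op_def)
  interpret S: linear_functor R E E S by fact
  interpret S': linear_functor R E E S' by fact
  show X: "X \<in> Obj M" and Y: "Y \<in> Obj M" using l by (auto simp: derived_op_def)
  have t': "\<guillemotleft>t (omap N X) : omap S' (omap N X) \<rightarrow>\<^bsub>E\<^esub> omap S (omap N X)\<guillemotright>" if "has_operations N n" for N n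
    using t linear_functor.omap_obj[OF has_operations_linear[OF that] X] by (simp add: natural_def)
  fix N n assume N: "has_operations N n"
  note n = derived_op_in_hom[OF l N]
  show "\<guillemotleft>l N n \<cdot>\<^bsub>E\<^esub> t (omap N X) : omap S' (omap N X) \<rightarrow>\<^bsub>E\<^esub> omap N Y\<guillemotright>"
    by (rule comp_in_hom[OF t'[OF N] n])
  fix P p f assume P: "has_operations P p" and f: "op_map N n P p f"
  note f' = op_map_in_hom[OF f] and p = derived_op_in_hom[OF l P]
  have "t (omap P X) \<cdot>\<^bsub>E\<^esub> amap S' (f X) = amap S (f X) \<cdot>\<^bsub>E\<^esub> t (omap N X)"
    using t f'[OF X] by (simp add: natural_def)
  then show "f Y \<cdot>\<^bsub>E\<^esub> (l N n \<cdot>\<^bsub>E\<^esub> t (omap N X)) = l P p \<cdot>\<^bsub>E\<^esub> t (omap P X) \<cdot>\<^bsub>E\<^esub> amap S' (f X)"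
    by (simp add: comp_assoc[OF t'[OF N] n f'[OF Y], symmetric] derived_op_natural[OF l N P f]
        comp_assoc[OF t'[OF N] S.amap_in_hom[OF f'[OF X]] p]
        comp_assoc[OF S'.amap_in_hom[OF f'[OF X]] t'[OF P] p])
qed

end

section \<open>The category of algebras\<close>

text \<open>
  In the definitions of the module categories the operations are not given by one family over \<open>J\<close>,
  but by structures \<open>s\<close> such as pairs of curried functions, which \<open>dec\<close> turns into such a family.
\<close>

locale functor_algebras = functor_operations R M E J src tgt T
  for R :: "('r, 'm) ring_scheme" (structure)
    and M :: "('r, 'mo, 'ma, 'z1) lincat_scheme"
    and E :: "('r, 'eo, 'ea, 'z2) lincat_scheme"
    and J :: "'j set" and src tgt and T :: "'j \<Rightarrow> ('eo, 'ea, 'eo, 'ea) ftor" +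
  fixes eqs :: "('mo, 'ma, 'eo, 'ea) ftor \<Rightarrow> ('j \<Rightarrow> 'ea) \<Rightarrow> bool"
    and dec :: "'s \<Rightarrow> 'j \<Rightarrow> 'ea" and ext :: "'s set"
  assumes eqs_stable: "stable eqs"
    and dec_surj: "\<exists>s \<in> ext. \<forall>j \<in> J. dec s j = n j"
begin

definition algs :: "(('mo, 'ma, 'eo, 'ea) ftor \<times> 's) set" where
  "algs = {(N, s). has_operations N (dec s) \<and> eqs N (dec s) \<and> ftor_extensional M N \<and> s \<in> ext}"

text \<open>The condition on arrows mentions the operations only, because
  \<open>structured_functors\<close> itself adds naturality; \<open>mor\<close> unites the two in
  \<open>op_map\<close>.\<close>

abbreviation "A \<equiv> structured_functors M E algs
  (\<lambda>s s' f. \<forall>j \<in> J. f (tgt j) \<cdot>\<^bsub>E\<^esub> dec s j = dec s' j \<cdot>\<^bsub>E\<^esub> amap (T j) (f (src j)))"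

text \<open>The components of an arrow of \<open>A\<close>, freed of the triple. Membership of both
  ends and extensionality are included so that \<open>in_hom_A\<close> is an equivalence without
  side conditions.\<close>

definition mor where
  "mor P Q f \<longleftrightarrow> P \<in> algs \<and> Q \<in> algs \<and> f \<in> extensional (Obj M) \<and>
    op_map (fst P) (dec (snd P)) (fst Q) (dec (snd Q)) f"

lemma algs_operations: "P \<in> algs \<Longrightarrow> has_operations (fst P) (dec (snd P))"
  by (auto simp: algs_def)

lemma algs_eqs: "P \<in> algs \<Longrightarrow> eqs (fst P) (dec (snd P))"
  by (auto simp: algs_def)

lemma algs_linear: "P \<in> algs \<Longrightarrow> linear_functor R M E (fst P)"
  by (rule has_operations_linear[OF algs_operations])

lemma algs_obj: "\<lbrakk>P \<in> algs; X \<in> Obj M\<rbrakk> \<Longrightarrow> omap (fst P) X \<in> Obj E"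
  by (rule linear_functor.omap_obj[OF algs_linear])

lemma Obj_A: "Obj A = algs"
  by (simp add: structured_functors_def)

lemma in_hom_A: "\<guillemotleft>a : P \<rightarrow>\<^bsub>A\<^esub> Q\<guillemotright> \<longleftrightarrow> (\<exists>f. a = (P, Q, f) \<and> mor P Q f)"
  by (auto simp: structured_functors_def in_hom_def mor_def op_map_def)

lemma in_hom_A_triple: "\<guillemotleft>(P, Q, f) : P' \<rightarrow>\<^bsub>A\<^esub> Q'\<guillemotright> \<longleftrightarrow> P = P' \<and> Q = Q' \<and> mor P Q f"
  by (auto simp: in_hom_A)

lemma Id_A: "Id A P = (P, P, \<lambda>X\<in>Obj M. Id E (omap (fst P) X))"
  by (simp add: structured_functors_def)

lemma Comp_A: "(Q', V, g) \<cdot>\<^bsub>A\<^esub> (P, Q, f) = (P, V, \<lambda>X\<in>Obj M. g X \<cdot>\<^bsub>E\<^esub> f X)"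
  by (simp add: structured_functors_def)

lemma zero_A: "\<zero>\<^bsub>Hom A P Q\<^esub> = (P, Q, \<lambda>X\<in>Obj M. \<zero>\<^bsub>Hom E (omap (fst P) X) (omap (fst Q) X)\<^esub>)"
  by (simp add: structured_functors_def)

lemma add_A: "(P', Q', f) \<oplus>\<^bsub>Hom A P Q\<^esub> (P'', Q'', g) =
    (P, Q, \<lambda>X\<in>Obj M. f X \<oplus>\<^bsub>Hom E (omap (fst P) X) (omap (fst Q) X)\<^esub> g X)"
  by (simp add: structured_functors_def)

lemma smult_A: "c \<odot>\<^bsub>Hom A P Q\<^esub> (P', Q', f) =
    (P, Q, \<lambda>X\<in>Obj M. c \<odot>\<^bsub>Hom E (omap (fst P) X) (omap (fst Q) X)\<^esub> f X)"
  by (simp add: structured_functors_def)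

lemmas A_simps = in_hom_A_triple Id_A Comp_A zero_A add_A smult_A

lemma mor_in_hom: "\<lbrakk>mor P Q f; X \<in> Obj M\<rbrakk> \<Longrightarrow> \<guillemotleft>f X : omap (fst P) X \<rightarrow>\<^bsub>E\<^esub> omap (fst Q) X\<guillemotright>"
  using op_map_in_hom by (auto simp: mor_def)

lemma mor_natural:
  "\<lbrakk>mor P Q f; \<guillemotleft>h : X \<rightarrow>\<^bsub>M\<^esub> Y\<guillemotright>\<rbrakk> \<Longrightarrow> f Y \<cdot>\<^bsub>E\<^esub> amap (fst P) h = amap (fst Q) h \<cdot>\<^bsub>E\<^esub> f X"
  using op_map_natural by (auto simp: mor_def)

lemma mor_op:
  "\<lbrakk>mor P Q f; j \<in> J\<rbrakk> \<Longrightarrow> f (tgt j) \<cdot>\<^bsub>E\<^esub> dec (snd P) j = dec (snd Q) j \<cdot>\<^bsub>E\<^esub> amap (T j) (f (src j))"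
  using op_map_op by (auto simp: mor_def)

lemma mor_algs: "mor P Q f \<Longrightarrow> P \<in> algs" "mor P Q f \<Longrightarrow> Q \<in> algs"
  by (simp_all add: mor_def)

lemma mor_ext: "\<lbrakk>mor P Q f; mor P' Q' g; \<And>X. X \<in> Obj M \<Longrightarrow> f X = g X\<rbrakk> \<Longrightarrow> f = g"
  unfolding mor_def by (metis extensionalityI)

lemma mor_restrict:
  "\<lbrakk>P \<in> algs; Q \<in> algs; op_map (fst P) (dec (snd P)) (fst Q) (dec (snd Q)) f\<rbrakk> \<Longrightarrow> mor P Q (restrict f (Obj M))"
  using op_map_cong[of _ _ _ _ f "restrict f (Obj M)"] by (simp add: mor_def)

lemma mor_id: "P \<in> algs \<Longrightarrow> mor P P (\<lambda>X\<in>Obj M. Id E (omap (fst P) X))"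
  by (rule mor_restrict[OF _ _ op_map_id[OF algs_operations]])

lemma mor_comp: "\<lbrakk>mor P Q f; mor Q V g\<rbrakk> \<Longrightarrow> mor P V (\<lambda>X\<in>Obj M. g X \<cdot>\<^bsub>E\<^esub> f X)"
  by (rule mor_restrict) (auto simp: mor_def intro: op_map_comp[of _ _ "fst Q" "dec (snd Q)"] algs_operations)

lemma mor_zero:
  "\<lbrakk>P \<in> algs; Q \<in> algs\<rbrakk> \<Longrightarrow> mor P Q (\<lambda>X\<in>Obj M. \<zero>\<^bsub>Hom E (omap (fst P) X) (omap (fst Q) X)\<^esub>)"
  by (rule mor_restrict) (auto intro: op_map_zero algs_operations)

lemma mor_add:
  "\<lbrakk>mor P Q f; mor P Q g\<rbrakk> \<Longrightarrow> mor P Q (\<lambda>X\<in>Obj M. f X \<oplus>\<^bsub>Hom E (omap (fst P) X) (omap (fst Q) X)\<^esub> g X)"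
  by (rule mor_restrict) (auto simp: mor_def intro: op_map_add algs_operations)

lemma mor_smult:
  "\<lbrakk>c \<in> carrier R; mor P Q f\<rbrakk> \<Longrightarrow> mor P Q (\<lambda>X\<in>Obj M. c \<odot>\<^bsub>Hom E (omap (fst P) X) (omap (fst Q) X)\<^esub> f X)"
  by (rule mor_restrict) (auto simp: mor_def intro: op_map_smult algs_operations)

lemma carrier_Hom_A: "\<lbrakk>P \<in> algs; Q \<in> algs\<rbrakk> \<Longrightarrow> a \<in> carrier (Hom A P Q) \<longleftrightarrow> (\<exists>f. a = (P, Q, f) \<and> mor P Q f)"
  using in_hom_A[of a P Q] by (simp add: in_hom_def Obj_A)

section \<open>The linear structure of the category of algebras\<close>

lemma module_Hom_A:
  assumes P: "P \<in> algs" and Q: "Q \<in> algs"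
  shows "module R (Hom A P Q)"
proof -
  let ?H = "\<lambda>X. Hom E (omap (fst P) X) (omap (fst Q) X)"
  have mod: "module R (?H X)" if "X \<in> Obj M" for X
    using hom_module[OF algs_obj[OF P that] algs_obj[OF Q that]] .
  then have grp: "abelian_group (?H X)" if "X \<in> Obj M" for X using that by (simp add: module_def)
  then have mon: "abelian_monoid (?H X)" if "X \<in> Obj M" for X using that by (simp add: abelian_group_def)
  have car: "f X \<in> carrier (?H X)" if "mor P Q f" "X \<in> Obj M" for f X
    using mor_in_hom[OF that] by (simp add: in_hom_def)
  \<comment> \<open>The unit laws compare a restricted family with \<open>f\<close> itself, so the
    values outside \<open>Obj M\<close> have to agree as well.\<close>
  have undef: "f X = undefined" if "mor P Q f" "X \<notin> Obj M" for f X
    using that by (simp add: mor_def extensional_def)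
  note H = carrier_Hom_A[OF P Q]
  show ?thesis
  proof (rule moduleI)
    show "abelian_group (Hom A P Q)"
    proof (rule abelian_groupI)
      fix a b assume "a \<in> carrier (Hom A P Q)" "b \<in> carrier (Hom A P Q)"
      then obtain f g where fg: "a = (P, Q, f)" "mor P Q f" "b = (P, Q, g)" "mor P Q g" by (auto simp: H)
      show "a \<oplus>\<^bsub>Hom A P Q\<^esub> b \<in> carrier (Hom A P Q)" using mor_add fg by (simp add: H add_A)
      show "a \<oplus>\<^bsub>Hom A P Q\<^esub> b = b \<oplus>\<^bsub>Hom A P Q\<^esub> a"
        using fg car by (auto simp: add_A intro!: restrict_ext abelian_monoid.a_comm mon)
      show "\<zero>\<^bsub>Hom A P Q\<^esub> \<oplus>\<^bsub>Hom A P Q\<^esub> a = a"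
        using fg car by (auto simp: undef add_A zero_A restrict_def intro!: ext abelian_monoid.l_zero mon)
      show "a \<oplus>\<^bsub>Hom A P Q\<^esub> b \<oplus>\<^bsub>Hom A P Q\<^esub> c = a \<oplus>\<^bsub>Hom A P Q\<^esub> (b \<oplus>\<^bsub>Hom A P Q\<^esub> c)"
        if "c \<in> carrier (Hom A P Q)" for c
        using that fg car by (auto simp: H add_A intro!: restrict_ext abelian_monoid.a_assoc mon)
      \<comment> \<open>The additive inverse is obtained as the multiple by -1, which is a map of
        algebras by \<open>mor_smult\<close>.\<close>
      have "(\<ominus> \<one>) \<odot>\<^bsub>?H X\<^esub> f X \<oplus>\<^bsub>?H X\<^esub> f X = \<zero>\<^bsub>?H X\<^esub>" if X: "X \<in> Obj M" for X
        using module.smult_l_minus[OF mod[OF X] base.R.one_closed car[OF fg(2) X]]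
          module.smult_one[OF mod[OF X] car[OF fg(2) X]] abelian_group.l_neg[OF grp[OF X] car[OF fg(2) X]] by simp
      then have "((\<ominus> \<one>) \<odot>\<^bsub>Hom A P Q\<^esub> a) \<oplus>\<^bsub>Hom A P Q\<^esub> a = \<zero>\<^bsub>Hom A P Q\<^esub>"
        using fg by (auto simp: add_A smult_A zero_A intro!: restrict_ext)
      moreover have "(\<ominus> \<one>) \<odot>\<^bsub>Hom A P Q\<^esub> a \<in> carrier (Hom A P Q)"
        using mor_smult fg by (simp add: H smult_A)
      ultimately show "\<exists>y \<in> carrier (Hom A P Q). y \<oplus>\<^bsub>Hom A P Q\<^esub> a = \<zero>\<^bsub>Hom A P Q\<^esub>" by blast
    qed (use mor_zero[OF P Q] in \<open>simp add: H zero_A\<close>)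
  next
    fix c d a b assume c: "c \<in> carrier R" and "a \<in> carrier (Hom A P Q)"
    then obtain f where f: "a = (P, Q, f)" "mor P Q f" by (auto simp: H)
    show "c \<odot>\<^bsub>Hom A P Q\<^esub> a \<in> carrier (Hom A P Q)" using mor_smult c f by (simp add: H smult_A)
    show "(c \<oplus> d) \<odot>\<^bsub>Hom A P Q\<^esub> a = c \<odot>\<^bsub>Hom A P Q\<^esub> a \<oplus>\<^bsub>Hom A P Q\<^esub> d \<odot>\<^bsub>Hom A P Q\<^esub> a"
      if "d \<in> carrier R"
      using f c that car by (auto simp: add_A smult_A intro!: restrict_ext module.smult_l_distr[OF mod])
    show "c \<otimes> d \<odot>\<^bsub>Hom A P Q\<^esub> a = c \<odot>\<^bsub>Hom A P Q\<^esub> (d \<odot>\<^bsub>Hom A P Q\<^esub> a)"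
      if "d \<in> carrier R"
      using f c that car by (auto simp: smult_A intro!: restrict_ext module.smult_assoc1[OF mod])
    show "c \<odot>\<^bsub>Hom A P Q\<^esub> (a \<oplus>\<^bsub>Hom A P Q\<^esub> b) = c \<odot>\<^bsub>Hom A P Q\<^esub> a \<oplus>\<^bsub>Hom A P Q\<^esub> c \<odot>\<^bsub>Hom A P Q\<^esub> b"
      if "b \<in> carrier (Hom A P Q)"
      using f c that car by (auto simp: H add_A smult_A intro!: restrict_ext module.smult_r_distr[OF mod])
  next
    fix a assume "a \<in> carrier (Hom A P Q)"
    then obtain f where f: "a = (P, Q, f)" "mor P Q f" by (auto simp: H)
    show "\<one> \<odot>\<^bsub>Hom A P Q\<^esub> a = a"
      using f car by (auto simp: undef smult_A restrict_def intro!: ext module.smult_one[OF mod])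
  qed (rule base.R.cring_axioms)
qed

sublocale A: linear_category R A
proof (intro linear_category.intro linear_category_axioms.intro base.R.cring_axioms)
  show "module R (Hom A X Y)" if "X \<in> Obj A" "Y \<in> Obj A" for X Y
    using that module_Hom_A by (simp add: Obj_A)
  show "X = X' \<and> Y = Y'" if "\<guillemotleft>f : X \<rightarrow>\<^bsub>A\<^esub> Y\<guillemotright>" "\<guillemotleft>f : X' \<rightarrow>\<^bsub>A\<^esub> Y'\<guillemotright>" for f X Y X' Y'
    using that by (auto simp: in_hom_A)
  show "\<guillemotleft>Id A X : X \<rightarrow>\<^bsub>A\<^esub> X\<guillemotright>" if "X \<in> Obj A" for X
    using that mor_id by (simp add: Obj_A A_simps)
next
  fix P Q f assume "\<guillemotleft>f : P \<rightarrow>\<^bsub>A\<^esub> Q\<guillemotright>"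
  then obtain f' where f: "f = (P, Q, f')" "mor P Q f'" by (auto simp: in_hom_A)
  note hom = mor_in_hom[OF f(2)]
  have undef: "f' X = undefined" if "X \<notin> Obj M" for X
    using f(2) that by (simp add: mor_def extensional_def)
  show "Id A Q \<cdot>\<^bsub>A\<^esub> f = f"
    using f hom by (auto simp: undef A_simps restrict_def intro!: ext comp_id_left)
  show "f \<cdot>\<^bsub>A\<^esub> Id A P = f"
    using f hom by (auto simp: undef A_simps restrict_def intro!: ext comp_id_right)
  fix V g assume "\<guillemotleft>g : Q \<rightarrow>\<^bsub>A\<^esub> V\<guillemotright>"
  then obtain g' where g: "g = (Q, V, g')" "mor Q V g'" by (auto simp: in_hom_A)
  show "\<guillemotleft>g \<cdot>\<^bsub>A\<^esub> f : P \<rightarrow>\<^bsub>A\<^esub> V\<guillemotright>" using mor_comp f g by (simp add: A_simps)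
  note hom' = mor_in_hom[OF g(2)]
  show "h \<cdot>\<^bsub>A\<^esub> g \<cdot>\<^bsub>A\<^esub> f = h \<cdot>\<^bsub>A\<^esub> (g \<cdot>\<^bsub>A\<^esub> f)" if "\<guillemotleft>h : V \<rightarrow>\<^bsub>A\<^esub> W\<guillemotright>" for W h
    using that f(1) g(1) by (auto simp: in_hom_A Comp_A intro!: restrict_ext comp_assoc[OF hom hom' mor_in_hom])
  show "(g \<oplus>\<^bsub>Hom A Q V\<^esub> h) \<cdot>\<^bsub>A\<^esub> f = g \<cdot>\<^bsub>A\<^esub> f \<oplus>\<^bsub>Hom A P V\<^esub> h \<cdot>\<^bsub>A\<^esub> f" if "\<guillemotleft>h : Q \<rightarrow>\<^bsub>A\<^esub> V\<guillemotright>" for h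
    using that f(1) g(1)
    by (auto simp: in_hom_A Comp_A add_A intro!: restrict_ext comp_add_left[OF hom hom' mor_in_hom])
  show "(c \<odot>\<^bsub>Hom A Q V\<^esub> g) \<cdot>\<^bsub>A\<^esub> f = c \<odot>\<^bsub>Hom A P V\<^esub> (g \<cdot>\<^bsub>A\<^esub> f)" if "c \<in> carrier R" for c
    using that f(1) g(1) by (auto simp: Comp_A smult_A intro!: restrict_ext comp_smult_left[OF _ hom hom'])
  show "g \<cdot>\<^bsub>A\<^esub> (c \<odot>\<^bsub>Hom A P Q\<^esub> f) = c \<odot>\<^bsub>Hom A P V\<^esub> (g \<cdot>\<^bsub>A\<^esub> f)" if "c \<in> carrier R" for c
    using that f(1) g(1) by (auto simp: Comp_A smult_A intro!: restrict_ext comp_smult_right[OF _ hom hom'])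
next
  fix P Q V f f' g assume "\<guillemotleft>f : P \<rightarrow>\<^bsub>A\<^esub> Q\<guillemotright>" "\<guillemotleft>f' : P \<rightarrow>\<^bsub>A\<^esub> Q\<guillemotright>" "\<guillemotleft>g : Q \<rightarrow>\<^bsub>A\<^esub> V\<guillemotright>"
  then show "g \<cdot>\<^bsub>A\<^esub> (f \<oplus>\<^bsub>Hom A P Q\<^esub> f') = g \<cdot>\<^bsub>A\<^esub> f \<oplus>\<^bsub>Hom A P V\<^esub> g \<cdot>\<^bsub>A\<^esub> f'"
    by (auto simp: in_hom_A Comp_A add_A
        intro!: restrict_ext comp_add_right[OF mor_in_hom mor_in_hom mor_in_hom])
qed

text \<open>The code \<open>s\<close> reproduces \<open>n\<close> on \<open>J\<close> only, whereas
  the predicate \<open>eqs\<close> may also depend on values elsewhere. The identity of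
  \<open>N\<close> is a pointwise epic map from the family \<open>n\<close> to the family
  \<open>dec s\<close>, so stability under quotients transfers the laws.\<close>

lemma algebra_of_operations:
  assumes N: "has_operations N n" and eqs: "eqs N n" and ext: "ftor_extensional M N"
  obtains s where "(N, s) \<in> algs" "\<And>j. j \<in> J \<Longrightarrow> dec s j = n j"
proof -
  obtain s where s: "s \<in> ext" "\<And>j. j \<in> J \<Longrightarrow> dec s j = n j" using dec_surj by blast
  have N': "has_operations N (dec s)" using N s(2) by (simp add: has_operations_def)
  interpret N: linear_functor R M E N by (rule has_operations_linear[OF N])
  have "op_map N n N (dec s) (\<lambda>X. Id E (omap N X))"
    using op_map_id[OF N] s(2) by (simp add: op_map_def)
  then have "eqs N (dec s)"
    by (rule stable_quotient[OF eqs_stable N eqs N'])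
      (auto simp: is_epi_def id_in_hom N.omap_obj comp_id_right)
  then show ?thesis using that[of s] N' s ext by (simp add: algs_def)
qed

text \<open>Every target in \<open>K\<close> satisfies the laws, so \<open>stable_sub\<close> gives
  them for the lifted structure; \<open>algebra_of_operations\<close> then supplies a code for
  it.\<close>

lemma lift_algebra:
  fixes K :: "((('mo, 'ma, 'eo, 'ea) ftor \<times> 's) \<times> ('mo \<Rightarrow> 'ea)) set" and Z :: "'mo \<Rightarrow> 'eo"
  assumes K: "\<And>P k. (P, k) \<in> K \<Longrightarrow> P \<in> algs"
    and Z: "\<And>X. X \<in> Obj M \<Longrightarrow> Z X \<in> Obj E"
    and k: "\<And>P k X. \<lbrakk>(P, k) \<in> K; X \<in> Obj M\<rbrakk> \<Longrightarrow> \<guillemotleft>k X : Z X \<rightarrow>\<^bsub>E\<^esub> omap (fst P) X\<guillemotright>"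
    and mono: "\<And>X. X \<in> Obj M \<Longrightarrow> jointly_mono E (Z X) {k X | P k. (P, k) \<in> K}"
    and arr: "\<And>X Y h. \<guillemotleft>h : X \<rightarrow>\<^bsub>M\<^esub> Y\<guillemotright> \<Longrightarrow> \<exists>u. \<guillemotleft>u : Z X \<rightarrow>\<^bsub>E\<^esub> Z Y\<guillemotright> \<and>
      (\<forall>P k. (P, k) \<in> K \<longrightarrow> k Y \<cdot>\<^bsub>E\<^esub> u = amap (fst P) h \<cdot>\<^bsub>E\<^esub> k X)"
    and op: "\<And>j. j \<in> J \<Longrightarrow> \<exists>u. \<guillemotleft>u : omap (T j) (Z (src j)) \<rightarrow>\<^bsub>E\<^esub> Z (tgt j)\<guillemotright> \<and>
      (\<forall>P k. (P, k) \<in> K \<longrightarrow> k (tgt j) \<cdot>\<^bsub>E\<^esub> u = dec (snd P) j \<cdot>\<^bsub>E\<^esub> amap (T j) (k (src j)))"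
  obtains N where "N \<in> algs" "\<And>X. X \<in> Obj M \<Longrightarrow> omap (fst N) X = Z X"
    "\<And>P k. (P, k) \<in> K \<Longrightarrow> mor N P (restrict k (Obj M))"
proof -
  define K' where "K' = {(fst P, dec (snd P), k) | P k. (P, k) \<in> K}"
  have K': "(fst P, dec (snd P), k) \<in> K'" if "(P, k) \<in> K" for P k using that by (auto simp: K'_def)
  have K'_ops: "has_operations P p \<and> eqs P p" if "(P, p, k) \<in> K'" for P p k
    using that K algs_operations algs_eqs by (auto simp: K'_def)
  have set_eq: "{k X | P p k. (P, p, k) \<in> K'} = {k X | P k. (P, k) \<in> K}" for X
    by (auto simp: K'_def)
  obtain N n where N: "has_operations N n" "ftor_extensional M N" and obj: "\<And>X. X \<in> Obj M \<Longrightarrow> omap N X = Z X"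
    and maps: "\<And>P p k. (P, p, k) \<in> K' \<Longrightarrow> op_map N n P p k"
  proof (rule lift_operations[of K' Z])
    show "has_operations P p" if "(P, p, k) \<in> K'" for P p k using K'_ops[OF that] by blast
    show "\<guillemotleft>k X : Z X \<rightarrow>\<^bsub>E\<^esub> omap P X\<guillemotright>" if "(P, p, k) \<in> K'" "X \<in> Obj M" for P p k X
      using that k by (auto simp: K'_def)
    show "jointly_mono E (Z X) {k X | P p k. (P, p, k) \<in> K'}" if "X \<in> Obj M" for X
      using mono[OF that] by (simp add: set_eq)
    show "\<exists>u. \<guillemotleft>u : Z X \<rightarrow>\<^bsub>E\<^esub> Z Y\<guillemotright> \<and> (\<forall>P p k. (P, p, k) \<in> K' \<longrightarrow> k Y \<cdot>\<^bsub>E\<^esub> u = amap P h \<cdot>\<^bsub>E\<^esub> k X)"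
      if "\<guillemotleft>h : X \<rightarrow>\<^bsub>M\<^esub> Y\<guillemotright>" for X Y h
      using arr[OF that] unfolding K'_def by blast
    show "\<exists>u. \<guillemotleft>u : omap (T j) (Z (src j)) \<rightarrow>\<^bsub>E\<^esub> Z (tgt j)\<guillemotright> \<and>
        (\<forall>P p k. (P, p, k) \<in> K' \<longrightarrow> k (tgt j) \<cdot>\<^bsub>E\<^esub> u = p j \<cdot>\<^bsub>E\<^esub> amap (T j) (k (src j)))" if "j \<in> J" for j
      using op[OF that] unfolding K'_def by blast
  qed (use Z in auto)
  have "eqs N n"
  proof (rule stable_sub[OF eqs_stable N(1)])
    show "has_operations P p \<and> eqs P p \<and> op_map N n P p k" if "(P, p, k) \<in> K'" for P p k
      using K'_ops[OF that] maps[OF that] by blast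
    show "jointly_mono E (omap N X) {k X | P p k. (P, p, k) \<in> K'}" if "X \<in> Obj M" for X
      using mono[OF that] obj[OF that] by (simp add: set_eq)
  qed
  then obtain s where s: "(N, s) \<in> algs" "\<And>j. j \<in> J \<Longrightarrow> dec s j = n j"
    using algebra_of_operations N by blast
  show ?thesis
  proof (rule that[OF s(1)])
    show "mor (N, s) P (restrict k (Obj M))" if "(P, k) \<in> K" for P k
      using mor_restrict[OF s(1) K[OF that], of k] maps[OF K'[OF that]] s(2) by (simp add: op_map_def)
  qed (simp add: obj)
qed

text \<open>The laws descend along the pointwise epic \<open>q\<close> by
  \<open>stable_quotient\<close>.\<close>

lemma descend_algebra:
  assumes P: "P \<in> algs"
    and epi: "\<And>X. X \<in> Obj M \<Longrightarrow> is_epi E (omap (fst P) X) (Z X) (q X)"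
    and arr: "\<And>X Y h. \<guillemotleft>h : X \<rightarrow>\<^bsub>M\<^esub> Y\<guillemotright> \<Longrightarrow>
      \<exists>u. \<guillemotleft>u : Z X \<rightarrow>\<^bsub>E\<^esub> Z Y\<guillemotright> \<and> u \<cdot>\<^bsub>E\<^esub> q X = q Y \<cdot>\<^bsub>E\<^esub> amap (fst P) h"
    and op: "\<And>j. j \<in> J \<Longrightarrow> \<exists>u. \<guillemotleft>u : omap (T j) (Z (src j)) \<rightarrow>\<^bsub>E\<^esub> Z (tgt j)\<guillemotright> \<and>
      u \<cdot>\<^bsub>E\<^esub> amap (T j) (q (src j)) = q (tgt j) \<cdot>\<^bsub>E\<^esub> dec (snd P) j"
  obtains N where "N \<in> algs" "\<And>X. X \<in> Obj M \<Longrightarrow> omap (fst N) X = Z X" "mor P N (restrict q (Obj M))"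
proof -
  obtain N n where N: "has_operations N n" "ftor_extensional M N" and obj: "\<And>X. X \<in> Obj M \<Longrightarrow> omap N X = Z X"
    and q: "op_map (fst P) (dec (snd P)) N n q"
    using descend_operations[OF algs_operations[OF P] epi arr op] by metis
  have "eqs N n"
    by (rule stable_quotient[OF eqs_stable algs_operations[OF P] algs_eqs[OF P] N(1) q]) (simp add: obj epi)
  then obtain s where s: "(N, s) \<in> algs" "\<And>j. j \<in> J \<Longrightarrow> dec s j = n j"
    using algebra_of_operations N by blast
  show ?thesis
    by (rule that[OF s(1)]) (use obj mor_restrict[OF P s(1), of q] q s(2) in \<open>simp_all add: op_map_def\<close>)
qed

lemma mor_factor_mono:
  fixes K :: "((('mo, 'ma, 'eo, 'ea) ftor \<times> 's) \<times> ('mo \<Rightarrow> 'ea)) set"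
  assumes W: "W \<in> algs" and N: "N \<in> algs" and k: "\<And>P k. (P, k) \<in> K \<Longrightarrow> mor N P k"
    and mono: "\<And>X. X \<in> Obj M \<Longrightarrow> jointly_mono E (omap (fst N) X) {k X | P k. (P, k) \<in> K}"
    and u: "\<And>X. X \<in> Obj M \<Longrightarrow> \<guillemotleft>u X : omap (fst W) X \<rightarrow>\<^bsub>E\<^esub> omap (fst N) X\<guillemotright>"
    and ku: "\<And>P k. (P, k) \<in> K \<Longrightarrow> mor W P (\<lambda>X\<in>Obj M. k X \<cdot>\<^bsub>E\<^esub> u X)"
  shows "mor W N (restrict u (Obj M))"
proof (rule mor_restrict[OF W N])
  define K' where "K' = {(fst P, dec (snd P), k) | P k. (P, k) \<in> K}"
  have set_eq: "{k X | P p k. (P, p, k) \<in> K'} = {k X | P k. (P, k) \<in> K}" for X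
    by (auto simp: K'_def)
  show "op_map (fst W) (dec (snd W)) (fst N) (dec (snd N)) u"
  proof (rule op_map_factor_mono[of _ _ _ _ K'])
    fix P p k assume "(P, p, k) \<in> K'"
    then obtain Q where Q: "P = fst Q" "p = dec (snd Q)" "(Q, k) \<in> K" by (auto simp: K'_def)
    show "has_operations P p" "op_map (fst N) (dec (snd N)) P p k"
      using k[OF Q(3)] Q(1,2) algs_operations by (auto simp: mor_def)
    have "op_map (fst W) (dec (snd W)) P p (\<lambda>X\<in>Obj M. k X \<cdot>\<^bsub>E\<^esub> u X)"
      using ku[OF Q(3)] Q(1,2) by (simp add: mor_def)
    then show "op_map (fst W) (dec (snd W)) P p (\<lambda>X. k X \<cdot>\<^bsub>E\<^esub> u X)"
      by (rule op_map_cong) simp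
  qed (use W N u mono in \<open>simp_all add: set_eq algs_operations\<close>)
qed

lemma mor_factor_epi:
  assumes W: "W \<in> algs" and q: "mor P N q"
    and epi: "\<And>X. X \<in> Obj M \<Longrightarrow> is_epi E (omap (fst P) X) (omap (fst N) X) (q X)"
    and u: "\<And>X. X \<in> Obj M \<Longrightarrow> \<guillemotleft>u X : omap (fst N) X \<rightarrow>\<^bsub>E\<^esub> omap (fst W) X\<guillemotright>"
    and uq: "mor P W (\<lambda>X\<in>Obj M. u X \<cdot>\<^bsub>E\<^esub> q X)"
  shows "mor N W (restrict u (Obj M))"
proof (rule mor_restrict[OF mor_algs(2)[OF q] W])
  have "op_map (fst P) (dec (snd P)) (fst W) (dec (snd W)) (\<lambda>X\<in>Obj M. u X \<cdot>\<^bsub>E\<^esub> q X)"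
    using uq by (simp add: mor_def)
  then have uq': "op_map (fst P) (dec (snd P)) (fst W) (dec (snd W)) (\<lambda>X. u X \<cdot>\<^bsub>E\<^esub> q X)"
    by (rule op_map_cong) simp
  have q': "op_map (fst P) (dec (snd P)) (fst N) (dec (snd N)) q" using q by (simp add: mor_def)
  show "op_map (fst N) (dec (snd N)) (fst W) (dec (snd W)) u"
    by (rule op_map_factor_epi[OF algs_operations[OF mor_algs(1)[OF q]] algs_operations[OF mor_algs(2)[OF q]]
          algs_operations[OF W] q' epi u uq'])
qed

section \<open>Kernels, cokernels, monos and epis computed pointwise\<close>

lemma zero_mor_iff:
  assumes "mor P Q f"
  shows "(P, Q, f) = \<zero>\<^bsub>Hom A P Q\<^esub> \<longleftrightarrow> (\<forall>X \<in> Obj M. f X = \<zero>\<^bsub>Hom E (omap (fst P) X) (omap (fst Q) X)\<^esub>)"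
proof -
  have "f = (\<lambda>X\<in>Obj M. \<zero>\<^bsub>Hom E (omap (fst P) X) (omap (fst Q) X)\<^esub>)"
    if "\<forall>X \<in> Obj M. f X = \<zero>\<^bsub>Hom E (omap (fst P) X) (omap (fst Q) X)\<^esub>"
    using mor_ext[OF assms mor_zero[OF mor_algs[OF assms]]] that by simp
  then show ?thesis by (auto simp: zero_A)
qed

lemma comp_zero_iff:
  assumes f: "mor P Q f" and g: "mor Q V g"
  shows "(Q, V, g) \<cdot>\<^bsub>A\<^esub> (P, Q, f) = \<zero>\<^bsub>Hom A P V\<^esub> \<longleftrightarrow>
    (\<forall>X \<in> Obj M. g X \<cdot>\<^bsub>E\<^esub> f X = \<zero>\<^bsub>Hom E (omap (fst P) X) (omap (fst V) X)\<^esub>)"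
  using zero_mor_iff[OF mor_comp[OF f g]] by (simp add: Comp_A)

text \<open>\<open>A.monoI\<close> reduces the claim to arrows killed by \<open>f\<close>, and
  vanishing of an arrow is a pointwise condition.\<close>

lemma pointwise_mono:
  assumes f: "mor P Q f" and mono: "\<And>X. X \<in> Obj M \<Longrightarrow> is_mono E (omap (fst P) X) (omap (fst Q) X) (f X)"
  shows "is_mono A P Q (P, Q, f)"
proof (rule A.monoI)
  fix W g assume "\<guillemotleft>g : W \<rightarrow>\<^bsub>A\<^esub> P\<guillemotright>" and fg: "(P, Q, f) \<cdot>\<^bsub>A\<^esub> g = \<zero>\<^bsub>Hom A W Q\<^esub>"
  then obtain g' where g: "g = (W, P, g')" "mor W P g'" by (auto simp: in_hom_A)
  have "g' X = \<zero>\<^bsub>Hom E (omap (fst W) X) (omap (fst P) X)\<^esub>" if X: "X \<in> Obj M" for X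
  proof (rule mono_cancel[OF mono[OF X] _ mor_in_hom[OF g(2) X]])
    note obj = algs_obj[OF mor_algs(1)[OF g(2)] X] algs_obj[OF mor_algs(1)[OF f] X]
    show "\<guillemotleft>\<zero>\<^bsub>Hom E (omap (fst W) X) (omap (fst P) X)\<^esub> : omap (fst W) X \<rightarrow>\<^bsub>E\<^esub> omap (fst P) X\<guillemotright>"
      by (rule zero_in_hom[OF obj])
    show "f X \<cdot>\<^bsub>E\<^esub> g' X = f X \<cdot>\<^bsub>E\<^esub> \<zero>\<^bsub>Hom E (omap (fst W) X) (omap (fst P) X)\<^esub>"
      using fg X by (simp add: g(1) comp_zero_iff[OF g(2) f] comp_zero_right[OF mor_in_hom[OF f X] obj(1)])
  qed
  then show "g = \<zero>\<^bsub>Hom A W P\<^esub>" using zero_mor_iff[OF g(2)] g(1) by simp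
qed (use f in \<open>simp add: in_hom_A_triple\<close>)

lemma pointwise_epi:
  assumes f: "mor P Q f" and epi: "\<And>X. X \<in> Obj M \<Longrightarrow> is_epi E (omap (fst P) X) (omap (fst Q) X) (f X)"
  shows "is_epi A P Q (P, Q, f)"
proof (rule A.epiI)
  fix W g assume "\<guillemotleft>g : Q \<rightarrow>\<^bsub>A\<^esub> W\<guillemotright>" and gf: "g \<cdot>\<^bsub>A\<^esub> (P, Q, f) = \<zero>\<^bsub>Hom A P W\<^esub>"
  then obtain g' where g: "g = (Q, W, g')" "mor Q W g'" by (auto simp: in_hom_A)
  have "g' X = \<zero>\<^bsub>Hom E (omap (fst Q) X) (omap (fst W) X)\<^esub>" if X: "X \<in> Obj M" for X
  proof (rule epi_cancel[OF epi[OF X] _ mor_in_hom[OF g(2) X]])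
    note obj = algs_obj[OF mor_algs(2)[OF f] X] algs_obj[OF mor_algs(2)[OF g(2)] X]
    show "\<guillemotleft>\<zero>\<^bsub>Hom E (omap (fst Q) X) (omap (fst W) X)\<^esub> : omap (fst Q) X \<rightarrow>\<^bsub>E\<^esub> omap (fst W) X\<guillemotright>"
      by (rule zero_in_hom[OF obj])
    show "g' X \<cdot>\<^bsub>E\<^esub> f X = \<zero>\<^bsub>Hom E (omap (fst Q) X) (omap (fst W) X)\<^esub> \<cdot>\<^bsub>E\<^esub> f X"
      using gf X by (simp add: g(1) comp_zero_iff[OF f g(2)] comp_zero_left[OF mor_in_hom[OF f X] obj(2)])
  qed
  then show "g = \<zero>\<^bsub>Hom A Q W\<^esub>" using zero_mor_iff[OF g(2)] g(1) by simp
qed (use f in \<open>simp add: in_hom_A_triple\<close>)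

text \<open>Lifts exist at each object; chosen there independently of each other, they form a map of
  algebras by \<open>mor_factor_mono\<close>.\<close>

lemma pointwise_kernel:
  assumes f: "mor P Q f" and k: "mor K P k"
    and ker: "\<And>X. X \<in> Obj M \<Longrightarrow>
      is_kernel E (omap (fst P) X) (omap (fst Q) X) (f X) (omap (fst K) X) (k X)"
  shows "is_kernel A P Q (P, Q, f) K (K, P, k)"
proof (rule A.kernelI)
  show "is_mono A K P (K, P, k)" by (rule pointwise_mono[OF k kernel_mono[OF ker]])
  show "(P, Q, f) \<cdot>\<^bsub>A\<^esub> (K, P, k) = \<zero>\<^bsub>Hom A K Q\<^esub>"
    using ker by (simp add: comp_zero_iff[OF k f] is_kernel_def)
  fix W h assume "\<guillemotleft>h : W \<rightarrow>\<^bsub>A\<^esub> P\<guillemotright>" and fh: "(P, Q, f) \<cdot>\<^bsub>A\<^esub> h = \<zero>\<^bsub>Hom A W Q\<^esub>"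
  then obtain h' where h: "h = (W, P, h')" "mor W P h'" by (auto simp: in_hom_A)
  have "\<exists>u. \<guillemotleft>u : omap (fst W) X \<rightarrow>\<^bsub>E\<^esub> omap (fst K) X\<guillemotright> \<and> k X \<cdot>\<^bsub>E\<^esub> u = h' X" if X: "X \<in> Obj M" for X
    using kernel_lift[OF ker[OF X] mor_in_hom[OF h(2) X]] fh X by (auto simp: h(1) comp_zero_iff[OF h(2) f])
  then obtain u where u: "\<And>X. X \<in> Obj M \<Longrightarrow> \<guillemotleft>u X : omap (fst W) X \<rightarrow>\<^bsub>E\<^esub> omap (fst K) X\<guillemotright>"
    and ku: "\<And>X. X \<in> Obj M \<Longrightarrow> k X \<cdot>\<^bsub>E\<^esub> u X = h' X" by metis
  \<comment> \<open>The composite is restricted and \<open>h'\<close> is extensional, so agreement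
    on \<open>Obj M\<close> is equality.\<close>
  have h'_eq: "(\<lambda>X\<in>Obj M. k X \<cdot>\<^bsub>E\<^esub> u X) = h'"
    using h(2) ku by (auto simp: mor_def fun_eq_iff extensional_def)
  have "mor W K (restrict u (Obj M))"
    by (rule mor_factor_mono[where K = "{(P, k)}"])
      (use h k u h'_eq mor_algs mono_jointly_mono[OF kernel_mono[OF ker]] in auto)
  moreover have "(K, P, k) \<cdot>\<^bsub>A\<^esub> (W, K, restrict u (Obj M)) = h"
    using h'_eq h(1) by (auto simp: Comp_A cong: restrict_cong)
  ultimately show "\<exists>u. \<guillemotleft>u : W \<rightarrow>\<^bsub>A\<^esub> K\<guillemotright> \<and> (K, P, k) \<cdot>\<^bsub>A\<^esub> u = h" by (auto simp: in_hom_A)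
qed (use f in \<open>simp add: in_hom_A_triple\<close>)

lemma pointwise_cokernel:
  assumes f: "mor P Q f" and q: "mor Q V q"
    and coker: "\<And>X. X \<in> Obj M \<Longrightarrow>
      is_cokernel E (omap (fst P) X) (omap (fst Q) X) (f X) (omap (fst V) X) (q X)"
  shows "is_cokernel A P Q (P, Q, f) V (Q, V, q)"
proof (rule A.cokernelI)
  show "is_epi A Q V (Q, V, q)" by (rule pointwise_epi[OF q cokernel_epi[OF coker]])
  show "(Q, V, q) \<cdot>\<^bsub>A\<^esub> (P, Q, f) = \<zero>\<^bsub>Hom A P V\<^esub>"
    using coker by (simp add: comp_zero_iff[OF f q] is_cokernel_def)
  fix W h assume "\<guillemotleft>h : Q \<rightarrow>\<^bsub>A\<^esub> W\<guillemotright>" and hf: "h \<cdot>\<^bsub>A\<^esub> (P, Q, f) = \<zero>\<^bsub>Hom A P W\<^esub>"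
  then obtain h' where h: "h = (Q, W, h')" "mor Q W h'" by (auto simp: in_hom_A)
  have "\<exists>u. \<guillemotleft>u : omap (fst V) X \<rightarrow>\<^bsub>E\<^esub> omap (fst W) X\<guillemotright> \<and> u \<cdot>\<^bsub>E\<^esub> q X = h' X" if X: "X \<in> Obj M" for X
    using cokernel_lift[OF coker[OF X] mor_in_hom[OF h(2) X]] hf X by (auto simp: h(1) comp_zero_iff[OF f h(2)])
  then obtain u where u: "\<And>X. X \<in> Obj M \<Longrightarrow> \<guillemotleft>u X : omap (fst V) X \<rightarrow>\<^bsub>E\<^esub> omap (fst W) X\<guillemotright>"
    and uq: "\<And>X. X \<in> Obj M \<Longrightarrow> u X \<cdot>\<^bsub>E\<^esub> q X = h' X" by metis
  have h'_eq: "(\<lambda>X\<in>Obj M. u X \<cdot>\<^bsub>E\<^esub> q X) = h'"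
    using h(2) uq by (auto simp: mor_def fun_eq_iff extensional_def)
  have "mor V W (restrict u (Obj M))"
    by (rule mor_factor_epi[OF mor_algs(2)[OF h(2)] q cokernel_epi[OF coker] u]) (simp_all add: h'_eq h(2))
  moreover have "(V, W, restrict u (Obj M)) \<cdot>\<^bsub>A\<^esub> (Q, V, q) = h"
    using h'_eq h(1) by (auto simp: Comp_A cong: restrict_cong)
  ultimately show "\<exists>u. \<guillemotleft>u : V \<rightarrow>\<^bsub>A\<^esub> W\<guillemotright> \<and> u \<cdot>\<^bsub>A\<^esub> (Q, V, q) = h" by (auto simp: in_hom_A)
qed (use f in \<open>simp add: in_hom_A_triple\<close>)

text \<open>The result is stated as an algebra whose values are kernels in \<open>E\<close>, and not
  merely as a kernel in \<open>A\<close>, so that \<open>mono_pointwise\<close> can work at a single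
  object.\<close>

lemma pointwise_kernel_exists:
  assumes f: "mor P Q f"
  obtains K k where "mor K P k"
    "\<And>X. X \<in> Obj M \<Longrightarrow> is_kernel E (omap (fst P) X) (omap (fst Q) X) (f X) (omap (fst K) X) (k X)"
proof -
  have P: "P \<in> algs" and Q: "Q \<in> algs" using mor_algs[OF f] .
  interpret P: linear_functor R M E "fst P" by (rule algs_linear[OF P])
  interpret Q: linear_functor R M E "fst Q" by (rule algs_linear[OF Q])
  note f' = mor_in_hom[OF f]
  have "\<exists>Z k. is_kernel E (omap (fst P) X) (omap (fst Q) X) (f X) Z k" if "X \<in> Obj M" for X
    using kernels[OF f'[OF that]] .
  then obtain Z k where
    ker: "\<And>X. X \<in> Obj M \<Longrightarrow> is_kernel E (omap (fst P) X) (omap (fst Q) X) (f X) (Z X) (k X)" by metis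
  have k: "\<guillemotleft>k X : Z X \<rightarrow>\<^bsub>E\<^esub> omap (fst P) X\<guillemotright>" and fk: "f X \<cdot>\<^bsub>E\<^esub> k X = \<zero>\<^bsub>Hom E (Z X) (omap (fst Q) X)\<^esub>"
    if "X \<in> Obj M" for X using ker[OF that] by (auto simp: is_kernel_def)
  obtain K where K: "K \<in> algs" "\<And>X. X \<in> Obj M \<Longrightarrow> omap (fst K) X = Z X" "mor K P (restrict k (Obj M))"
  proof (rule lift_algebra[of "{(P, k)}" Z])
    show "\<exists>u. \<guillemotleft>u : Z X \<rightarrow>\<^bsub>E\<^esub> Z Y\<guillemotright> \<and> (\<forall>P' k'. (P', k') \<in> {(P, k)} \<longrightarrow> k' Y \<cdot>\<^bsub>E\<^esub> u = amap (fst P') h \<cdot>\<^bsub>E\<^esub> k' X)"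
      if h: "\<guillemotleft>h : X \<rightarrow>\<^bsub>M\<^esub> Y\<guillemotright>" for X Y h
    proof -
      note X = base.in_hom_obj(1)[OF h] and Y = base.in_hom_obj(2)[OF h]
      note Ph = P.amap_in_hom[OF h] and Qh = Q.amap_in_hom[OF h]
      \<comment> \<open>Naturality of \<open>f\<close> moves it next to \<open>k X\<close>, so the
        composite of \<open>amap (fst P) h\<close> with \<open>k X\<close> is killed by
        \<open>f Y\<close> and lifts to the kernel at \<open>Y\<close>.\<close>
      have "f Y \<cdot>\<^bsub>E\<^esub> (amap (fst P) h \<cdot>\<^bsub>E\<^esub> k X) = amap (fst Q) h \<cdot>\<^bsub>E\<^esub> (f X \<cdot>\<^bsub>E\<^esub> k X)"
        by (simp add: comp_assoc[OF k[OF X] Ph f'[OF Y], symmetric] mor_natural[OF f h]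
            comp_assoc[OF k[OF X] f'[OF X] Qh])
      also have "\<dots> = \<zero>\<^bsub>Hom E (Z X) (omap (fst Q) Y)\<^esub>"
        using comp_zero_right[OF Qh] in_hom_obj[OF k[OF X]] by (simp add: fk[OF X])
      finally show ?thesis
        using kernel_lift[OF ker[OF Y] comp_in_hom[OF k[OF X] Ph]] by auto
    qed
    show "\<exists>u. \<guillemotleft>u : omap (T j) (Z (src j)) \<rightarrow>\<^bsub>E\<^esub> Z (tgt j)\<guillemotright> \<and> (\<forall>P' k'. (P', k') \<in> {(P, k)} \<longrightarrow>
        k' (tgt j) \<cdot>\<^bsub>E\<^esub> u = dec (snd P') j \<cdot>\<^bsub>E\<^esub> amap (T j) (k' (src j)))" if j: "j \<in> J" for j
    proof -
      interpret T: linear_functor R E E "T j" by (rule T_linear[OF j])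
      note s = src_obj[OF j] and t = tgt_obj[OF j]
      note p = has_operations_in_hom[OF algs_operations[OF P] j] and q = has_operations_in_hom[OF algs_operations[OF Q] j]
      \<comment> \<open>The same argument for the operation: \<open>f\<close> passes through it, and
        \<open>T j\<close> sends the zero composite of \<open>f\<close> and \<open>k\<close> to
        zero.\<close>
      have "f (tgt j) \<cdot>\<^bsub>E\<^esub> (dec (snd P) j \<cdot>\<^bsub>E\<^esub> amap (T j) (k (src j)))
          = dec (snd Q) j \<cdot>\<^bsub>E\<^esub> amap (T j) (f (src j) \<cdot>\<^bsub>E\<^esub> k (src j))"
        by (simp add: comp_assoc[OF T.amap_in_hom[OF k[OF s]] p f'[OF t], symmetric] mor_op[OF f j]
            comp_assoc[OF T.amap_in_hom[OF k[OF s]] T.amap_in_hom[OF f'[OF s]] q] T.amap_comp[OF k[OF s] f'[OF s]])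
      also have "\<dots> = \<zero>\<^bsub>Hom E (omap (T j) (Z (src j))) (omap (fst Q) (tgt j))\<^esub>"
        using comp_zero_right[OF q] in_hom_obj[OF k[OF s]] Q.omap_obj[OF s]
        by (simp add: fk[OF s] T.amap_zero T.omap_obj)
      finally show ?thesis
        using kernel_lift[OF ker[OF t] comp_in_hom[OF T.amap_in_hom[OF k[OF s]] p]] by auto
    qed
    show "jointly_mono E (Z X) {k' X | P' k'. (P', k') \<in> {(P, k)}}" if "X \<in> Obj M" for X
      using mono_jointly_mono[OF kernel_mono[OF ker[OF that]]] by simp
  qed (use P k in_hom_obj[OF k] in auto)
  then show ?thesis using that[OF K(3)] ker by simp
qed

lemma pointwise_cokernel_exists:
  assumes f: "mor P Q f"
  obtains V q where "mor Q V q"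
    "\<And>X. X \<in> Obj M \<Longrightarrow> is_cokernel E (omap (fst P) X) (omap (fst Q) X) (f X) (omap (fst V) X) (q X)"
proof -
  have P: "P \<in> algs" and Q: "Q \<in> algs" using mor_algs[OF f] .
  interpret P: linear_functor R M E "fst P" by (rule algs_linear[OF P])
  interpret Q: linear_functor R M E "fst Q" by (rule algs_linear[OF Q])
  note f' = mor_in_hom[OF f]
  have "\<exists>Z q. is_cokernel E (omap (fst P) X) (omap (fst Q) X) (f X) Z q" if "X \<in> Obj M" for X
    using cokernels[OF f'[OF that]] .
  then obtain Z q where
    coker: "\<And>X. X \<in> Obj M \<Longrightarrow> is_cokernel E (omap (fst P) X) (omap (fst Q) X) (f X) (Z X) (q X)" by metis
  have q: "\<guillemotleft>q X : omap (fst Q) X \<rightarrow>\<^bsub>E\<^esub> Z X\<guillemotright>" and qf: "q X \<cdot>\<^bsub>E\<^esub> f X = \<zero>\<^bsub>Hom E (omap (fst P) X) (Z X)\<^esub>"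
    if "X \<in> Obj M" for X using coker[OF that] by (auto simp: is_cokernel_def)
  obtain V where V: "V \<in> algs" "\<And>X. X \<in> Obj M \<Longrightarrow> omap (fst V) X = Z X" "mor Q V (restrict q (Obj M))"
  proof (rule descend_algebra[OF Q cokernel_epi[OF coker]])
    show "\<exists>u. \<guillemotleft>u : Z X \<rightarrow>\<^bsub>E\<^esub> Z Y\<guillemotright> \<and> u \<cdot>\<^bsub>E\<^esub> q X = q Y \<cdot>\<^bsub>E\<^esub> amap (fst Q) h" if h: "\<guillemotleft>h : X \<rightarrow>\<^bsub>M\<^esub> Y\<guillemotright>" for X Y h
    proof -
      note X = base.in_hom_obj(1)[OF h] and Y = base.in_hom_obj(2)[OF h]
      note Ph = P.amap_in_hom[OF h] and Qh = Q.amap_in_hom[OF h]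
      have "q Y \<cdot>\<^bsub>E\<^esub> amap (fst Q) h \<cdot>\<^bsub>E\<^esub> f X = q Y \<cdot>\<^bsub>E\<^esub> f Y \<cdot>\<^bsub>E\<^esub> amap (fst P) h"
        by (simp add: comp_assoc[OF f'[OF X] Qh q[OF Y]] mor_natural[OF f h, symmetric]
            comp_assoc[OF Ph f'[OF Y] q[OF Y]])
      also have "\<dots> = \<zero>\<^bsub>Hom E (omap (fst P) X) (Z Y)\<^esub>"
        using comp_zero_left[OF Ph] in_hom_obj[OF q[OF Y]] by (simp add: qf[OF Y])
      finally show ?thesis
        using cokernel_lift[OF coker[OF X] comp_in_hom[OF Qh q[OF Y]]] by auto
    qed
    show "\<exists>u. \<guillemotleft>u : omap (T j) (Z (src j)) \<rightarrow>\<^bsub>E\<^esub> Z (tgt j)\<guillemotright> \<and>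
        u \<cdot>\<^bsub>E\<^esub> amap (T j) (q (src j)) = q (tgt j) \<cdot>\<^bsub>E\<^esub> dec (snd Q) j" if j: "j \<in> J" for j
    proof -
      interpret T: linear_functor R E E "T j" by (rule T_linear[OF j])
      note s = src_obj[OF j] and t = tgt_obj[OF j]
      note p' = has_operations_in_hom[OF algs_operations[OF P] j] and q' = has_operations_in_hom[OF algs_operations[OF Q] j]
      \<comment> \<open>The arrow to be factored kills the image of \<open>f\<close> under
        \<open>T j\<close>. By \<open>T_cokernel\<close> the image of \<open>q\<close> under
        \<open>T j\<close> is a cokernel of that image, which is what induces the operation on the
        quotient.\<close>
      have "q (tgt j) \<cdot>\<^bsub>E\<^esub> dec (snd Q) j \<cdot>\<^bsub>E\<^esub> amap (T j) (f (src j)) = q (tgt j) \<cdot>\<^bsub>E\<^esub> f (tgt j) \<cdot>\<^bsub>E\<^esub> dec (snd P) j"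
        by (simp add: comp_assoc[OF T.amap_in_hom[OF f'[OF s]] q' q[OF t]] mor_op[OF f j, symmetric]
            comp_assoc[OF p' f'[OF t] q[OF t]])
      also have "\<dots> = \<zero>\<^bsub>Hom E (omap (T j) (omap (fst P) (src j))) (Z (tgt j))\<^esub>"
        using comp_zero_left[OF p'] in_hom_obj[OF q[OF t]] by (simp add: qf[OF t])
      finally show ?thesis
        using cokernel_lift[OF T_cokernel[OF j coker[OF s]] comp_in_hom[OF q' q[OF t]]] by blast
    qed
  qed auto
  then show ?thesis using that[OF V(3)] coker by simp
qed

text \<open>The pointwise kernel \<open>k\<close> of \<open>f\<close> satisfies
  \<open>f k = 0\<close> in \<open>A\<close>, so \<open>f\<close> mono forces \<open>k = 0\<close>.
  Hence at \<open>X\<close> anything killed by \<open>f X\<close> factors through a zero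
  arrow.\<close>

lemma mono_pointwise:
  assumes mono: "is_mono A P Q (P, Q, f)" and X: "X \<in> Obj M"
  shows "is_mono E (omap (fst P) X) (omap (fst Q) X) (f X)"
proof -
  have f: "mor P Q f" using mono by (simp add: is_mono_def in_hom_A_triple)
  obtain K k where k: "mor K P k"
    and ker: "\<And>X. X \<in> Obj M \<Longrightarrow> is_kernel E (omap (fst P) X) (omap (fst Q) X) (f X) (omap (fst K) X) (k X)"
    using pointwise_kernel_exists[OF f] by blast
  have obj: "P \<in> Obj A" "Q \<in> Obj A" "K \<in> Obj A" using mor_algs[OF f] mor_algs[OF k] by (simp_all add: Obj_A)
  have f': "\<guillemotleft>(P, Q, f) : P \<rightarrow>\<^bsub>A\<^esub> Q\<guillemotright>" and k': "\<guillemotleft>(K, P, k) : K \<rightarrow>\<^bsub>A\<^esub> P\<guillemotright>"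
    using f k by (simp_all add: in_hom_A_triple)
  have "(P, Q, f) \<cdot>\<^bsub>A\<^esub> (K, P, k) = (P, Q, f) \<cdot>\<^bsub>A\<^esub> \<zero>\<^bsub>Hom A K P\<^esub>"
    using pointwise_kernel[OF f k ker] A.comp_zero_right[OF f'] obj by (simp add: is_kernel_def)
  then have "(K, P, k) = \<zero>\<^bsub>Hom A K P\<^esub>"
    using A.mono_cancel[OF mono _ k' A.zero_in_hom] obj by simp
  then have k0: "k X = \<zero>\<^bsub>Hom E (omap (fst K) X) (omap (fst P) X)\<^esub>"
    using zero_mor_iff[OF k] X by simp
  show ?thesis
  proof (rule monoI[OF mor_in_hom[OF f X]])
    fix W g assume g: "\<guillemotleft>g : W \<rightarrow>\<^bsub>E\<^esub> omap (fst P) X\<guillemotright>" "f X \<cdot>\<^bsub>E\<^esub> g = \<zero>\<^bsub>Hom E W (omap (fst Q) X)\<^esub>"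
    obtain u where "\<guillemotleft>u : W \<rightarrow>\<^bsub>E\<^esub> omap (fst K) X\<guillemotright>" "k X \<cdot>\<^bsub>E\<^esub> u = g" using kernel_lift[OF ker[OF X] g] .
    then show "g = \<zero>\<^bsub>Hom E W (omap (fst P) X)\<^esub>"
      using comp_zero_left in_hom_obj[OF g(1)] k0 by metis
  qed
qed

text \<open>Dually, the pointwise cokernel of an epi of \<open>A\<close> is zero, and at
  \<open>X\<close> anything that kills \<open>f X\<close> factors through it.\<close>

lemma epi_pointwise:
  assumes epi: "is_epi A P Q (P, Q, f)" and X: "X \<in> Obj M"
  shows "is_epi E (omap (fst P) X) (omap (fst Q) X) (f X)"
proof -
  have f: "mor P Q f" using epi by (simp add: is_epi_def in_hom_A_triple)
  obtain V q where q: "mor Q V q" and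
    coker: "\<And>X. X \<in> Obj M \<Longrightarrow> is_cokernel E (omap (fst P) X) (omap (fst Q) X) (f X) (omap (fst V) X) (q X)"
    using pointwise_cokernel_exists[OF f] by blast
  have obj: "P \<in> Obj A" "Q \<in> Obj A" "V \<in> Obj A" using mor_algs[OF f] mor_algs[OF q] by (simp_all add: Obj_A)
  have f': "\<guillemotleft>(P, Q, f) : P \<rightarrow>\<^bsub>A\<^esub> Q\<guillemotright>" and q': "\<guillemotleft>(Q, V, q) : Q \<rightarrow>\<^bsub>A\<^esub> V\<guillemotright>"
    using f q by (simp_all add: in_hom_A_triple)
  have "(Q, V, q) \<cdot>\<^bsub>A\<^esub> (P, Q, f) = \<zero>\<^bsub>Hom A Q V\<^esub> \<cdot>\<^bsub>A\<^esub> (P, Q, f)"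
    using pointwise_cokernel[OF f q coker] A.comp_zero_left[OF f'] obj by (simp add: is_cokernel_def)
  then have "(Q, V, q) = \<zero>\<^bsub>Hom A Q V\<^esub>"
    using A.epi_cancel[OF epi _ q' A.zero_in_hom] obj by simp
  then have q0: "q X = \<zero>\<^bsub>Hom E (omap (fst Q) X) (omap (fst V) X)\<^esub>"
    using zero_mor_iff[OF q] X by simp
  show ?thesis
  proof (rule epiI[OF mor_in_hom[OF f X]])
    fix W g assume g: "\<guillemotleft>g : omap (fst Q) X \<rightarrow>\<^bsub>E\<^esub> W\<guillemotright>" "g \<cdot>\<^bsub>E\<^esub> f X = \<zero>\<^bsub>Hom E (omap (fst P) X) W\<^esub>"
    obtain u where "\<guillemotleft>u : omap (fst V) X \<rightarrow>\<^bsub>E\<^esub> W\<guillemotright>" "u \<cdot>\<^bsub>E\<^esub> q X = g" using cokernel_lift[OF coker[OF X] g] .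
    then show "g = \<zero>\<^bsub>Hom E (omap (fst Q) X) W\<^esub>"
      using comp_zero_right in_hom_obj[OF g(1)] q0 by metis
  qed
qed

section \<open>Zero object, biproducts and the axioms of an abelian category\<close>

lemma zero_object_A: "\<exists>Z. is_zero_object A Z"
proof -
  obtain Z0 where Z0: "is_zero_object E Z0" using zero_object by blast
  then have Z0_obj: "Z0 \<in> Obj E" by (simp add: is_zero_object_def)
  have to_Z0: "u = v" if "\<guillemotleft>u : W \<rightarrow>\<^bsub>E\<^esub> Z0\<guillemotright>" "\<guillemotleft>v : W \<rightarrow>\<^bsub>E\<^esub> Z0\<guillemotright>" for u v W
    using Z0 that in_hom_obj[OF that(1)] unfolding is_zero_object_def by blast
  have from_Z0: "u = v" if "\<guillemotleft>u : Z0 \<rightarrow>\<^bsub>E\<^esub> W\<guillemotright>" "\<guillemotleft>v : Z0 \<rightarrow>\<^bsub>E\<^esub> W\<guillemotright>" for u v W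
    using Z0 that in_hom_obj[OF that(1)] unfolding is_zero_object_def by blast
  obtain Z where Z: "Z \<in> algs" "\<And>X. X \<in> Obj M \<Longrightarrow> omap (fst Z) X = Z0"
  \<comment> \<open>The empty family is jointly monic on \<open>Z0\<close> because any two parallel
    arrows into a zero object agree. There are no maps to commute with, so identities serve on
    arrows and zero arrows as operations.\<close>
  proof (rule lift_algebra[of "{}" "\<lambda>_. Z0"])
    show "jointly_mono E Z0 {k X |P k. (P, k) \<in> {}}" for X
      using to_Z0 unfolding jointly_mono_def by blast
    show "\<exists>u. \<guillemotleft>u : Z0 \<rightarrow>\<^bsub>E\<^esub> Z0\<guillemotright> \<and> (\<forall>P k. (P, k) \<in> {} \<longrightarrow> k Y \<cdot>\<^bsub>E\<^esub> u = amap (fst P) h \<cdot>\<^bsub>E\<^esub> k X)" for X Y h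
      using id_in_hom[OF Z0_obj] by blast
    show "\<exists>u. \<guillemotleft>u : omap (T j) Z0 \<rightarrow>\<^bsub>E\<^esub> Z0\<guillemotright> \<and>
        (\<forall>P k. (P, k) \<in> {} \<longrightarrow> k (tgt j) \<cdot>\<^bsub>E\<^esub> u = dec (snd P) j \<cdot>\<^bsub>E\<^esub> amap (T j) (k (src j)))" if j: "j \<in> J" for j
      using zero_in_hom[OF linear_functor.omap_obj[OF T_linear[OF j] Z0_obj] Z0_obj] by blast
  qed (use Z0_obj in auto)
  have "is_zero_object A Z"
    unfolding is_zero_object_def
  proof (intro conjI ballI)
    show "Z \<in> Obj A" using Z by (simp add: Obj_A)
    fix P assume P: "P \<in> Obj A"
    have "\<exists>f. \<guillemotleft>f : Z \<rightarrow>\<^bsub>A\<^esub> P\<guillemotright>" "\<exists>f. \<guillemotleft>f : P \<rightarrow>\<^bsub>A\<^esub> Z\<guillemotright>"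
      using A.zero_in_hom[of Z P] A.zero_in_hom[of P Z] P Z(1) unfolding Obj_A by blast+
    moreover have "f = g" if fg: "\<guillemotleft>f : Z \<rightarrow>\<^bsub>A\<^esub> P\<guillemotright>" "\<guillemotleft>g : Z \<rightarrow>\<^bsub>A\<^esub> P\<guillemotright>" for f g
    proof -
      obtain f' g' where fg: "f = (Z, P, f')" "mor Z P f'" "g = (Z, P, g')" "mor Z P g'"
        using fg unfolding in_hom_A by blast
      have "f' X = g' X" if "X \<in> Obj M" for X
        using mor_in_hom[OF fg(2) that] mor_in_hom[OF fg(4) that] by (simp add: Z(2)[OF that] from_Z0)
      then show ?thesis using mor_ext[OF fg(2,4)] fg(1,3) by simp
    qed
    moreover have "f = g" if fg: "\<guillemotleft>f : P \<rightarrow>\<^bsub>A\<^esub> Z\<guillemotright>" "\<guillemotleft>g : P \<rightarrow>\<^bsub>A\<^esub> Z\<guillemotright>" for f g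
    proof -
      obtain f' g' where fg: "f = (P, Z, f')" "mor P Z f'" "g = (P, Z, g')" "mor P Z g'"
        using fg unfolding in_hom_A by blast
      have "f' X = g' X" if "X \<in> Obj M" for X
        using mor_in_hom[OF fg(2) that] mor_in_hom[OF fg(4) that] by (simp add: Z(2)[OF that] to_Z0)
      then show ?thesis using mor_ext[OF fg(2,4)] fg(1,3) by simp
    qed
    ultimately show "\<exists>!f. \<guillemotleft>f : Z \<rightarrow>\<^bsub>A\<^esub> P\<guillemotright>" "\<exists>!f. \<guillemotleft>f : P \<rightarrow>\<^bsub>A\<^esub> Z\<guillemotright>" by blast+
  qed
  then show ?thesis by blast
qed

text \<open>The projections make the pointwise biproduct an algebra. The injections are then maps of
  algebras by \<open>mor_factor_mono\<close>, since their composites with the projections are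
  identities and zeros.\<close>

lemma biproducts_A:
  assumes P: "P \<in> algs" and Q: "Q \<in> algs"
  shows "\<exists>B i j p q. is_biproduct A P Q B i j p q"
proof -
  interpret P: linear_functor R M E "fst P" by (rule algs_linear[OF P])
  interpret Q: linear_functor R M E "fst Q" by (rule algs_linear[OF Q])
  have "\<exists>B i j p q. is_biproduct E (omap (fst P) X) (omap (fst Q) X) B i j p q" if "X \<in> Obj M" for X
    using biproducts[OF P.omap_obj[OF that] Q.omap_obj[OF that]] .
  then obtain Z i j p q where
    bp: "\<And>X. X \<in> Obj M \<Longrightarrow> is_biproduct E (omap (fst P) X) (omap (fst Q) X) (Z X) (i X) (j X) (p X) (q X)"
    by metis
  have i: "\<guillemotleft>i X : omap (fst P) X \<rightarrow>\<^bsub>E\<^esub> Z X\<guillemotright>" and j: "\<guillemotleft>j X : omap (fst Q) X \<rightarrow>\<^bsub>E\<^esub> Z X\<guillemotright>"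
    and p: "\<guillemotleft>p X : Z X \<rightarrow>\<^bsub>E\<^esub> omap (fst P) X\<guillemotright>" and q: "\<guillemotleft>q X : Z X \<rightarrow>\<^bsub>E\<^esub> omap (fst Q) X\<guillemotright>"
    and pi: "p X \<cdot>\<^bsub>E\<^esub> i X = Id E (omap (fst P) X)" and qj: "q X \<cdot>\<^bsub>E\<^esub> j X = Id E (omap (fst Q) X)"
    and qi: "q X \<cdot>\<^bsub>E\<^esub> i X = \<zero>\<^bsub>Hom E (omap (fst P) X) (omap (fst Q) X)\<^esub>"
    and pj: "p X \<cdot>\<^bsub>E\<^esub> j X = \<zero>\<^bsub>Hom E (omap (fst Q) X) (omap (fst P) X)\<^esub>"
    and sum: "i X \<cdot>\<^bsub>E\<^esub> p X \<oplus>\<^bsub>Hom E (Z X) (Z X)\<^esub> j X \<cdot>\<^bsub>E\<^esub> q X = Id E (Z X)"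
    if "X \<in> Obj M" for X using bp[OF that] by (auto simp: is_biproduct_def)
  \<comment> \<open>Stated for arbitrary \<open>p\<close> and \<open>q\<close>, as it is used again
    for the restricted projections.\<close>
  have set_eq: "{k X |S k. (S, k) \<in> {(P, p), (Q, q)}} = {p X, q X}" for X and p q :: "'mo \<Rightarrow> 'ea" by blast
  have mono: "jointly_mono E (Z X) {p X, q X}" if "X \<in> Obj M" for X
    by (rule biproduct_jointly_mono[OF bp[OF that]])
  obtain B where B: "B \<in> algs" "\<And>X. X \<in> Obj M \<Longrightarrow> omap (fst B) X = Z X"
    and maps: "\<And>S k. (S, k) \<in> {(P, p), (Q, q)} \<Longrightarrow> mor B S (restrict k (Obj M))"
  proof (rule lift_algebra[of "{(P, p), (Q, q)}" Z])
    show "\<exists>u. \<guillemotleft>u : Z X \<rightarrow>\<^bsub>E\<^esub> Z Y\<guillemotright> \<and>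
        (\<forall>S k. (S, k) \<in> {(P, p), (Q, q)} \<longrightarrow> k Y \<cdot>\<^bsub>E\<^esub> u = amap (fst S) h \<cdot>\<^bsub>E\<^esub> k X)"
      if h: "\<guillemotleft>h : X \<rightarrow>\<^bsub>M\<^esub> Y\<guillemotright>" for X Y h
      using biproduct_pair[OF bp comp_in_hom[OF p P.amap_in_hom[OF h]] comp_in_hom[OF q Q.amap_in_hom[OF h]]]
        base.in_hom_obj[OF h] by auto
    show "\<exists>u. \<guillemotleft>u : omap (T c) (Z (src c)) \<rightarrow>\<^bsub>E\<^esub> Z (tgt c)\<guillemotright> \<and> (\<forall>S k. (S, k) \<in> {(P, p), (Q, q)} \<longrightarrow>
        k (tgt c) \<cdot>\<^bsub>E\<^esub> u = dec (snd S) c \<cdot>\<^bsub>E\<^esub> amap (T c) (k (src c)))" if c: "c \<in> J" for c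
    proof -
      interpret T: linear_functor R E E "T c" by (rule T_linear[OF c])
      show ?thesis
        using biproduct_pair[OF bp[OF tgt_obj[OF c]]
            comp_in_hom[OF T.amap_in_hom[OF p[OF src_obj[OF c]]] has_operations_in_hom[OF algs_operations[OF P] c]]
            comp_in_hom[OF T.amap_in_hom[OF q[OF src_obj[OF c]]] has_operations_in_hom[OF algs_operations[OF Q] c]]]
        by auto
    qed
    show "jointly_mono E (Z X) {k X |S k. (S, k) \<in> {(P, p), (Q, q)}}" if "X \<in> Obj M" for X
      unfolding set_eq by (rule mono[OF that])
  qed (use P Q p q in_hom_obj[OF p] in auto)
  let ?p = "restrict p (Obj M)" and ?q = "restrict q (Obj M)"
  have p': "mor B P ?p" and q': "mor B Q ?q" using maps by auto
  have inj: "mor S B (restrict u (Obj M))"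
    if S: "S \<in> algs" and u: "\<And>X. X \<in> Obj M \<Longrightarrow> \<guillemotleft>u X : omap (fst S) X \<rightarrow>\<^bsub>E\<^esub> Z X\<guillemotright>"
      and up: "mor S P (\<lambda>X\<in>Obj M. p X \<cdot>\<^bsub>E\<^esub> u X)" and uq: "mor S Q (\<lambda>X\<in>Obj M. q X \<cdot>\<^bsub>E\<^esub> u X)" for S u
  proof (rule mor_factor_mono[of S B "{(P, ?p), (Q, ?q)}"])
    show "S \<in> algs" "B \<in> algs" by (fact S B(1))+
    show "mor B V k" if "(V, k) \<in> {(P, ?p), (Q, ?q)}" for V k
      using that by (elim insertE) (simp_all add: p' q')
    show "\<guillemotleft>u X : omap (fst S) X \<rightarrow>\<^bsub>E\<^esub> omap (fst B) X\<guillemotright>" if "X \<in> Obj M" for X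
      using u[OF that] by (simp add: B(2)[OF that])
    show "jointly_mono E (omap (fst B) X) {k X |S k. (S, k) \<in> {(P, ?p), (Q, ?q)}}" if "X \<in> Obj M" for X
      unfolding set_eq using mono[OF that] that by (simp add: B(2))
    have restr: "(\<lambda>X\<in>Obj M. restrict k (Obj M) X \<cdot>\<^bsub>E\<^esub> u X) = (\<lambda>X\<in>Obj M. k X \<cdot>\<^bsub>E\<^esub> u X)" for k
      by (rule restrict_ext) simp
    show "mor S V (\<lambda>X\<in>Obj M. k X \<cdot>\<^bsub>E\<^esub> u X)" if "(V, k) \<in> {(P, ?p), (Q, ?q)}" for V k
      using that by (elim insertE) (simp_all only: restr up uq prod.inject empty_iff)
  qed
  have i': "mor P B (restrict i (Obj M))"
  proof (rule inj[OF P i])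
    show "mor P P (\<lambda>X\<in>Obj M. p X \<cdot>\<^bsub>E\<^esub> i X)" using mor_id[OF P] by (simp add: pi cong: restrict_cong)
    show "mor P Q (\<lambda>X\<in>Obj M. q X \<cdot>\<^bsub>E\<^esub> i X)" using mor_zero[OF P Q] by (simp add: qi cong: restrict_cong)
  qed
  have j': "mor Q B (restrict j (Obj M))"
  proof (rule inj[OF Q j])
    show "mor Q P (\<lambda>X\<in>Obj M. p X \<cdot>\<^bsub>E\<^esub> j X)" using mor_zero[OF Q P] by (simp add: pj cong: restrict_cong)
    show "mor Q Q (\<lambda>X\<in>Obj M. q X \<cdot>\<^bsub>E\<^esub> j X)" using mor_id[OF Q] by (simp add: qj cong: restrict_cong)
  qed
  have "is_biproduct A P Q B (P, B, restrict i (Obj M)) (Q, B, restrict j (Obj M)) (B, P, ?p) (B, Q, ?q)"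
    unfolding is_biproduct_def
  proof (intro conjI)
    show "(B, P, ?p) \<cdot>\<^bsub>A\<^esub> (P, B, restrict i (Obj M)) = Id A P"
      by (simp add: A_simps pi cong: restrict_cong)
    show "(B, Q, ?q) \<cdot>\<^bsub>A\<^esub> (Q, B, restrict j (Obj M)) = Id A Q"
      by (simp add: A_simps qj cong: restrict_cong)
    show "(B, Q, ?q) \<cdot>\<^bsub>A\<^esub> (P, B, restrict i (Obj M)) = \<zero>\<^bsub>Hom A P Q\<^esub>"
      by (simp add: A_simps qi cong: restrict_cong)
    show "(B, P, ?p) \<cdot>\<^bsub>A\<^esub> (Q, B, restrict j (Obj M)) = \<zero>\<^bsub>Hom A Q P\<^esub>"
      by (simp add: A_simps pj cong: restrict_cong)
    show "(P, B, restrict i (Obj M)) \<cdot>\<^bsub>A\<^esub> (B, P, ?p) \<oplus>\<^bsub>Hom A B B\<^esub> (Q, B, restrict j (Obj M)) \<cdot>\<^bsub>A\<^esub> (B, Q, ?q) = Id A B"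
      by (simp add: A_simps sum B(2) cong: restrict_cong)
  qed (simp_all only: in_hom_A_triple i' j' p' q' simp_thms)
  then show ?thesis by blast
qed

theorem abelian_A: "abelian_category R A"
proof (intro abelian_category.intro abelian_category_axioms.intro A.linear_category_axioms)
  show "\<exists>Z. is_zero_object A Z" by (rule zero_object_A)
  show "\<exists>B i j p q. is_biproduct A P Q B i j p q" if "P \<in> Obj A" "Q \<in> Obj A" for P Q
    using biproducts_A that by (simp add: Obj_A)
  show "\<exists>K k. is_kernel A P Q a K k" if a: "\<guillemotleft>a : P \<rightarrow>\<^bsub>A\<^esub> Q\<guillemotright>" for P Q a
  proof -
    obtain f where f: "a = (P, Q, f)" "mor P Q f" using a unfolding in_hom_A by blast
    show ?thesis
      by (rule pointwise_kernel_exists[OF f(2)]) (use pointwise_kernel[OF f(2)] f(1) in blast)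
  qed
  show "\<exists>K k. is_cokernel A P Q a K k" if a: "\<guillemotleft>a : P \<rightarrow>\<^bsub>A\<^esub> Q\<guillemotright>" for P Q a
  proof -
    obtain f where f: "a = (P, Q, f)" "mor P Q f" using a unfolding in_hom_A by blast
    show ?thesis
      by (rule pointwise_cokernel_exists[OF f(2)]) (use pointwise_cokernel[OF f(2)] f(1) in blast)
  qed
  show "\<exists>V g. is_kernel A Q V g P a" if mono: "is_mono A P Q a" for P Q a
  proof -
    obtain f where a: "a = (P, Q, f)" and f: "mor P Q f" using mono[unfolded is_mono_def in_hom_A, THEN conjunct1] by blast
    obtain V q where q: "mor Q V q" and
      coker: "\<And>X. X \<in> Obj M \<Longrightarrow> is_cokernel E (omap (fst P) X) (omap (fst Q) X) (f X) (omap (fst V) X) (q X)"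
      using pointwise_cokernel_exists[OF f] by blast
    have "is_kernel A Q V (Q, V, q) P (P, Q, f)"
      by (rule pointwise_kernel[OF q f mono_is_kernel_of_cokernel[OF mono_pointwise[OF mono[unfolded a]] coker]])
    then show ?thesis using a by blast
  qed
  show "\<exists>K k. is_cokernel A K P k Q a" if epi: "is_epi A P Q a" for P Q a
  proof -
    obtain f where a: "a = (P, Q, f)" and f: "mor P Q f" using epi[unfolded is_epi_def in_hom_A, THEN conjunct1] by blast
    obtain K k where k: "mor K P k" and
      ker: "\<And>X. X \<in> Obj M \<Longrightarrow> is_kernel E (omap (fst P) X) (omap (fst Q) X) (f X) (omap (fst K) X) (k X)"
      using pointwise_kernel_exists[OF f] by blast
    have "is_cokernel A K P (K, P, k) Q (P, Q, f)"
      by (rule pointwise_cokernel[OF k f epi_is_cokernel_of_kernel[OF epi_pointwise[OF epi[unfolded a]] ker]])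
    then show ?thesis using a by blast
  qed
qed

end

section \<open>Modules over monoidal functors\<close>

lemma tensor_left_simps [simp]:
  "omap (tensor_left C X) Y = X \<otimes>\<^sub>o\<^bsub>C\<^esub> Y" "amap (tensor_left C X) f = Id C X \<otimes>\<^sub>a\<^bsub>C\<^esub> f"
  by (simp_all add: tensor_left_def)

lemma tensor_right_simps [simp]:
  "omap (tensor_right C X) Y = Y \<otimes>\<^sub>o\<^bsub>C\<^esub> X" "amap (tensor_right C X) f = f \<otimes>\<^sub>a\<^bsub>C\<^esub> Id C X"
  by (simp_all add: tensor_right_def)

section \<open>Tensor functors, and structure maps as natural transformations\<close>

context monoidal_category
begin

lemma id_comp_id:
  "X \<in> Obj C \<Longrightarrow> Id C X \<cdot>\<^bsub>C\<^esub> Id C X = Id C X"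
  using left.comp_id_left[OF left.id_in_hom] .

lemma tensor_left_linear:
  assumes X: "X \<in> Obj C"
  shows "linear_functor R C C (tensor_left C X)"
proof
  note i = left.id_in_hom[OF X]
  show "omap (tensor_left C X) Y \<in> Obj C" if "Y \<in> Obj C" for Y using bi_obj[OF X that] by simp
  show "amap (tensor_left C X) (Id C Y) = Id C (omap (tensor_left C X) Y)" if "Y \<in> Obj C" for Y
    using bi_id[OF X that] by simp
  fix Y Z f assume f: "\<guillemotleft>f : Y \<rightarrow>\<^bsub>C\<^esub> Z\<guillemotright>"
  show "\<guillemotleft>amap (tensor_left C X) f : omap (tensor_left C X) Y \<rightarrow>\<^bsub>C\<^esub> omap (tensor_left C X) Z\<guillemotright>"
    using bi_in_hom[OF i f] by simp
  show "amap (tensor_left C X) (g \<cdot>\<^bsub>C\<^esub> f) = amap (tensor_left C X) g \<cdot>\<^bsub>C\<^esub> amap (tensor_left C X) f"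
    if "\<guillemotleft>g : Z \<rightarrow>\<^bsub>C\<^esub> W\<guillemotright>" for g W
    using bi_comp[OF i i f that] by (simp add: id_comp_id[OF X])
  show "amap (tensor_left C X) (f \<oplus>\<^bsub>Hom C Y Z\<^esub> g)
    = amap (tensor_left C X) f \<oplus>\<^bsub>Hom C (omap (tensor_left C X) Y) (omap (tensor_left C X) Z)\<^esub> amap (tensor_left C X) g"
    if "\<guillemotleft>g : Y \<rightarrow>\<^bsub>C\<^esub> Z\<guillemotright>" for g
    using bi_add_right[OF i f that] by simp
  show "amap (tensor_left C X) (c \<odot>\<^bsub>Hom C Y Z\<^esub> f)
    = c \<odot>\<^bsub>Hom C (omap (tensor_left C X) Y) (omap (tensor_left C X) Z)\<^esub> amap (tensor_left C X) f"
    if "c \<in> carrier R" for c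
    using bi_smult_right[OF that i f] by simp
qed

lemma tensor_right_linear:
  assumes X: "X \<in> Obj C"
  shows "linear_functor R C C (tensor_right C X)"
proof
  note i = left.id_in_hom[OF X]
  show "omap (tensor_right C X) Y \<in> Obj C" if "Y \<in> Obj C" for Y using bi_obj[OF that X] by simp
  show "amap (tensor_right C X) (Id C Y) = Id C (omap (tensor_right C X) Y)" if "Y \<in> Obj C" for Y
    using bi_id[OF that X] by simp
  fix Y Z f assume f: "\<guillemotleft>f : Y \<rightarrow>\<^bsub>C\<^esub> Z\<guillemotright>"
  show "\<guillemotleft>amap (tensor_right C X) f : omap (tensor_right C X) Y \<rightarrow>\<^bsub>C\<^esub> omap (tensor_right C X) Z\<guillemotright>"
    using bi_in_hom[OF f i] by simp
  show "amap (tensor_right C X) (g \<cdot>\<^bsub>C\<^esub> f) = amap (tensor_right C X) g \<cdot>\<^bsub>C\<^esub> amap (tensor_right C X) f"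
    if "\<guillemotleft>g : Z \<rightarrow>\<^bsub>C\<^esub> W\<guillemotright>" for g W
    using bi_comp[OF f that i i] by (simp add: id_comp_id[OF X])
  show "amap (tensor_right C X) (f \<oplus>\<^bsub>Hom C Y Z\<^esub> g)
    = amap (tensor_right C X) f \<oplus>\<^bsub>Hom C (omap (tensor_right C X) Y) (omap (tensor_right C X) Z)\<^esub> amap (tensor_right C X) g"
    if "\<guillemotleft>g : Y \<rightarrow>\<^bsub>C\<^esub> Z\<guillemotright>" for g
    using bi_add_left[OF f that i] by simp
  show "amap (tensor_right C X) (c \<odot>\<^bsub>Hom C Y Z\<^esub> f)
    = c \<odot>\<^bsub>Hom C (omap (tensor_right C X) Y) (omap (tensor_right C X) Z)\<^esub> amap (tensor_right C X) f"
    if "c \<in> carrier R" for c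
    using bi_smult_left[OF that f i] by simp
qed

text \<open>The interchange law in both orders. It gives naturality of the whiskered arrows below,
  and in the naturality law of a module it separates the factor that depends on the module from the
  one that does not.\<close>

lemma tensor_split:
  assumes f: "\<guillemotleft>f : X \<rightarrow>\<^bsub>C\<^esub> X'\<guillemotright>" and g: "\<guillemotleft>g : Y \<rightarrow>\<^bsub>C\<^esub> Y'\<guillemotright>"
  shows "(Id C X' \<otimes>\<^sub>a\<^bsub>C\<^esub> g) \<cdot>\<^bsub>C\<^esub> (f \<otimes>\<^sub>a\<^bsub>C\<^esub> Id C Y) = f \<otimes>\<^sub>a\<^bsub>C\<^esub> g"
    and "(f \<otimes>\<^sub>a\<^bsub>C\<^esub> Id C Y') \<cdot>\<^bsub>C\<^esub> (Id C X \<otimes>\<^sub>a\<^bsub>C\<^esub> g) = f \<otimes>\<^sub>a\<^bsub>C\<^esub> g"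
proof -
  note obj = left.in_hom_obj[OF f] left.in_hom_obj[OF g]
  show "(Id C X' \<otimes>\<^sub>a\<^bsub>C\<^esub> g) \<cdot>\<^bsub>C\<^esub> (f \<otimes>\<^sub>a\<^bsub>C\<^esub> Id C Y) = f \<otimes>\<^sub>a\<^bsub>C\<^esub> g"
    using bi_comp[OF f left.id_in_hom[OF obj(2)] left.id_in_hom[OF obj(3)] g]
    by (simp add: left.comp_id_left[OF f] left.comp_id_right[OF g])
  show "(f \<otimes>\<^sub>a\<^bsub>C\<^esub> Id C Y') \<cdot>\<^bsub>C\<^esub> (Id C X \<otimes>\<^sub>a\<^bsub>C\<^esub> g) = f \<otimes>\<^sub>a\<^bsub>C\<^esub> g"
    using bi_comp[OF left.id_in_hom[OF obj(1)] f g left.id_in_hom[OF obj(4)]]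
    by (simp add: left.comp_id_right[OF f] left.comp_id_left[OF g])
qed

text \<open>With \<open>f\<close> of the form \<open>lax_mult\<close>, \<open>lax_unit\<close> or
  \<open>amap F f\<close>, this is the transformation by which such an arrow enters
  \<open>derived_op_pre\<close>.\<close>

lemma tensor_left_natural:
  assumes f: "\<guillemotleft>f : X \<rightarrow>\<^bsub>C\<^esub> X'\<guillemotright>"
  shows "natural C C (tensor_left C X) (tensor_left C X') (\<lambda>Z. f \<otimes>\<^sub>a\<^bsub>C\<^esub> Id C Z)"
  unfolding natural_def using bi_in_hom[OF f left.id_in_hom] tensor_split[OF f] by auto

lemma tensor_right_natural:
  assumes f: "\<guillemotleft>f : X \<rightarrow>\<^bsub>C\<^esub> X'\<guillemotright>"
  shows "natural C C (tensor_right C X) (tensor_right C X') (\<lambda>Z. Id C Z \<otimes>\<^sub>a\<^bsub>C\<^esub> f)"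
  unfolding natural_def using bi_in_hom[OF left.id_in_hom f] tensor_split[OF _ f] by auto

lemma iso_in_hom: "is_iso C X Y f \<Longrightarrow> \<guillemotleft>f : X \<rightarrow>\<^bsub>C\<^esub> Y\<guillemotright>"
  by (simp add: is_iso_def)

text \<open>The free argument of the associator is the place of the module: the last one for left
  modules, the middle one for bimodules, the first one for right modules. Hence three
  versions.\<close>

lemma associator_natural_left:
  assumes X: "X \<in> Obj C" and Y: "Y \<in> Obj C"
  shows "natural C C (tensor_left C (X \<otimes>\<^sub>o\<^bsub>C\<^esub> Y)) (comp_ftor (tensor_left C X) (tensor_left C Y)) (associator C X Y)"
  using associator_natural[OF left.id_in_hom[OF X] left.id_in_hom[OF Y]] iso_in_hom[OF associator_iso[OF X Y]]
  by (simp add: natural_def bi_id[OF X Y])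

lemma associator_natural_middle:
  assumes X: "X \<in> Obj C" and Y: "Y \<in> Obj C"
  shows "natural C C (comp_ftor (tensor_right C Y) (tensor_left C X)) (comp_ftor (tensor_left C X) (tensor_right C Y))
    (\<lambda>Z. associator C X Z Y)"
  using associator_natural[OF left.id_in_hom[OF X] _ left.id_in_hom[OF Y]] iso_in_hom[OF associator_iso[OF X _ Y]]
  by (simp add: natural_def)

lemma associator_natural_right:
  assumes X: "X \<in> Obj C" and Y: "Y \<in> Obj C"
  shows "natural C C (comp_ftor (tensor_right C Y) (tensor_right C X)) (tensor_right C (X \<otimes>\<^sub>o\<^bsub>C\<^esub> Y))
    (\<lambda>Z. associator C Z X Y)"
  using associator_natural[OF _ left.id_in_hom[OF X] left.id_in_hom[OF Y]] iso_in_hom[OF associator_iso[OF _ X Y]]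
  by (simp add: natural_def bi_id[OF X Y])

text \<open>The unit of \<open>E\<close> need not be a value of \<open>F\<close> or
  \<open>G\<close>, so exactness of tensoring with such values does not cover it; the unitors
  compare these functors with the identity functor.\<close>

lemma tensor_unit_preserves_epis:
  "preserves_epis C C (tensor_left C (munit C))" "preserves_epis C C (tensor_right C (munit C))"
proof -
  let ?I = "\<lparr>omap = \<lambda>X. X, amap = \<lambda>f. f\<rparr>"
  have I: "preserves_epis C C ?I" by (simp add: preserves_epis_def)
  show "preserves_epis C C (tensor_left C (munit C))"
    by (rule preserves_epis_iso[OF tensor_left_linear[OF munit_obj] I, of "lunitor C"])
      (simp_all add: natural_def lunitor_iso lunitor_natural iso_in_hom)
  show "preserves_epis C C (tensor_right C (munit C))"
    by (rule preserves_epis_iso[OF tensor_right_linear[OF munit_obj] I, of "runitor C"])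
      (simp_all add: natural_def runitor_iso runitor_natural iso_in_hom)
qed

end

text \<open>The index set stays abstract and \<open>lop\<close> picks out the indices of the left
  multiplications. For bimodules the same \<open>J\<close> also contains the indices of the right
  multiplications.\<close>

locale left_operations =
  functor_operations R M E J src tgt T + ftor: monoidal_functor R C E F + mod: left_module_category R C M L
  for R :: "('r, 'm) ring_scheme" (structure)
    and C :: "('r, 'co, 'ca, 'z1) moncat_scheme"
    and E :: "('r, 'eo, 'ea, 'z2) moncat_scheme"
    and F :: "('co, 'ca, 'eo, 'ea, 'z3) lax_ftor_scheme"
    and M :: "('r, 'mo, 'ma, 'z4) lincat_scheme"
    and L :: "('co, 'ca, 'mo, 'ma, 'z5) lact_scheme"
    and J :: "'j set" and src tgt and T :: "'j \<Rightarrow> ('eo, 'ea, 'eo, 'ea) ftor" +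
  fixes lop :: "'co \<Rightarrow> 'mo \<Rightarrow> 'j"
  assumes lop: "\<lbrakk>A \<in> Obj C; X \<in> Obj M\<rbrakk> \<Longrightarrow> lop A X \<in> J \<and> src (lop A X) = X \<and>
    tgt (lop A X) = A \<triangleright>\<^sub>o\<^bsub>L\<^esub> X \<and> T (lop A X) = tensor_left E (omap F A)"
begin

definition left_equations :: "('mo, 'ma, 'eo, 'ea) ftor \<Rightarrow> ('j \<Rightarrow> 'ea) \<Rightarrow> bool" where
  "left_equations N n \<longleftrightarrow>
    (\<forall>f A A' h X X'. \<guillemotleft>f : A \<rightarrow>\<^bsub>C\<^esub> A'\<guillemotright> \<longrightarrow> \<guillemotleft>h : X \<rightarrow>\<^bsub>M\<^esub> X'\<guillemotright> \<longrightarrow>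
      n (lop A' X') \<cdot>\<^bsub>E\<^esub> (amap F f \<otimes>\<^sub>a\<^bsub>E\<^esub> amap N h) = amap N (f \<triangleright>\<^sub>a\<^bsub>L\<^esub> h) \<cdot>\<^bsub>E\<^esub> n (lop A X)) \<and>
    (\<forall>A B X. A \<in> Obj C \<longrightarrow> B \<in> Obj C \<longrightarrow> X \<in> Obj M \<longrightarrow>
      n (lop A (B \<triangleright>\<^sub>o\<^bsub>L\<^esub> X)) \<cdot>\<^bsub>E\<^esub> (Id E (omap F A) \<otimes>\<^sub>a\<^bsub>E\<^esub> n (lop B X))
            \<cdot>\<^bsub>E\<^esub> associator E (omap F A) (omap F B) (omap N X)
        = amap N (lassoc L A B X) \<cdot>\<^bsub>E\<^esub> n (lop (A \<otimes>\<^sub>o\<^bsub>C\<^esub> B) X) \<cdot>\<^bsub>E\<^esub> (lax_mult F A B \<otimes>\<^sub>a\<^bsub>E\<^esub> Id E (omap N X))) \<and>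
    (\<forall>X. X \<in> Obj M \<longrightarrow>
      amap N (lunit L X) \<cdot>\<^bsub>E\<^esub> n (lop (munit C) X) \<cdot>\<^bsub>E\<^esub> (lax_unit F \<otimes>\<^sub>a\<^bsub>E\<^esub> Id E (omap N X))
        = lunitor E (omap N X))"

lemma left_functor_module_iff:
  "left_functor_module R C E F M L N (\<lambda>A X. n (lop A X)) \<longleftrightarrow>
    linear_functor R M E N \<and>
    (\<forall>A \<in> Obj C. \<forall>X \<in> Obj M. \<guillemotleft>n (lop A X) : omap F A \<otimes>\<^sub>o\<^bsub>E\<^esub> omap N X \<rightarrow>\<^bsub>E\<^esub> omap N (A \<triangleright>\<^sub>o\<^bsub>L\<^esub> X)\<guillemotright>) \<and>
    left_equations N n"
  unfolding left_functor_module_def left_functor_module_axioms_def left_equations_def by blast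

text \<open>Each law equates two derived operations with a common source, so
  \<open>stable_eq\<close> applies. For naturality, associativity and unit law the source is the
  tensor functor of \<open>omap F A\<close>, of the tensor product of \<open>omap F A\<close> and
  \<open>omap F B\<close>, and of \<open>munit E\<close>.\<close>

lemma left_equations_stable: "stable left_equations"
proof -
  note [simp] = lop ftor.omap_obj ftor.source.munit_obj mod.action.bi_obj ftor.source.bi_obj
  have basic: "derived_op (tensor_left E (omap F A)) X (A \<triangleright>\<^sub>o\<^bsub>L\<^esub> X) (\<lambda>N n. n (lop A X))"
    if "A \<in> Obj C" "X \<in> Obj M" for A X
    using derived_op_basic[of "lop A X"] that by simp
  \<comment> \<open>Preservation of epis is known for the functors \<open>T j\<close>, so the tensor
    functor is reached through the index belonging to some object \<open>X\<close>.\<close>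
  have epi: "preserves_epis E E (tensor_left E (omap F A))" if "A \<in> Obj C" "X \<in> Obj M" for A X
    using T_epi[of "lop A X"] that by simp
  have nat: "stable (\<lambda>N n. n (lop A' X') \<cdot>\<^bsub>E\<^esub> (amap F f \<otimes>\<^sub>a\<^bsub>E\<^esub> amap N h) = amap N (f \<triangleright>\<^sub>a\<^bsub>L\<^esub> h) \<cdot>\<^bsub>E\<^esub> n (lop A X))"
    if f: "\<guillemotleft>f : A \<rightarrow>\<^bsub>C\<^esub> A'\<guillemotright>" and h: "\<guillemotleft>h : X \<rightarrow>\<^bsub>M\<^esub> X'\<guillemotright>" for f A A' h X X'
  proof (rule stable_eq)
    have obj [simp]: "A \<in> Obj C" "A' \<in> Obj C" "X \<in> Obj M" "X' \<in> Obj M"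
      using f h by (auto simp: in_hom_def)
    note Ff = ftor.amap_in_hom[OF f]
    show "derived_op (tensor_left E (omap F A)) X (A' \<triangleright>\<^sub>o\<^bsub>L\<^esub> X') (\<lambda>N n. amap N (f \<triangleright>\<^sub>a\<^bsub>L\<^esub> h) \<cdot>\<^bsub>E\<^esub> n (lop A X))"
      by (rule derived_op_post[OF basic mod.action.bi_in_hom[OF f h]]) simp_all
    \<comment> \<open>The arrow \<open>amap F f\<close> tensored with \<open>amap N h\<close> is
      split in two: the part with \<open>amap N h\<close> is handled by
      \<open>derived_op_basic_arrow\<close>, the part with \<open>amap F f\<close> is a
      transformation of tensor functors for \<open>derived_op_pre\<close>.\<close>
    have "derived_op (tensor_left E (omap F A')) X (A' \<triangleright>\<^sub>o\<^bsub>L\<^esub> X')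
        (\<lambda>N n. n (lop A' X') \<cdot>\<^bsub>E\<^esub> (Id E (omap F A') \<otimes>\<^sub>a\<^bsub>E\<^esub> amap N h))"
      using derived_op_basic_arrow[of "lop A' X'" h X] h by simp
    note derived_op_pre[OF this ftor.target.tensor_left_linear ftor.target.tensor_left_natural[OF Ff]]
    then show "derived_op (tensor_left E (omap F A)) X (A' \<triangleright>\<^sub>o\<^bsub>L\<^esub> X')
        (\<lambda>N n. n (lop A' X') \<cdot>\<^bsub>E\<^esub> (amap F f \<otimes>\<^sub>a\<^bsub>E\<^esub> amap N h))"
    proof (rule derived_op_cong)
      fix N n assume N: "has_operations N n"
      interpret N: linear_functor R M E N by (rule has_operations_linear[OF N])
      note Nh = N.amap_in_hom[OF h]
      have n: "\<guillemotleft>n (lop A' X') : omap F A' \<otimes>\<^sub>o\<^bsub>E\<^esub> omap N X' \<rightarrow>\<^bsub>E\<^esub> omap N (A' \<triangleright>\<^sub>o\<^bsub>L\<^esub> X')\<guillemotright>"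
        using has_operations_in_hom[OF N, of "lop A' X'"] by simp
      show "n (lop A' X') \<cdot>\<^bsub>E\<^esub> (Id E (omap F A') \<otimes>\<^sub>a\<^bsub>E\<^esub> amap N h) \<cdot>\<^bsub>E\<^esub> (amap F f \<otimes>\<^sub>a\<^bsub>E\<^esub> Id E (omap N X))
          = n (lop A' X') \<cdot>\<^bsub>E\<^esub> (amap F f \<otimes>\<^sub>a\<^bsub>E\<^esub> amap N h)"
        using comp_assoc[OF ftor.target.bi_in_hom[OF Ff id_in_hom[of "omap N X"]]
            ftor.target.bi_in_hom[OF id_in_hom[of "omap F A'"] Nh] n]
        by (simp add: ftor.target.tensor_split[OF Ff Nh] N.omap_obj)
    qed simp
    show "preserves_epis E E (tensor_left E (omap F A))" by (rule epi[of A X]) simp_all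
  qed
  have assoc: "stable (\<lambda>N n. n (lop A (B \<triangleright>\<^sub>o\<^bsub>L\<^esub> X)) \<cdot>\<^bsub>E\<^esub> (Id E (omap F A) \<otimes>\<^sub>a\<^bsub>E\<^esub> n (lop B X))
            \<cdot>\<^bsub>E\<^esub> associator E (omap F A) (omap F B) (omap N X)
        = amap N (lassoc L A B X) \<cdot>\<^bsub>E\<^esub> n (lop (A \<otimes>\<^sub>o\<^bsub>C\<^esub> B) X) \<cdot>\<^bsub>E\<^esub> (lax_mult F A B \<otimes>\<^sub>a\<^bsub>E\<^esub> Id E (omap N X)))"
    if [simp]: "A \<in> Obj C" "B \<in> Obj C" "X \<in> Obj M" for A B X
  proof (rule stable_eq)
    let ?S = "tensor_left E (omap F A \<otimes>\<^sub>o\<^bsub>E\<^esub> omap F B)"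
    let ?S' = "comp_ftor (tensor_left E (omap F A)) (tensor_left E (omap F B))"
    have S: "linear_functor R E E ?S"
      by (rule ftor.target.tensor_left_linear) (simp add: ftor.target.bi_obj)
    have t: "natural E E ?S ?S' (associator E (omap F A) (omap F B))"
      by (rule ftor.target.associator_natural_left) simp_all
    have "derived_op ?S' X (A \<triangleright>\<^sub>o\<^bsub>L\<^esub> (B \<triangleright>\<^sub>o\<^bsub>L\<^esub> X))
        (\<lambda>N n. n (lop A (B \<triangleright>\<^sub>o\<^bsub>L\<^esub> X)) \<cdot>\<^bsub>E\<^esub> (Id E (omap F A) \<otimes>\<^sub>a\<^bsub>E\<^esub> n (lop B X)))"
      using derived_op_comp[of "tensor_left E (omap F B)" X "lop A (B \<triangleright>\<^sub>o\<^bsub>L\<^esub> X)"] basic[of B X] by simp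
    from derived_op_pre[OF this S t]
    show "derived_op ?S X (A \<triangleright>\<^sub>o\<^bsub>L\<^esub> (B \<triangleright>\<^sub>o\<^bsub>L\<^esub> X))
        (\<lambda>N n. n (lop A (B \<triangleright>\<^sub>o\<^bsub>L\<^esub> X)) \<cdot>\<^bsub>E\<^esub> (Id E (omap F A) \<otimes>\<^sub>a\<^bsub>E\<^esub> n (lop B X))
            \<cdot>\<^bsub>E\<^esub> associator E (omap F A) (omap F B) (omap N X))" .
    have "\<guillemotleft>lassoc L A B X : (A \<otimes>\<^sub>o\<^bsub>C\<^esub> B) \<triangleright>\<^sub>o\<^bsub>L\<^esub> X \<rightarrow>\<^bsub>M\<^esub> A \<triangleright>\<^sub>o\<^bsub>L\<^esub> (B \<triangleright>\<^sub>o\<^bsub>L\<^esub> X)\<guillemotright>"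
      using mod.lassoc_iso[of A B X] by (simp add: is_iso_def)
    note derived_op_post[OF basic this]
    then show "derived_op ?S X (A \<triangleright>\<^sub>o\<^bsub>L\<^esub> (B \<triangleright>\<^sub>o\<^bsub>L\<^esub> X))
        (\<lambda>N n. amap N (lassoc L A B X) \<cdot>\<^bsub>E\<^esub> n (lop (A \<otimes>\<^sub>o\<^bsub>C\<^esub> B) X) \<cdot>\<^bsub>E\<^esub> (lax_mult F A B \<otimes>\<^sub>a\<^bsub>E\<^esub> Id E (omap N X)))"
      by (rule derived_op_pre[OF _ S ftor.target.tensor_left_natural]) (simp_all add: ftor.lax_mult_in_hom)
    \<comment> \<open>The tensor product of \<open>omap F A\<close> and \<open>omap F B\<close> need
      not be a value of \<open>F\<close>, so the property is transported from \<open>?S'\<close>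
      along the associator.\<close>
    show "preserves_epis E E ?S"
      by (rule preserves_epis_iso[OF S preserves_epis_comp[OF epi[of B X] epi[of A X]] t])
        (simp_all add: ftor.target.associator_iso)
  qed
  have unit: "stable (\<lambda>N n. amap N (lunit L X) \<cdot>\<^bsub>E\<^esub> n (lop (munit C) X) \<cdot>\<^bsub>E\<^esub> (lax_unit F \<otimes>\<^sub>a\<^bsub>E\<^esub> Id E (omap N X))
        = lunitor E (omap N X))" if [simp]: "X \<in> Obj M" for X
  proof (rule stable_eq)
    let ?S = "tensor_left E (munit E)"
    have S: "linear_functor R E E ?S"
      by (rule ftor.target.tensor_left_linear[OF ftor.target.munit_obj])
    show "derived_op ?S X X (\<lambda>N n. lunitor E (omap N X))"
      by (rule derived_op_transformation[OF S])
        (simp_all add: ftor.target.lunitor_natural ftor.target.iso_in_hom ftor.target.lunitor_iso)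
    have "\<guillemotleft>lunit L X : munit C \<triangleright>\<^sub>o\<^bsub>L\<^esub> X \<rightarrow>\<^bsub>M\<^esub> X\<guillemotright>"
      using mod.lunit_iso[of X] by (simp add: is_iso_def)
    note derived_op_post[OF basic this]
    then show "derived_op ?S X X
        (\<lambda>N n. amap N (lunit L X) \<cdot>\<^bsub>E\<^esub> n (lop (munit C) X) \<cdot>\<^bsub>E\<^esub> (lax_unit F \<otimes>\<^sub>a\<^bsub>E\<^esub> Id E (omap N X)))"
      by (rule derived_op_pre[OF _ S ftor.target.tensor_left_natural]) (simp_all add: ftor.lax_unit_in_hom)
    show "preserves_epis E E ?S" by (rule ftor.target.tensor_unit_preserves_epis)
  qed
  show ?thesis
    unfolding left_equations_def using nat assoc unit by (intro stable_conj stable_all stable_imp)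
qed

end

locale right_operations =
  functor_operations R M E J src tgt T + ftor: monoidal_functor R D E G + mod: right_module_category R D M K
  for R :: "('r, 'm) ring_scheme" (structure)
    and D :: "('r, 'do, 'da, 'z1) moncat_scheme"
    and E :: "('r, 'eo, 'ea, 'z2) moncat_scheme"
    and G :: "('do, 'da, 'eo, 'ea, 'z3) lax_ftor_scheme"
    and M :: "('r, 'mo, 'ma, 'z4) lincat_scheme"
    and K :: "('do, 'da, 'mo, 'ma, 'z5) ract_scheme"
    and J :: "'j set" and src tgt and T :: "'j \<Rightarrow> ('eo, 'ea, 'eo, 'ea) ftor" +
  fixes rop :: "'mo \<Rightarrow> 'do \<Rightarrow> 'j"
  assumes rop: "\<lbrakk>X \<in> Obj M; A \<in> Obj D\<rbrakk> \<Longrightarrow> rop X A \<in> J \<and> src (rop X A) = X \<and>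
    tgt (rop X A) = X \<triangleleft>\<^sub>o\<^bsub>K\<^esub> A \<and> T (rop X A) = tensor_right E (omap G A)"
begin

definition right_equations :: "('mo, 'ma, 'eo, 'ea) ftor \<Rightarrow> ('j \<Rightarrow> 'ea) \<Rightarrow> bool" where
  "right_equations N n \<longleftrightarrow>
    (\<forall>h X X' f A A'. \<guillemotleft>h : X \<rightarrow>\<^bsub>M\<^esub> X'\<guillemotright> \<longrightarrow> \<guillemotleft>f : A \<rightarrow>\<^bsub>D\<^esub> A'\<guillemotright> \<longrightarrow>
      n (rop X' A') \<cdot>\<^bsub>E\<^esub> (amap N h \<otimes>\<^sub>a\<^bsub>E\<^esub> amap G f) = amap N (h \<triangleleft>\<^sub>a\<^bsub>K\<^esub> f) \<cdot>\<^bsub>E\<^esub> n (rop X A)) \<and>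
    (\<forall>X A B. X \<in> Obj M \<longrightarrow> A \<in> Obj D \<longrightarrow> B \<in> Obj D \<longrightarrow>
      amap N (rassoc K X A B) \<cdot>\<^bsub>E\<^esub> n (rop (X \<triangleleft>\<^sub>o\<^bsub>K\<^esub> A) B) \<cdot>\<^bsub>E\<^esub> (n (rop X A) \<otimes>\<^sub>a\<^bsub>E\<^esub> Id E (omap G B))
        = n (rop X (A \<otimes>\<^sub>o\<^bsub>D\<^esub> B)) \<cdot>\<^bsub>E\<^esub> (Id E (omap N X) \<otimes>\<^sub>a\<^bsub>E\<^esub> lax_mult G A B)
            \<cdot>\<^bsub>E\<^esub> associator E (omap N X) (omap G A) (omap G B)) \<and>
    (\<forall>X. X \<in> Obj M \<longrightarrow>
      amap N (runit K X) \<cdot>\<^bsub>E\<^esub> n (rop X (munit D)) \<cdot>\<^bsub>E\<^esub> (Id E (omap N X) \<otimes>\<^sub>a\<^bsub>E\<^esub> lax_unit G)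
        = runitor E (omap N X))"

lemma right_functor_module_iff:
  "right_functor_module R D E G M K N (\<lambda>X A. n (rop X A)) \<longleftrightarrow>
    linear_functor R M E N \<and>
    (\<forall>X \<in> Obj M. \<forall>A \<in> Obj D. \<guillemotleft>n (rop X A) : omap N X \<otimes>\<^sub>o\<^bsub>E\<^esub> omap G A \<rightarrow>\<^bsub>E\<^esub> omap N (X \<triangleleft>\<^sub>o\<^bsub>K\<^esub> A)\<guillemotright>) \<and>
    right_equations N n"
  unfolding right_functor_module_def right_functor_module_axioms_def right_equations_def by blast

text \<open>Unlike for left modules, the associativity law starts at tensoring with
  \<open>omap G A\<close> and then with \<open>omap G B\<close>. This already is a composite of
  given functors, and the associator occurs only in building the right-hand side.\<close>

lemma right_equations_stable: "stable right_equations"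
proof -
  note [simp] = rop ftor.omap_obj ftor.source.munit_obj mod.action.bi_obj ftor.source.bi_obj
  have basic: "derived_op (tensor_right E (omap G A)) X (X \<triangleleft>\<^sub>o\<^bsub>K\<^esub> A) (\<lambda>N n. n (rop X A))"
    if "X \<in> Obj M" "A \<in> Obj D" for A X
    using derived_op_basic[of "rop X A"] that by simp
  have epi: "preserves_epis E E (tensor_right E (omap G A))" if "X \<in> Obj M" "A \<in> Obj D" for A X
    using T_epi[of "rop X A"] that by simp
  have nat: "stable (\<lambda>N n. n (rop X' A') \<cdot>\<^bsub>E\<^esub> (amap N h \<otimes>\<^sub>a\<^bsub>E\<^esub> amap G f) = amap N (h \<triangleleft>\<^sub>a\<^bsub>K\<^esub> f) \<cdot>\<^bsub>E\<^esub> n (rop X A))"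
    if h: "\<guillemotleft>h : X \<rightarrow>\<^bsub>M\<^esub> X'\<guillemotright>" and f: "\<guillemotleft>f : A \<rightarrow>\<^bsub>D\<^esub> A'\<guillemotright>" for f A A' h X X'
  proof (rule stable_eq)
    have obj [simp]: "A \<in> Obj D" "A' \<in> Obj D" "X \<in> Obj M" "X' \<in> Obj M"
      using f h by (auto simp: in_hom_def)
    note Gf = ftor.amap_in_hom[OF f]
    show "derived_op (tensor_right E (omap G A)) X (X' \<triangleleft>\<^sub>o\<^bsub>K\<^esub> A') (\<lambda>N n. amap N (h \<triangleleft>\<^sub>a\<^bsub>K\<^esub> f) \<cdot>\<^bsub>E\<^esub> n (rop X A))"
      by (rule derived_op_post[OF basic mod.action.bi_in_hom[OF h f]]) simp_all
    have "derived_op (tensor_right E (omap G A')) X (X' \<triangleleft>\<^sub>o\<^bsub>K\<^esub> A')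
        (\<lambda>N n. n (rop X' A') \<cdot>\<^bsub>E\<^esub> (amap N h \<otimes>\<^sub>a\<^bsub>E\<^esub> Id E (omap G A')))"
      using derived_op_basic_arrow[of "rop X' A'" h X] h by simp
    note derived_op_pre[OF this ftor.target.tensor_right_linear ftor.target.tensor_right_natural[OF Gf]]
    then show "derived_op (tensor_right E (omap G A)) X (X' \<triangleleft>\<^sub>o\<^bsub>K\<^esub> A')
        (\<lambda>N n. n (rop X' A') \<cdot>\<^bsub>E\<^esub> (amap N h \<otimes>\<^sub>a\<^bsub>E\<^esub> amap G f))"
    proof (rule derived_op_cong)
      fix N n assume N: "has_operations N n"
      interpret N: linear_functor R M E N by (rule has_operations_linear[OF N])
      note Nh = N.amap_in_hom[OF h]
      have n: "\<guillemotleft>n (rop X' A') : omap N X' \<otimes>\<^sub>o\<^bsub>E\<^esub> omap G A' \<rightarrow>\<^bsub>E\<^esub> omap N (X' \<triangleleft>\<^sub>o\<^bsub>K\<^esub> A')\<guillemotright>"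
        using has_operations_in_hom[OF N, of "rop X' A'"] by simp
      show "n (rop X' A') \<cdot>\<^bsub>E\<^esub> (amap N h \<otimes>\<^sub>a\<^bsub>E\<^esub> Id E (omap G A')) \<cdot>\<^bsub>E\<^esub> (Id E (omap N X) \<otimes>\<^sub>a\<^bsub>E\<^esub> amap G f)
          = n (rop X' A') \<cdot>\<^bsub>E\<^esub> (amap N h \<otimes>\<^sub>a\<^bsub>E\<^esub> amap G f)"
        using comp_assoc[OF ftor.target.bi_in_hom[OF id_in_hom[of "omap N X"] Gf]
            ftor.target.bi_in_hom[OF Nh id_in_hom[of "omap G A'"]] n]
        by (simp add: ftor.target.tensor_split[OF Nh Gf] N.omap_obj)
    qed simp
    show "preserves_epis E E (tensor_right E (omap G A))" by (rule epi[of X A]) simp_all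
  qed
  have assoc: "stable (\<lambda>N n. amap N (rassoc K X A B) \<cdot>\<^bsub>E\<^esub> n (rop (X \<triangleleft>\<^sub>o\<^bsub>K\<^esub> A) B)
            \<cdot>\<^bsub>E\<^esub> (n (rop X A) \<otimes>\<^sub>a\<^bsub>E\<^esub> Id E (omap G B))
        = n (rop X (A \<otimes>\<^sub>o\<^bsub>D\<^esub> B)) \<cdot>\<^bsub>E\<^esub> (Id E (omap N X) \<otimes>\<^sub>a\<^bsub>E\<^esub> lax_mult G A B)
            \<cdot>\<^bsub>E\<^esub> associator E (omap N X) (omap G A) (omap G B))"
    if [simp]: "X \<in> Obj M" "A \<in> Obj D" "B \<in> Obj D" for A B X
  proof (rule stable_eq)
    let ?S = "comp_ftor (tensor_right E (omap G B)) (tensor_right E (omap G A))"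
    have S: "linear_functor R E E ?S"
      by (intro linear_functor_comp[of R E E _ E] ftor.target.tensor_right_linear) simp_all
    have S': "linear_functor R E E (tensor_right E (omap G A \<otimes>\<^sub>o\<^bsub>E\<^esub> omap G B))"
      by (rule ftor.target.tensor_right_linear) (simp add: ftor.target.bi_obj)
    have "\<guillemotleft>rassoc K X A B : (X \<triangleleft>\<^sub>o\<^bsub>K\<^esub> A) \<triangleleft>\<^sub>o\<^bsub>K\<^esub> B \<rightarrow>\<^bsub>M\<^esub> X \<triangleleft>\<^sub>o\<^bsub>K\<^esub> (A \<otimes>\<^sub>o\<^bsub>D\<^esub> B)\<guillemotright>"
      using mod.rassoc_iso[of X A B] by (simp add: is_iso_def)
    then show "derived_op ?S X (X \<triangleleft>\<^sub>o\<^bsub>K\<^esub> (A \<otimes>\<^sub>o\<^bsub>D\<^esub> B)) (\<lambda>N n. amap N (rassoc K X A B) \<cdot>\<^bsub>E\<^esub> n (rop (X \<triangleleft>\<^sub>o\<^bsub>K\<^esub> A) B)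
            \<cdot>\<^bsub>E\<^esub> (n (rop X A) \<otimes>\<^sub>a\<^bsub>E\<^esub> Id E (omap G B)))"
      using derived_op_post_comp[of "tensor_right E (omap G A)" X "rop (X \<triangleleft>\<^sub>o\<^bsub>K\<^esub> A) B"] basic[of X A] by simp
    \<comment> \<open>The right-hand side arises by two changes of source: first along
      \<open>lax_mult\<close>, to tensoring with the product of \<open>omap G A\<close> and
      \<open>omap G B\<close>, then along the associator, to \<open>?S\<close>.\<close>
    have "derived_op (tensor_right E (omap G A \<otimes>\<^sub>o\<^bsub>E\<^esub> omap G B)) X (X \<triangleleft>\<^sub>o\<^bsub>K\<^esub> (A \<otimes>\<^sub>o\<^bsub>D\<^esub> B))
        (\<lambda>N n. n (rop X (A \<otimes>\<^sub>o\<^bsub>D\<^esub> B)) \<cdot>\<^bsub>E\<^esub> (Id E (omap N X) \<otimes>\<^sub>a\<^bsub>E\<^esub> lax_mult G A B))"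
      by (rule derived_op_pre[OF basic S' ftor.target.tensor_right_natural]) (simp_all add: ftor.lax_mult_in_hom)
    from derived_op_pre[OF this S ftor.target.associator_natural_right]
    show "derived_op ?S X (X \<triangleleft>\<^sub>o\<^bsub>K\<^esub> (A \<otimes>\<^sub>o\<^bsub>D\<^esub> B))
        (\<lambda>N n. n (rop X (A \<otimes>\<^sub>o\<^bsub>D\<^esub> B)) \<cdot>\<^bsub>E\<^esub> (Id E (omap N X) \<otimes>\<^sub>a\<^bsub>E\<^esub> lax_mult G A B)
            \<cdot>\<^bsub>E\<^esub> associator E (omap N X) (omap G A) (omap G B))" by simp
    show "preserves_epis E E ?S" by (rule preserves_epis_comp[OF epi[of X A] epi[of X B]]) simp_all
  qed
  have unit: "stable (\<lambda>N n. amap N (runit K X) \<cdot>\<^bsub>E\<^esub> n (rop X (munit D)) \<cdot>\<^bsub>E\<^esub> (Id E (omap N X) \<otimes>\<^sub>a\<^bsub>E\<^esub> lax_unit G)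
        = runitor E (omap N X))" if [simp]: "X \<in> Obj M" for X
  proof (rule stable_eq)
    let ?S = "tensor_right E (munit E)"
    have S: "linear_functor R E E ?S"
      by (rule ftor.target.tensor_right_linear[OF ftor.target.munit_obj])
    show "derived_op ?S X X (\<lambda>N n. runitor E (omap N X))"
      by (rule derived_op_transformation[OF S])
        (simp_all add: ftor.target.runitor_natural ftor.target.iso_in_hom ftor.target.runitor_iso)
    have "\<guillemotleft>runit K X : X \<triangleleft>\<^sub>o\<^bsub>K\<^esub> munit D \<rightarrow>\<^bsub>M\<^esub> X\<guillemotright>"
      using mod.runit_iso[of X] by (simp add: is_iso_def)
    note derived_op_post[OF basic this]
    then show "derived_op ?S X X
        (\<lambda>N n. amap N (runit K X) \<cdot>\<^bsub>E\<^esub> n (rop X (munit D)) \<cdot>\<^bsub>E\<^esub> (Id E (omap N X) \<otimes>\<^sub>a\<^bsub>E\<^esub> lax_unit G))"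
      by (rule derived_op_pre[OF _ S ftor.target.tensor_right_natural]) (simp_all add: ftor.lax_unit_in_hom)
    show "preserves_epis E E ?S" by (rule ftor.target.tensor_unit_preserves_epis)
  qed
  show ?thesis
    unfolding right_equations_def using nat assoc unit by (intro stable_conj stable_all stable_imp)
qed

end

text \<open>Both halves refer to one index set and one family of functors, so that
  \<open>stable\<close> and \<open>derived_op\<close> mean the same in both and their stability
  results can be combined.\<close>

locale bimodule_operations =
  left: left_operations R C E F M L J src tgt T lop + right: right_operations R D E G M K J src tgt T rop +
  mod: bimodule_category R C D M L K am
  for R :: "('r, 'm) ring_scheme" (structure)
    and C :: "('r, 'co, 'ca, 'z1) moncat_scheme"
    and D :: "('r, 'do, 'da, 'z2) moncat_scheme"
    and E :: "('r, 'eo, 'ea, 'z3) moncat_scheme"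
    and F :: "('co, 'ca, 'eo, 'ea, 'z4) lax_ftor_scheme"
    and G :: "('do, 'da, 'eo, 'ea, 'z5) lax_ftor_scheme"
    and M :: "('r, 'mo, 'ma, 'z6) lincat_scheme"
    and L :: "('co, 'ca, 'mo, 'ma, 'z7) lact_scheme"
    and K :: "('do, 'da, 'mo, 'ma, 'z8) ract_scheme"
    and am :: "'co \<Rightarrow> 'mo \<Rightarrow> 'do \<Rightarrow> 'ma"
    and J :: "'j set" and src tgt and T :: "'j \<Rightarrow> ('eo, 'ea, 'eo, 'ea) ftor" and lop rop
begin

definition compatible :: "('mo, 'ma, 'eo, 'ea) ftor \<Rightarrow> ('j \<Rightarrow> 'ea) \<Rightarrow> bool" where
  "compatible N n \<longleftrightarrow>
    (\<forall>A X B. A \<in> Obj C \<longrightarrow> X \<in> Obj M \<longrightarrow> B \<in> Obj D \<longrightarrow>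
      amap N (am A X B) \<cdot>\<^bsub>E\<^esub> n (rop (A \<triangleright>\<^sub>o\<^bsub>L\<^esub> X) B) \<cdot>\<^bsub>E\<^esub> (n (lop A X) \<otimes>\<^sub>a\<^bsub>E\<^esub> Id E (omap G B))
        = n (lop A (X \<triangleleft>\<^sub>o\<^bsub>K\<^esub> B)) \<cdot>\<^bsub>E\<^esub> (Id E (omap F A) \<otimes>\<^sub>a\<^bsub>E\<^esub> n (rop X B))
            \<cdot>\<^bsub>E\<^esub> associator E (omap F A) (omap N X) (omap G B))"

lemma functor_bimodule_iff:
  "functor_bimodule R C D E F G M L K am N (\<lambda>A X. n (lop A X)) (\<lambda>X A. n (rop X A)) \<longleftrightarrow>
    left_functor_module R C E F M L N (\<lambda>A X. n (lop A X)) \<and>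
    right_functor_module R D E G M K N (\<lambda>X A. n (rop X A)) \<and> compatible N n"
  unfolding functor_bimodule_def functor_bimodule_axioms_def compatible_def by blast

text \<open>Both sides start at tensoring with \<open>omap F A\<close> on the left and then with
  \<open>omap G B\<close> on the right, a composite of functors \<open>T j\<close>. One side
  multiplies from the left first; the other reassociates and multiplies from the right
  first.\<close>

lemma compatible_stable: "left.stable compatible"
  unfolding compatible_def
proof (intro left.stable_all left.stable_imp left.stable_eq)
  note [simp] = left.lop right.rop left.ftor.omap_obj right.ftor.omap_obj
    left.mod.action.bi_obj right.mod.action.bi_obj
  fix A X B
  assume [simp]: "A \<in> Obj C" "X \<in> Obj M" "B \<in> Obj D"
  let ?S = "comp_ftor (tensor_right E (omap G B)) (tensor_left E (omap F A))"
  have S: "linear_functor R E E ?S"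
    by (intro linear_functor_comp[of R E E _ E] left.ftor.target.tensor_left_linear
        left.ftor.target.tensor_right_linear) simp_all
  have "\<guillemotleft>am A X B : (A \<triangleright>\<^sub>o\<^bsub>L\<^esub> X) \<triangleleft>\<^sub>o\<^bsub>K\<^esub> B \<rightarrow>\<^bsub>M\<^esub> A \<triangleright>\<^sub>o\<^bsub>L\<^esub> (X \<triangleleft>\<^sub>o\<^bsub>K\<^esub> B)\<guillemotright>"
    using mod.am_iso[of A X B] by (simp add: is_iso_def)
  then show "left.derived_op ?S X (A \<triangleright>\<^sub>o\<^bsub>L\<^esub> (X \<triangleleft>\<^sub>o\<^bsub>K\<^esub> B))
      (\<lambda>N n. amap N (am A X B) \<cdot>\<^bsub>E\<^esub> n (rop (A \<triangleright>\<^sub>o\<^bsub>L\<^esub> X) B) \<cdot>\<^bsub>E\<^esub> (n (lop A X) \<otimes>\<^sub>a\<^bsub>E\<^esub> Id E (omap G B)))"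
    using left.derived_op_post_comp[of "tensor_left E (omap F A)" X "rop (A \<triangleright>\<^sub>o\<^bsub>L\<^esub> X) B"]
      left.derived_op_basic[of "lop A X"] by simp
  \<comment> \<open>With the right multiplication inside, the source has the two tensor functors in
    the opposite order; the associator, natural in its middle argument, changes it to
    \<open>?S\<close>.\<close>
  have "left.derived_op (comp_ftor (tensor_left E (omap F A)) (tensor_right E (omap G B))) X
      (A \<triangleright>\<^sub>o\<^bsub>L\<^esub> (X \<triangleleft>\<^sub>o\<^bsub>K\<^esub> B)) (\<lambda>N n. n (lop A (X \<triangleleft>\<^sub>o\<^bsub>K\<^esub> B)) \<cdot>\<^bsub>E\<^esub> (Id E (omap F A) \<otimes>\<^sub>a\<^bsub>E\<^esub> n (rop X B)))"
    using left.derived_op_comp[of "tensor_right E (omap G B)" X "lop A (X \<triangleleft>\<^sub>o\<^bsub>K\<^esub> B)"]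
      left.derived_op_basic[of "rop X B"] by simp
  from left.derived_op_pre[OF this S left.ftor.target.associator_natural_middle]
  show "left.derived_op ?S X (A \<triangleright>\<^sub>o\<^bsub>L\<^esub> (X \<triangleleft>\<^sub>o\<^bsub>K\<^esub> B))
      (\<lambda>N n. n (lop A (X \<triangleleft>\<^sub>o\<^bsub>K\<^esub> B)) \<cdot>\<^bsub>E\<^esub> (Id E (omap F A) \<otimes>\<^sub>a\<^bsub>E\<^esub> n (rop X B))
            \<cdot>\<^bsub>E\<^esub> associator E (omap F A) (omap N X) (omap G B))" by simp
  show "preserves_epis E E ?S"
    using preserves_epis_comp left.T_epi[of "lop A X"] left.T_epi[of "rop X B"] by simp
qed

end

section \<open>The three categories of modules\<close>

theorem abelian_left_modules:
  assumes E: "abelian_category R E" and F: "monoidal_functor R C E F"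
    and L: "left_module_category R C M L"
    and ex: "\<forall>A \<in> Obj C. exact_functor E E (tensor_left E (omap F A))"
  shows "abelian_category R (left_modules R C E F M L)"
proof -
  interpret E: abelian_category R E by fact
  interpret F: monoidal_functor R C E F by fact
  interpret L: left_module_category R C M L by fact
  \<comment> \<open>The index of a multiplication is the pair of objects at which the action is
    formed, so a curried \<open>\<mu>\<close> is a family over the index set after
    uncurrying.\<close>
  interpret left_operations R C E F M L "Obj C \<times> Obj M" snd "\<lambda>(A, X). A \<triangleright>\<^sub>o\<^bsub>L\<^esub> X"
    "\<lambda>(A, X). tensor_left E (omap F A)" Pair
  proof (intro left_operations.intro functor_operations.intro functor_operations_axioms.intro
      left_operations_axioms.intro L.action.right.linear_category_axioms E F L)
    fix j assume j: "j \<in> Obj C \<times> Obj M"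
    then obtain A X where AX: "j = (A, X)" "A \<in> Obj C" "X \<in> Obj M" by blast
    note FA = F.omap_obj[OF AX(2)]
    show "snd j \<in> Obj M" "(case j of (A, X) \<Rightarrow> A \<triangleright>\<^sub>o\<^bsub>L\<^esub> X) \<in> Obj M"
      using AX L.action.bi_obj by simp_all
    show lin: "linear_functor R E E (case j of (A, X) \<Rightarrow> tensor_left E (omap F A))"
      using F.target.tensor_left_linear[OF FA] AX(1) by simp
    \<comment> \<open>The exactness hypothesis enters here, in the form of right exactness of the
      functors \<open>T j\<close>.\<close>
    show "is_cokernel E (omap (case j of (A, X) \<Rightarrow> tensor_left E (omap F A)) Y)
        (omap (case j of (A, X) \<Rightarrow> tensor_left E (omap F A)) Z)
        (amap (case j of (A, X) \<Rightarrow> tensor_left E (omap F A)) f)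
        (omap (case j of (A, X) \<Rightarrow> tensor_left E (omap F A)) Q)
        (amap (case j of (A, X) \<Rightarrow> tensor_left E (omap F A)) q)"
      if "is_cokernel E Y Z f Q q" for Y Z f Q q
      using E.exact_preserves_cokernel[OF E lin _ that] ex AX by simp
  qed auto
  let ?ext = "{\<mu>. case_prod \<mu> \<in> extensional (Obj C \<times> Obj M)}"
  interpret alg: functor_algebras R M E "Obj C \<times> Obj M" snd "\<lambda>(A, X). A \<triangleright>\<^sub>o\<^bsub>L\<^esub> X"
    "\<lambda>(A, X). tensor_left E (omap F A)" left_equations case_prod ?ext
  proof
    show "stable left_equations" by (rule left_equations_stable)
    \<comment> \<open>The code of a family \<open>n\<close> is its curried restriction: it agrees
      with \<open>n\<close> on the index set and is extensional, as the objects of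
      \<open>left_modules\<close> require.\<close>
    show "\<exists>s \<in> ?ext. \<forall>j \<in> Obj C \<times> Obj M. case_prod s j = n j" for n
      by (rule bexI[of _ "curry (restrict n (Obj C \<times> Obj M))"]) auto
  qed
  have "alg.algs = {(N, \<mu>). left_functor_module R C E F M L N \<mu> \<and>
      ftor_extensional M N \<and> case_prod \<mu> \<in> extensional (Obj C \<times> Obj M)}"
    \<comment> \<open>With the uncurried multiplication as the family \<open>n\<close>, the
      expression \<open>n (A, X)\<close> is again \<open>\<mu> A X\<close>, so algebras and modules
      coincide literally.\<close>
    using left_functor_module_iff[of _ "case_prod _"] by (auto simp: alg.algs_def has_operations_def)
  moreover have "(\<lambda>s s' f. \<forall>j \<in> Obj C \<times> Obj M. f (case j of (A, X) \<Rightarrow> A \<triangleright>\<^sub>o\<^bsub>L\<^esub> X) \<cdot>\<^bsub>E\<^esub> case_prod s j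
      = case_prod s' j \<cdot>\<^bsub>E\<^esub> amap (case j of (A, X) \<Rightarrow> tensor_left E (omap F A)) (f (snd j)))
      = left_module_map C E F M L"
    by (simp add: fun_eq_iff left_module_map_def)
  ultimately show ?thesis using alg.abelian_A by (simp add: left_modules_def)
qed

theorem abelian_right_modules:
  assumes E: "abelian_category R E" and G: "monoidal_functor R D E G"
    and K: "right_module_category R D M K"
    and ex: "\<forall>B \<in> Obj D. exact_functor E E (tensor_right E (omap G B))"
  shows "abelian_category R (right_modules R D E G M K)"
proof -
  interpret E: abelian_category R E by fact
  interpret G: monoidal_functor R D E G by fact
  interpret K: right_module_category R D M K by fact
  interpret right_operations R D E G M K "Obj M \<times> Obj D" fst "\<lambda>(X, A). X \<triangleleft>\<^sub>o\<^bsub>K\<^esub> A"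
    "\<lambda>(X, A). tensor_right E (omap G A)" Pair
  proof (intro right_operations.intro functor_operations.intro functor_operations_axioms.intro
      right_operations_axioms.intro K.action.left.linear_category_axioms E G K)
    fix j assume j: "j \<in> Obj M \<times> Obj D"
    then obtain X A where XA: "j = (X, A)" "X \<in> Obj M" "A \<in> Obj D" by blast
    note GA = G.omap_obj[OF XA(3)]
    show "fst j \<in> Obj M" "(case j of (X, A) \<Rightarrow> X \<triangleleft>\<^sub>o\<^bsub>K\<^esub> A) \<in> Obj M"
      using XA K.action.bi_obj by simp_all
    show lin: "linear_functor R E E (case j of (X, A) \<Rightarrow> tensor_right E (omap G A))"
      using G.target.tensor_right_linear[OF GA] XA(1) by simp
    show "is_cokernel E (omap (case j of (X, A) \<Rightarrow> tensor_right E (omap G A)) Y)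
        (omap (case j of (X, A) \<Rightarrow> tensor_right E (omap G A)) Z)
        (amap (case j of (X, A) \<Rightarrow> tensor_right E (omap G A)) f)
        (omap (case j of (X, A) \<Rightarrow> tensor_right E (omap G A)) Q)
        (amap (case j of (X, A) \<Rightarrow> tensor_right E (omap G A)) q)"
      if "is_cokernel E Y Z f Q q" for Y Z f Q q
      using E.exact_preserves_cokernel[OF E lin _ that] ex XA by simp
  qed auto
  let ?ext = "{\<mu>. case_prod \<mu> \<in> extensional (Obj M \<times> Obj D)}"
  interpret alg: functor_algebras R M E "Obj M \<times> Obj D" fst "\<lambda>(X, A). X \<triangleleft>\<^sub>o\<^bsub>K\<^esub> A"
    "\<lambda>(X, A). tensor_right E (omap G A)" right_equations case_prod ?ext
  proof
    show "stable right_equations" by (rule right_equations_stable)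
    show "\<exists>s \<in> ?ext. \<forall>j \<in> Obj M \<times> Obj D. case_prod s j = n j" for n
      by (rule bexI[of _ "curry (restrict n (Obj M \<times> Obj D))"]) auto
  qed
  have "alg.algs = {(N, \<mu>). right_functor_module R D E G M K N \<mu> \<and>
      ftor_extensional M N \<and> case_prod \<mu> \<in> extensional (Obj M \<times> Obj D)}"
    using right_functor_module_iff[of _ "case_prod _"] by (auto simp: alg.algs_def has_operations_def)
  moreover have "(\<lambda>s s' f. \<forall>j \<in> Obj M \<times> Obj D. f (case j of (X, A) \<Rightarrow> X \<triangleleft>\<^sub>o\<^bsub>K\<^esub> A) \<cdot>\<^bsub>E\<^esub> case_prod s j
      = case_prod s' j \<cdot>\<^bsub>E\<^esub> amap (case j of (X, A) \<Rightarrow> tensor_right E (omap G A)) (f (fst j)))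
      = right_module_map D E G M K"
    by (simp add: fun_eq_iff right_module_map_def)
  ultimately show ?thesis using alg.abelian_A by (simp add: right_modules_def)
qed

theorem abelian_bimodules:
  assumes E: "abelian_category R E" and F: "monoidal_functor R C E F" and G: "monoidal_functor R D E G"
    and M: "bimodule_category R C D M L K am"
    and exF: "\<forall>A \<in> Obj C. exact_functor E E (tensor_left E (omap F A))"
    and exG: "\<forall>B \<in> Obj D. exact_functor E E (tensor_right E (omap G B))"
  shows "abelian_category R (bimodules R C D E F G M L K am)"
proof -
  interpret E: abelian_category R E by fact
  interpret F: monoidal_functor R C E F by fact
  interpret G: monoidal_functor R D E G by fact
  interpret M: bimodule_category R C D M L K am by fact
  \<comment> \<open>The disjoint union keeps the left and right multiplications apart within one
    family of operations; \<open>case_sum\<close> chooses source, target and functor by the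
    side.\<close>
  let ?J = "(Obj C \<times> Obj M) <+> (Obj M \<times> Obj D)"
  let ?src = "case_sum snd fst"
  let ?tgt = "case_sum (\<lambda>(A, X). A \<triangleright>\<^sub>o\<^bsub>L\<^esub> X) (\<lambda>(X, B). X \<triangleleft>\<^sub>o\<^bsub>K\<^esub> B)"
  let ?T = "case_sum (\<lambda>(A, X). tensor_left E (omap F A)) (\<lambda>(X, B). tensor_right E (omap G B))"
  have ops: "functor_operations R M E ?J ?src ?tgt ?T"
  proof (intro functor_operations.intro functor_operations_axioms.intro
      M.left.action.right.linear_category_axioms E)
    fix j assume "j \<in> ?J"
    then consider (l) A X where "j = Inl (A, X)" "A \<in> Obj C" "X \<in> Obj M"
      | (r) X B where "j = Inr (X, B)" "X \<in> Obj M" "B \<in> Obj D" by blast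
    then have j: "?src j \<in> Obj M \<and> ?tgt j \<in> Obj M \<and> linear_functor R E E (?T j) \<and> exact_functor E E (?T j)"
    proof cases
      case l
      then show ?thesis
        using exF F.target.tensor_left_linear[OF F.omap_obj] M.left.action.bi_obj by simp
    next
      case r
      then show ?thesis
        using exG F.target.tensor_right_linear[OF G.omap_obj] M.right.action.bi_obj by simp
    qed
    then show "?src j \<in> Obj M" "?tgt j \<in> Obj M" and lin: "linear_functor R E E (?T j)" by blast+
    have ex: "exact_functor E E (?T j)" using j by blast
    show "is_cokernel E (omap (?T j) Y) (omap (?T j) Z) (amap (?T j) f) (omap (?T j) Q) (amap (?T j) q)"
      if "is_cokernel E Y Z f Q q" for Y Z f Q q
      by (rule E.exact_preserves_cokernel[OF E lin ex that])
  qed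
  interpret bimodule_operations R C D E F G M L K am ?J ?src ?tgt ?T "\<lambda>A X. Inl (A, X)" "\<lambda>X B. Inr (X, B)"
    by (intro bimodule_operations.intro left_operations.intro right_operations.intro
        left_operations_axioms.intro right_operations_axioms.intro ops F G M
        M.left.left_module_category_axioms M.right.right_module_category_axioms) auto
  \<comment> \<open>A pair of curried multiplications becomes one family over the disjoint union,
    matching the pairs carried by objects of \<open>bimodules\<close>.\<close>
  let ?dec = "\<lambda>(\<mu>l, \<mu>r). case_sum (case_prod \<mu>l) (case_prod \<mu>r)"
  let ?ext = "{(\<mu>l, \<mu>r). case_prod \<mu>l \<in> extensional (Obj C \<times> Obj M) \<and>
    case_prod \<mu>r \<in> extensional (Obj M \<times> Obj D)}"
  let ?eqs = "\<lambda>N n. left.left_equations N n \<and> right.right_equations N n \<and> compatible N n"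
  interpret alg: functor_algebras R M E ?J ?src ?tgt ?T ?eqs ?dec ?ext
  proof
    show "left.stable ?eqs"
      by (intro left.stable_conj left.left_equations_stable right.right_equations_stable compatible_stable)
    show "\<exists>s \<in> ?ext. \<forall>j \<in> ?J. ?dec s j = n j" for n
      by (rule bexI[of _ "(curry (restrict (\<lambda>p. n (Inl p)) (Obj C \<times> Obj M)),
            curry (restrict (\<lambda>p. n (Inr p)) (Obj M \<times> Obj D)))"]) auto
  qed
  \<comment> \<open>Splits a condition over the index set into its left and right halves, as in the
    definitions of bimodules and of their maps.\<close>
  have ball_J: "(\<forall>j \<in> ?J. P j) \<longleftrightarrow>
      (\<forall>A \<in> Obj C. \<forall>X \<in> Obj M. P (Inl (A, X))) \<and> (\<forall>X \<in> Obj M. \<forall>B \<in> Obj D. P (Inr (X, B)))" for P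
    by blast
  have algs: "alg.algs = {(N, \<mu>l, \<mu>r). functor_bimodule R C D E F G M L K am N \<mu>l \<mu>r \<and>
      ftor_extensional M N \<and> case_prod \<mu>l \<in> extensional (Obj C \<times> Obj M) \<and>
      case_prod \<mu>r \<in> extensional (Obj M \<times> Obj D)}"
  proof -
    have "functor_bimodule R C D E F G M L K am N \<mu>l \<mu>r \<longleftrightarrow>
      left.has_operations N (?dec (\<mu>l, \<mu>r)) \<and> ?eqs N (?dec (\<mu>l, \<mu>r))" for N \<mu>l \<mu>r
      using functor_bimodule_iff[of N "?dec (\<mu>l, \<mu>r)"] left.left_functor_module_iff[of N "?dec (\<mu>l, \<mu>r)"]
        right.right_functor_module_iff[of N "?dec (\<mu>l, \<mu>r)"]
      unfolding left.has_operations_def ball_J by simp blast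
    then show ?thesis unfolding alg.algs_def by auto
  qed
  have maps: "(\<lambda>s s' f. \<forall>j \<in> ?J. f (?tgt j) \<cdot>\<^bsub>E\<^esub> ?dec s j = ?dec s' j \<cdot>\<^bsub>E\<^esub> amap (?T j) (f (?src j)))
      = (\<lambda>(\<mu>l, \<mu>r) (\<nu>l, \<nu>r) f. left_module_map C E F M L \<mu>l \<nu>l f \<and> right_module_map D E G M K \<mu>r \<nu>r f)"
    unfolding ball_J by (simp add: fun_eq_iff left_module_map_def right_module_map_def)
  show ?thesis using alg.abelian_A unfolding algs maps bimodules_def .
qed

text \<open>The module categories are quantified inside the statement, where types are fixed.
  Separate type variables for the three parts let each part choose its types independently.\<close>

theorem theorem41:
  fixes R :: "('r, 'm) ring_scheme"
    and C :: "('r, 'co, 'ca) moncat"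
    and D :: "('r, 'do, 'da) moncat"
    and E :: "('r, 'eo, 'ea) moncat"
    and F :: "('co, 'ca, 'eo, 'ea) lax_ftor"
    and G :: "('do, 'da, 'eo, 'ea) lax_ftor"
  assumes "monoidal_category R C"
    and "monoidal_category R D"
    and "abelian_category R E"
    and "monoidal_category R E"
    and "monoidal_functor R C E F"
    and "monoidal_functor R D E G"
  shows "((\<forall>A \<in> Obj C. exact_functor E E (tensor_left E (omap F A))) \<longrightarrow>
            (\<forall>(M :: ('r, 'mo1, 'ma1) lincat) (L :: ('co, 'ca, 'mo1, 'ma1) lact).
               left_module_category R C M L \<longrightarrow>
               abelian_category R (left_modules R C E F M L))) \<and>
         ((\<forall>B \<in> Obj D. exact_functor E E (tensor_right E (omap G B))) \<longrightarrow>
            (\<forall>(M :: ('r, 'mo2, 'ma2) lincat) (T :: ('do, 'da, 'mo2, 'ma2) ract).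
               right_module_category R D M T \<longrightarrow>
               abelian_category R (right_modules R D E G M T))) \<and>
         ((\<forall>A \<in> Obj C. exact_functor E E (tensor_left E (omap F A))) \<and>
          (\<forall>B \<in> Obj D. exact_functor E E (tensor_right E (omap G B))) \<longrightarrow>
            (\<forall>(M :: ('r, 'mo3, 'ma3) lincat) (L :: ('co, 'ca, 'mo3, 'ma3) lact)
              (T :: ('do, 'da, 'mo3, 'ma3) ract) am.
               bimodule_category R C D M L T am \<longrightarrow>
               abelian_category R (bimodules R C D E F G M L T am)))"
  using abelian_left_modules[OF assms(3,5)] abelian_right_modules[OF assms(3,6)]
    abelian_bimodules[OF assms(3,5,6)]
  by (intro conjI impI allI; (elim conjE)?) simp_all

end
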